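(* Let $A=\{\mathbf a_1,\ldots,\mathbf a_N\}\subset\mathbb Z^r$ be a finite set of $N>r$ vectors whose $\mathbb Z$-span is $\mathbb Z^r$ and for which there is a linear form $h$ with $h(\mathbf a_i)=1$ for all $i$. Let $\alpha\in\mathbb C^r$. Suppose that the A-hypergeometric system $H_A(\alpha)$ is non-resonant. Then $H_A(\alpha)$ is irreducible.
   Context: Write $\mathbf a_j=(a_{1j},\ldots,a_{rj})^T$ and $\partial_j=\partial/\partial v_j$ for $j=1,\ldots,N$. Put $Z_i=\sum_{j=1}^N a_{ij}v_j\partial_j$ for $i=1,\ldots,r$. Let $L=\{(l_1,\ldots,l_N)\in\mathbb Z^N : \sum_j l_j\mathbf a_j=\mathbf 0\}$ and, for $\mathbf l\in L$, let $\Box_{\mathbf l}=\prod_{l_i>0}\partial_i^{l_i}-\prod_{l_i<0}\partial_i^{-l_i}$. The A-hypergeometric system $H_A(\alpha)$, $\alpha=(\alpha_1,\ldots,\alpha_r)$, is the system of differential equations $(Z_i-\alpha_i)\Phi=0$ $(i=1,\ldots,r)$ and $\Box_{\mathbf l}\Phi=0$ $(\mathbf l\in L)$. Let $K=\mathbb C(v_1,\ldots,v_N)$, let $K[\partial_1,\ldots,\partial_N]$ be the (noncommutative) ring of linear differential operators with coefficients in $K$, and let $\mathcal H_A(\alpha)$ be its left ideal generated by all $Z_i-\alpha_i$ and all $\Box_{\mathbf l}$. The quotient $K[\partial_1,\ldots,\partial_N]/\mathcal H_A(\alpha)$ is a $K$-module with a natural left action of the operators $\partial_i$, so it is a D-module.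 The system $H_A(\alpha)$ is called irreducible if this D-module has no submodules besides $0$ and the module itself. Let $C(A)=\{\sum_j\lambda_j\mathbf a_j:\lambda_j\in\mathbb R_{\ge0}\}\subset\mathbb R^r$ be the positive cone of $A$. The system $H_A(\alpha)$ is called non-resonant if the set $\alpha+\mathbb Z^r$ has empty intersection with the boundary of $C(A)$.
   Formalization: Non-resonant is taken to mean that α+ℤ^r misses the complex linear span of every facet of C(A); for real α this is the stated condition, while for non-real α the stated one can hold vacuously and the claim then fails, e.g. A={(1,0),(1,1),(1,2)}, α=(i,0). *)

theory Defs
  imports "HOL-Analysis.Analysis" "HOL-Algebra.AbelCoset" "HOL-Algebra.Module"
    "HOL-Library.Poly_Mapping" "HOL-Computational_Algebra.Fraction_Field"
begin

section \<open>Rational functions and their partial derivatives\<close>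

text \<open>
  A finite index type \<open>'n\<close> plays the role of \<open>{1, \<dots>, N}\<close>; its linear order (needed for the
  library's \<open>idom\<close> instance on polynomials) has no mathematical significance.
\<close>

type_synonym 'n mpol = "('n \<Rightarrow>\<^sub>0 nat) \<Rightarrow>\<^sub>0 complex"
type_synonym 'n ratfun = "'n mpol fract"

lift_definition mpol_deriv :: "'n::linorder \<Rightarrow> 'n mpol \<Rightarrow> 'n mpol"
  is "\<lambda>i p m. of_nat (Poly_Mapping.lookup m i + 1) * p (m + Poly_Mapping.single i 1)"
proof -
  fix i :: 'n and p :: "('n \<Rightarrow>\<^sub>0 nat) \<Rightarrow> complex"
  assume "finite {m. p m \<noteq> 0}"
  then have "finite ((\<lambda>m. m + Poly_Mapping.single i (1::nat)) -` {m. p m \<noteq> 0})"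
    by (rule finite_vimageI) (simp add: inj_on_def)
  then show "finite {m. of_nat (Poly_Mapping.lookup m i + 1) * p (m + Poly_Mapping.single i 1) \<noteq> 0}"
    by (rule rev_finite_subset) auto
qed

text \<open>
  Coefficient form of the partial derivative: the coefficient of \<open>v\<^sup>m\<close> in \<open>\<partial>p/\<partial>v\<^sub>i\<close> is
  \<open>(m\<^sub>i + 1)\<close> times the coefficient of \<open>v\<^sup>m v\<^sub>i\<close> in \<open>p\<close>; see \<open>mpol_deriv_single\<close>.
\<close>

lemma mpol_deriv_0: "mpol_deriv i 0 = 0"
  by (rule poly_mapping_eqI) (simp add: mpol_deriv.rep_eq)

lemma mpol_deriv_add: "mpol_deriv i (p + q) = mpol_deriv i p + mpol_deriv i q"
  by (rule poly_mapping_eqI) (simp add: mpol_deriv.rep_eq lookup_add algebra_simps)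

lemma mpol_deriv_single:
  "mpol_deriv i (Poly_Mapping.single m c) =
    Poly_Mapping.single (m - Poly_Mapping.single i 1) (of_nat (Poly_Mapping.lookup m i) * c)"
proof (rule poly_mapping_eqI)
  fix k
  let ?e = "Poly_Mapping.single i (1::nat)"
  show "Poly_Mapping.lookup (mpol_deriv i (Poly_Mapping.single m c)) k =
      Poly_Mapping.lookup (Poly_Mapping.single (m - ?e) (of_nat (Poly_Mapping.lookup m i) * c)) k"
  proof (cases "Poly_Mapping.lookup m i = 0")
    case True
    then have "m \<noteq> k + ?e" by (auto simp: lookup_add)
    then show ?thesis using True by (simp add: mpol_deriv.rep_eq lookup_single)
  next
    case False
    then have "m = (m - ?e) + ?e"
      by (intro poly_mapping_eqI) (auto simp: lookup_add lookup_minus lookup_single when_def)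
    then have "m = k + ?e \<longleftrightarrow> m - ?e = k" by (metis add_diff_cancel_right')
    moreover have "Poly_Mapping.lookup m i = Poly_Mapping.lookup k i + 1" if "m = k + ?e" using that by (simp add: lookup_add)
    ultimately show ?thesis by (auto simp: mpol_deriv.rep_eq lookup_single when_def)
  qed
qed

lemma mpol_induct:
  fixes p :: "'a \<Rightarrow>\<^sub>0 'b::comm_monoid_add"
  assumes "P 0" and "\<And>m c. P (Poly_Mapping.single m c)" and "\<And>p q. P p \<Longrightarrow> P q \<Longrightarrow> P (p + q)"
  shows "P p"
proof (induction p rule: update_induct)
  case const then show ?case using assms(1) .
next
  case (update f a b)
  have "Poly_Mapping.update a b f = f + Poly_Mapping.single a b"
    using update(1) by (intro poly_mapping_eqI) (auto simp: lookup_update lookup_add lookup_single when_def in_keys_iff)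
  then show ?case using assms(2,3) update by simp
qed

lemma mpol_deriv_mult: "mpol_deriv i (p * q) = mpol_deriv i p * q + p * mpol_deriv i q"
proof (induction p rule: mpol_induct)
  case (2 m c)
  show ?case
  proof (induction q rule: mpol_induct)
    case (2 k d)
    let ?e = "Poly_Mapping.single i (1::nat)"
    have sh: "a + b - ?e = (a - ?e) + b" if "Poly_Mapping.lookup a i \<noteq> 0" for a b
      using that by (intro poly_mapping_eqI) (auto simp: lookup_add lookup_minus lookup_single when_def)
    have 1: "Poly_Mapping.single (m + k - ?e) (of_nat (Poly_Mapping.lookup m i) * c * d) =
        Poly_Mapping.single (m - ?e + k) (of_nat (Poly_Mapping.lookup m i) * c * d)"
      by (cases "Poly_Mapping.lookup m i = 0") (simp_all add: sh[simplified])
    have 2: "Poly_Mapping.single (m + k - ?e) (of_nat (Poly_Mapping.lookup k i) * c * d) =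
        Poly_Mapping.single (m + (k - ?e)) (of_nat (Poly_Mapping.lookup k i) * c * d)"
      using sh[of k m, simplified] by (cases "Poly_Mapping.lookup k i = 0") (simp_all add: add.commute)
    show ?case
      using 1 2
      by (simp add: mpol_deriv_single mult_single lookup_add single_add[symmetric] algebra_simps)
         (simp add: single_add distrib_right)
  qed (simp_all add: mpol_deriv_0 mpol_deriv_add algebra_simps)
qed (simp_all add: mpol_deriv_0 mpol_deriv_add algebra_simps)

lemma quotient_rule_aux:
  fixes p q r s :: "'a::comm_ring_1"
  assumes d: "p' * s + p * s' = r' * q + r * q'" and eq: "p * s = r * q"
  shows "(p' * q - p * q') * (s * s) = (r' * s - r * s') * (q * q)"
proof -
  have "(p' * q - p * q') * (s * s) = (p' * s + p * s') * (q * s) - (p * s) * (s' * q + q' * s)"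
    by (simp add: algebra_simps)
  also have "\<dots> = (r' * q + r * q') * (q * s) - (r * q) * (s' * q + q' * s)"
    by (simp only: d eq)
  also have "\<dots> = (r' * s - r * s') * (q * q)"
    by (simp add: algebra_simps)
  finally show ?thesis .
qed

lift_definition pd :: "'n::linorder \<Rightarrow> 'n ratfun \<Rightarrow> 'n ratfun"
  is "\<lambda>i (p, q). (mpol_deriv i p * q - p * mpol_deriv i q, q * q)"
proof -
  fix i :: 'n and x y :: "'n mpol \<times> 'n mpol"
  obtain p q where x: "x = (p, q)" by fastforce
  obtain r s where y: "y = (r, s)" by fastforce
  assume "fractrel x y"
  then have nz: "q \<noteq> 0" "s \<noteq> 0" and eq: "p * s = r * q" by (simp_all add: x y)
  have "mpol_deriv i p * s + p * mpol_deriv i s = mpol_deriv i r * q + r * mpol_deriv i q"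
    using arg_cong[OF eq, of "mpol_deriv i"] by (simp add: mpol_deriv_mult)
  then have "(mpol_deriv i p * q - p * mpol_deriv i q) * (s * s) = (mpol_deriv i r * s - r * mpol_deriv i s) * (q * q)"
    using eq by (rule quotient_rule_aux)
  then show "fractrel (case x of (p, q) \<Rightarrow> (mpol_deriv i p * q - p * mpol_deriv i q, q * q))
     (case y of (p, q) \<Rightarrow> (mpol_deriv i p * q - p * mpol_deriv i q, q * q))"
    using nz by (simp add: x y)
qed

lemma mpol_deriv_one: "mpol_deriv i 1 = 0"
  using mpol_deriv_single[of i 0 1] by simp

lemma pd_Fract: "q \<noteq> 0 \<Longrightarrow> pd i (Fract p q) = Fract (mpol_deriv i p * q - p * mpol_deriv i q) (q * q)"
  by (simp add: Fract.abs_eq pd.abs_eq)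

lemma pd_add: "pd i (f + g) = pd i f + pd i g"
proof -
  obtain p q where f: "f = Fract p q" "q \<noteq> 0" by (cases f)
  obtain r s where g: "g = Fract r s" "s \<noteq> 0" by (cases g)
  have aux: "(p' * s + p * s' + (r' * q + r * q')) * (q * s) - (p * s + r * q) * (q' * s + q * s') =
      (p' * q - p * q') * (s * s) + (r' * s - r * s') * (q * q)" for p' q' r' s'
    by (simp add: algebra_simps)
  have "pd i (f + g) = Fract ((mpol_deriv i p * q - p * mpol_deriv i q) * (s * s) +
      (mpol_deriv i r * s - r * mpol_deriv i s) * (q * q)) ((q * s) * (q * s))"
    using f g by (simp only: add_fract pd_Fract mult_eq_0_iff mpol_deriv_add mpol_deriv_mult aux simp_thms)
  also have "\<dots> = pd i f + pd i g"
    using f g by (simp add: pd_Fract mult.assoc mult.left_commute)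
  finally show ?thesis .
qed

lemma pd_mult: "pd i (f * g) = pd i f * g + f * pd i g"
  by (cases f; cases g) (simp add: pd_Fract eq_fract mpol_deriv_add mpol_deriv_mult algebra_simps)

lemma mpol_deriv_commute: "mpol_deriv i (mpol_deriv j p) = mpol_deriv j (mpol_deriv i p)"
proof (cases "i = j")
  case False
  then show ?thesis
    by (intro poly_mapping_eqI)
      (simp add: mpol_deriv.rep_eq lookup_add lookup_single when_def add.commute add.left_commute mult.left_commute)
qed simp

lemma mpol_deriv_uminus: "mpol_deriv i (- p) = - mpol_deriv i p"
  by (rule poly_mapping_eqI) (simp add: mpol_deriv.rep_eq)

lemma mpol_deriv_diff: "mpol_deriv i (p - q) = mpol_deriv i p - mpol_deriv i q"
  by (rule poly_mapping_eqI) (simp add: mpol_deriv.rep_eq lookup_minus algebra_simps)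

lemma pd_commute: "pd i (pd j f) = pd j (pd i f)"
proof (cases f)
  case (Fract p q)
  define Q where "Q = Fract q 1"
  have "Q \<noteq> 0" using Fract by (simp add: Q_def Zero_fract_def eq_fract)
  have *: "pd i (pd j (Fract r 1)) = pd j (pd i (Fract r 1))" for r
    by (simp add: pd_Fract mpol_deriv_one mpol_deriv_commute[of i j])
  have "f * Q = Fract p 1" using Fract by (simp add: Q_def eq_fract)
  then have "pd i (pd j (f * Q)) = pd j (pd i (f * Q))" by (simp add: *)
  then have "pd i (pd j f) * Q + f * pd i (pd j Q) = pd j (pd i f) * Q + f * pd j (pd i Q)"
    by (simp add: pd_mult pd_add algebra_simps)
  then show ?thesis using \<open>Q \<noteq> 0\<close> *[of q] by (simp add: Q_def)
qed

definition scalar :: "complex \<Rightarrow> 'n::linorder ratfun"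
  where "scalar c = Fract (Poly_Mapping.single 0 c) 1"

definition var :: "'n::linorder \<Rightarrow> 'n ratfun"
  where "var j = Fract (Poly_Mapping.single (Poly_Mapping.single j 1) 1) 1"

lemma pd_scalar: "pd i (scalar c) = 0"
  by (simp add: scalar_def pd_Fract mpol_deriv_one mpol_deriv_single Zero_fract_def)

lemma pd_var: "pd i (var j) = (if i = j then 1 else 0)"
  by (auto simp: var_def pd_Fract mpol_deriv_one mpol_deriv_single lookup_single Zero_fract_def One_fract_def when_def)

section \<open>The ring of linear differential operators\<close>

text \<open>
  \<open>dpow m\<close> is \<open>\<Prod>\<^sub>j \<partial>\<^sub>j ^ m\<^sub>j\<close>; the order of the factors is irrelevant by \<open>pd_commute\<close>.
  Differential operators are represented by their action on the field of rational functions.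
  This representation is faithful: the \<open>dpow m\<close> are linearly independent over that field
  (\<open>dpow_independent\<close> below), so the ring is \<open>K[\<partial>\<^sub>1, \<dots>, \<partial>\<^sub>N]\<close>, free as a left \<open>K\<close>-module on the
  monomials in the \<open>\<partial>\<^sub>j\<close>.
\<close>

definition dpow :: "('n::{finite,linorder} \<Rightarrow> nat) \<Rightarrow> 'n ratfun \<Rightarrow> 'n ratfun"
  where "dpow m = foldr (\<lambda>j P. (pd j ^^ m j) \<circ> P) (sorted_list_of_set UNIV) id"

definition diffop_ring :: "('n::{finite,linorder} ratfun \<Rightarrow> 'n ratfun) ring"
  where "diffop_ring =
    \<lparr>carrier = {(\<lambda>f. \<Sum>m\<in>S. c m * dpow m f) | S c. finite S},
     mult = (\<circ>), one = id, zero = (\<lambda>f. 0), add = (\<lambda>P Q f. P f + Q f)\<rparr>"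

lemma pd_sum: "pd i (sum g S) = (\<Sum>s\<in>S. pd i (g s))"
proof -
  have "pd i 0 = 0" by (simp add: Zero_fract_def pd_Fract mpol_deriv_0 mpol_deriv_one)
  then show ?thesis by (induction S rule: infinite_finite_induct) (auto simp: pd_add)
qed

lemma pd_pow_commute: "pd i ((pd j ^^ k) f) = (pd j ^^ k) (pd i f)"
  by (induction k) (simp_all add: pd_commute[of i j])

lemma pd_dpow: "pd i (dpow m f) = dpow (m(i := Suc (m i))) f"
proof -
  define G where "G m xs = foldr (\<lambda>j P. (pd j ^^ m j) \<circ> P) xs id"
    for m :: "'a \<Rightarrow> nat" and xs
  have G_Cons: "G m (x # xs) f = (pd x ^^ m x) (G m xs f)" for m x xs f
    by (simp add: G_def)
  define n where "n = m(i := Suc (m i))"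
  have n: "n i = Suc (m i)" "\<And>j. j \<noteq> i \<Longrightarrow> n j = m j" by (simp_all add: n_def)
  have notin: "G n xs f = G m xs f" if "i \<notin> set xs" for xs
    using that
  proof (induction xs)
    case (Cons x xs)
    then show ?case using n(2)[of x] by (auto simp: G_Cons)
  qed (simp add: G_def)
  have "pd i (G m xs f) = G n xs f" if "i \<in> set xs" "distinct xs" for xs
    using that
  proof (induction xs)
    case (Cons x xs)
    then show ?case
      by (cases "x = i") (auto simp: G_Cons notin n pd_pow_commute)
  qed simp
  then show ?thesis by (simp add: dpow_def G_def n_def)
qed

abbreviation dops :: "('n::{finite,linorder} ratfun \<Rightarrow> 'n ratfun) set"
  where "dops \<equiv> carrier diffop_ring"

lemma dopsI: "finite S \<Longrightarrow> (\<lambda>f. \<Sum>m\<in>S. c m * dpow m f) \<in> dops"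
  by (auto simp: diffop_ring_def)

lemma dopsE:
  assumes "P \<in> dops"
  obtains S c where "finite S" "P = (\<lambda>f. \<Sum>m\<in>S. c m * dpow m f)"
  using assms by (auto simp: diffop_ring_def)

lemma dops_zero: "(\<lambda>f. 0) \<in> dops"
  using dopsI[of "{}"] by simp

lemma dops_add:
  assumes "P \<in> dops" "Q \<in> dops" shows "(\<lambda>f. P f + Q f) \<in> dops"
proof -
  from assms(1) obtain S c where S: "finite S" and P: "P = (\<lambda>f. \<Sum>m\<in>S. c m * dpow m f)"
    by (rule dopsE)
  from assms(2) obtain T d where T: "finite T" and Q: "Q = (\<lambda>f. \<Sum>m\<in>T. d m * dpow m f)"
    by (rule dopsE)
  note fin = S T
  have "(\<Sum>m\<in>S. c m * dpow m f) = (\<Sum>m\<in>S \<union> T. (if m \<in> S then c m else 0) * dpow m f)" for f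
    using fin by (intro sum.mono_neutral_cong_left) auto
  moreover have "(\<Sum>m\<in>T. d m * dpow m f) = (\<Sum>m\<in>S \<union> T. (if m \<in> T then d m else 0) * dpow m f)" for f
    using fin by (intro sum.mono_neutral_cong_left) auto
  ultimately have "(\<lambda>f. P f + Q f) = (\<lambda>f. \<Sum>m\<in>S \<union> T. ((if m \<in> S then c m else 0) + (if m \<in> T then d m else 0)) * dpow m f)"
    by (simp add: P Q distrib_right sum.distrib)
  then show ?thesis using fin by (simp add: dopsI)
qed

lemma dops_smult:
  assumes "P \<in> dops" shows "(\<lambda>f. g * P f) \<in> dops"
proof -
  from assms obtain S c where "finite S" and P: "P = (\<lambda>f. \<Sum>m\<in>S. c m * dpow m f)"
    by (rule dopsE)
  then show ?thesis using dopsI[of S "\<lambda>m. g * c m"] by (simp add: sum_distrib_left mult.assoc)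
qed

lemma dops_sum: "(\<And>s. s \<in> S \<Longrightarrow> P s \<in> dops) \<Longrightarrow> (\<lambda>f. \<Sum>s\<in>S. P s f) \<in> dops"
  by (induction S rule: infinite_finite_induct) (auto simp: dops_zero intro: dops_add)

lemma dops_dpow: "dpow m \<in> dops"
  using dopsI[of "{m}" "\<lambda>_. 1"] by simp

lemma dpow_0: "dpow (\<lambda>_. 0) = id"
proof -
  have "foldr (\<lambda>j P. (pd j ^^ 0) \<circ> P) xs id = id" for xs :: "'a list"
    by (induction xs) auto
  then show ?thesis by (simp add: dpow_def)
qed

lemma dops_id: "id \<in> dops"
  using dops_dpow[of "\<lambda>_. 0"] by (simp add: dpow_0)

lemma dops_pd: "pd i \<in> dops"
proof -
  have "pd i = dpow ((\<lambda>_. 0)(i := Suc 0))"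
    using pd_dpow[of i "\<lambda>_. 0"] by (simp add: dpow_0 fun_eq_iff)
  then show ?thesis using dops_dpow by simp
qed

lemma dops_pd_comp:
  assumes "P \<in> dops" shows "(\<lambda>f. pd i (P f)) \<in> dops"
proof -
  from assms obtain S c where "finite S" and P: "P = (\<lambda>f. \<Sum>m\<in>S. c m * dpow m f)"
    by (rule dopsE)
  have *: "(\<lambda>f. pd i (c m) * dpow m f + c m * dpow (m(i := Suc (m i))) f) \<in> dops" for m
    by (rule dops_add[OF dops_smult[OF dops_dpow] dops_smult[OF dops_dpow]])
  have "(\<lambda>f. pd i (P f)) = (\<lambda>f. \<Sum>m\<in>S. pd i (c m) * dpow m f + c m * dpow (m(i := Suc (m i))) f)"
    by (simp add: P pd_sum pd_mult pd_dpow)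
  with dops_sum[where S = S, OF *] show ?thesis by simp
qed

lemma dops_dpow_comp:
  assumes "P \<in> dops" shows "dpow m \<circ> P \<in> dops"
proof -
  have pow: "(pd j ^^ k) \<circ> Q \<in> dops" if "Q \<in> dops" for j k and Q :: "'a ratfun \<Rightarrow> 'a ratfun"
    
  proof (induction k)
    case (Suc k)
    from dops_pd_comp[OF Suc.IH[OF Suc.prems], of j] show ?case by (simp add: comp_def)
  qed (use that in simp)
  define G where "G xs = foldr (\<lambda>j P. (pd j ^^ m j) \<circ> P) xs id" for xs
  have G_Cons: "G (x # xs) \<circ> P = (pd x ^^ m x) \<circ> (G xs \<circ> P)" for x xs
    by (simp add: G_def comp_assoc)
  have "G xs \<circ> P \<in> dops" for xs
  proof (induction xs)
    case Nil
    then show ?case using assms by (simp add: G_def)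
  qed (simp only: G_Cons pow)
  then show ?thesis by (simp add: dpow_def G_def)
qed

lemma dops_comp:
  assumes "P \<in> dops" "Q \<in> dops" shows "P \<circ> Q \<in> dops"
proof -
  from assms(1) obtain S c where "finite S" and P: "P = (\<lambda>f. \<Sum>m\<in>S. c m * dpow m f)"
    by (rule dopsE)
  have *: "(\<lambda>f. c m * (dpow m \<circ> Q) f) \<in> dops" for m
    by (rule dops_smult[OF dops_dpow_comp[OF assms(2)]])
  have "P \<circ> Q = (\<lambda>f. \<Sum>m\<in>S. c m * (dpow m \<circ> Q) f)" by (simp add: P fun_eq_iff)
  with dops_sum[where S = S, OF *] show ?thesis by simp
qed

lemma dpow_add: "dpow m (f + g) = dpow m f + dpow m g"
proof -
  have pow: "(pd j ^^ k) (f + g) = (pd j ^^ k) f + (pd j ^^ k) g" for j k and f g :: "'a ratfun"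
    by (induction k) (simp_all add: pd_add)
  have "foldr (\<lambda>j P. (pd j ^^ m j) \<circ> P) xs id (f + g) =
      foldr (\<lambda>j P. (pd j ^^ m j) \<circ> P) xs id f + foldr (\<lambda>j P. (pd j ^^ m j) \<circ> P) xs id g" for xs
    by (induction xs) (simp_all add: pow)
  then show ?thesis by (simp add: dpow_def)
qed

lemma dops_additive: "P \<in> dops \<Longrightarrow> P (f + g) = P f + P g"
  by (erule dopsE) (simp add: dpow_add distrib_left sum.distrib)

lemma ring_diffop_ring: "ring (diffop_ring :: ('n::{finite,linorder} ratfun \<Rightarrow> 'n ratfun) ring)"
proof (rule ringI)
  show "abelian_group (diffop_ring :: ('n ratfun \<Rightarrow> 'n ratfun) ring)"
  proof (rule abelian_groupI)
    fix P :: "'n ratfun \<Rightarrow> 'n ratfun"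
    assume "P \<in> dops"
    then have "(\<lambda>f. (- 1) * P f) \<in> dops" by (rule dops_smult)
    then show "\<exists>Q\<in>dops. Q \<oplus>\<^bsub>diffop_ring\<^esub> P = \<zero>\<^bsub>diffop_ring\<^esub>"
      by (rule rev_bexI) (simp add: diffop_ring_def)
  next
    fix P Q :: "'n ratfun \<Rightarrow> 'n ratfun"
    assume "P \<in> dops" "Q \<in> dops"
    from dops_add[OF this] show "P \<oplus>\<^bsub>diffop_ring\<^esub> Q \<in> dops" by (simp add: diffop_ring_def)
  next
    show "\<zero>\<^bsub>diffop_ring\<^esub> \<in> (dops :: ('n ratfun \<Rightarrow> 'n ratfun) set)" using dops_zero by (simp add: diffop_ring_def)
  qed (simp_all add: diffop_ring_def add_ac)
  show "Group.monoid (diffop_ring :: ('n ratfun \<Rightarrow> 'n ratfun) ring)"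
  proof (rule monoidI)
    fix P Q :: "'n ratfun \<Rightarrow> 'n ratfun"
    assume "P \<in> dops" "Q \<in> dops"
    from dops_comp[OF this] show "P \<otimes>\<^bsub>diffop_ring\<^esub> Q \<in> dops" by (simp add: diffop_ring_def)
  next
    show "\<one>\<^bsub>diffop_ring\<^esub> \<in> (dops :: ('n ratfun \<Rightarrow> 'n ratfun) set)" using dops_id by (simp add: diffop_ring_def)
  qed (simp_all add: diffop_ring_def comp_assoc)
next
  fix P Q R :: "'n ratfun \<Rightarrow> 'n ratfun"
  assume "R \<in> dops"
  then show "R \<otimes>\<^bsub>diffop_ring\<^esub> (P \<oplus>\<^bsub>diffop_ring\<^esub> Q) =
      R \<otimes>\<^bsub>diffop_ring\<^esub> P \<oplus>\<^bsub>diffop_ring\<^esub> R \<otimes>\<^bsub>diffop_ring\<^esub> Q"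
    by (simp add: diffop_ring_def fun_eq_iff dops_additive[unfolded diffop_ring_def])
qed (simp_all add: diffop_ring_def fun_eq_iff)


lemma lookup_mpol_deriv_pow:
  "\<exists>w. \<forall>t. w t > (0::nat) \<and> (\<forall>p. Poly_Mapping.lookup ((mpol_deriv j ^^ k) p) t =
    of_nat (w t) * Poly_Mapping.lookup p (t + Poly_Mapping.single j k))"
proof (induction k)
  case 0
  show ?case by (rule exI[of _ "\<lambda>_. 1"]) simp
next
  case (Suc k)
  then obtain w where w: "\<And>t. w t > (0::nat)"
      "\<And>p t. Poly_Mapping.lookup ((mpol_deriv j ^^ k) p) t =
        of_nat (w t) * Poly_Mapping.lookup p (t + Poly_Mapping.single j k)" by metis
  have e: "Poly_Mapping.single j (1 :: nat) + Poly_Mapping.single j k = Poly_Mapping.single j (Suc k)"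
    by (simp flip: single_add)
  show ?case
    by (rule exI[of _ "\<lambda>t. (Poly_Mapping.lookup t j + 1) * w (t + Poly_Mapping.single j 1)"])
      (simp only: funpow.simps comp_apply mpol_deriv.rep_eq w of_nat_mult add.assoc e mult.assoc,
       simp add: w)
qed

lemma dpow_poly:
  fixes m :: "'n::{finite,linorder} \<Rightarrow> nat"
  defines "X \<equiv> \<lambda>m. \<Sum>j\<in>UNIV. Poly_Mapping.single j (m j)"
  shows "\<exists>q w. dpow m (Fract p 1) = Fract q 1 \<and>
    (\<forall>t. w t > (0::nat) \<and> Poly_Mapping.lookup q t = of_nat (w t) * Poly_Mapping.lookup p (t + X m))"
proof -
  define G where "G xs = foldr (\<lambda>j P. (pd j ^^ m j) \<circ> P) xs id" for xs
  have G_Cons: "G (x # xs) f = (pd x ^^ m x) (G xs f)" for x xs f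
    by (simp add: G_def)
  have pow: "(pd j ^^ k) (Fract r 1) = Fract ((mpol_deriv j ^^ k) r) 1" for j :: 'n and k r
    by (induction k) (simp_all add: pd_Fract mpol_deriv_one)
  have "\<exists>q w. G xs (Fract p 1) = Fract q 1 \<and> (\<forall>t. w t > (0::nat) \<and> Poly_Mapping.lookup q t =
      of_nat (w t) * Poly_Mapping.lookup p (t + (\<Sum>j\<leftarrow>xs. Poly_Mapping.single j (m j))))" for xs
  proof (induction xs)
    case Nil
    show ?case by (rule exI[of _ p], rule exI[of _ "\<lambda>_. 1"]) (simp add: G_def)
  next
    case (Cons x xs)
    then obtain q w where q: "G xs (Fract p 1) = Fract q 1"
      and w: "\<And>t. w t > (0::nat)" "\<And>t. Poly_Mapping.lookup q t =
        of_nat (w t) * Poly_Mapping.lookup p (t + (\<Sum>j\<leftarrow>xs. Poly_Mapping.single j (m j)))" by metis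
    obtain v where v: "\<And>t. v t > (0::nat)"
      "\<And>p t. Poly_Mapping.lookup ((mpol_deriv x ^^ m x) p) t =
        of_nat (v t) * Poly_Mapping.lookup p (t + Poly_Mapping.single x (m x))"
      using lookup_mpol_deriv_pow[where j = x and k = "m x"] by metis
    show ?case
      by (rule exI[of _ "(mpol_deriv x ^^ m x) q"],
          rule exI[of _ "\<lambda>t. v t * w (t + Poly_Mapping.single x (m x))"])
        (simp add: G_Cons q pow v w add.assoc)
  qed
  from this[of "sorted_list_of_set UNIV"] show ?thesis
    by (simp add: dpow_def G_def X_def sum_list_distinct_conv_sum_set)
qed

lemma dpow_independent:
  fixes c :: "('n::{finite,linorder} \<Rightarrow> nat) \<Rightarrow> 'n ratfun"
  assumes fin: "finite S" and zero: "\<And>f. (\<Sum>m\<in>S. c m * dpow m f) = 0" and "k \<in> S"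
  shows "c k = 0"
proof (rule ccontr)
  assume "c k \<noteq> 0"
  define X :: "('n \<Rightarrow> nat) \<Rightarrow> ('n \<Rightarrow>\<^sub>0 nat)" where "X m = (\<Sum>j\<in>UNIV. Poly_Mapping.single j (m j))" for m
  have lookup_X: "Poly_Mapping.lookup (X m) i = m i" for m i
    by (simp add: X_def lookup_sum lookup_single when_def)
  obtain m where m: "m \<in> S" "c m \<noteq> 0"
    and least: "\<And>n. n \<in> S \<Longrightarrow> c n \<noteq> 0 \<Longrightarrow> (\<Sum>i\<in>UNIV. m i) \<le> (\<Sum>i\<in>UNIV. n i)"
    using ex_has_least_nat[of "\<lambda>m. m \<in> S \<and> c m \<noteq> 0" k "\<lambda>m. \<Sum>i\<in>UNIV. m i"] \<open>k \<in> S\<close> \<open>c k \<noteq> 0\<close>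
    by blast
  define f :: "'n ratfun" where "f = Fract (Poly_Mapping.single (X m) 1) 1"
  have poly: "\<exists>q w. dpow n f = Fract q 1 \<and> (\<forall>t. w t > (0::nat) \<and> Poly_Mapping.lookup q t =
      of_nat (w t) * Poly_Mapping.lookup (Poly_Mapping.single (X m) 1) (t + X n))" for n
    unfolding f_def X_def by (rule dpow_poly)
  have other: "c n * dpow n f = 0" if n: "n \<in> S - {m}" for n
  proof (rule ccontr)
    assume *: "c n * dpow n f \<noteq> 0"
    obtain q w where q: "dpow n f = Fract q 1"
      and w: "\<And>t. Poly_Mapping.lookup q t =
        of_nat (w t) * Poly_Mapping.lookup (Poly_Mapping.single (X m) 1) (t + X n)"
      using poly[of n] by blast
    have "q \<noteq> 0" using * q by (auto simp: Zero_fract_def)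
    then obtain t where "Poly_Mapping.lookup q t \<noteq> 0"
      by (metis poly_mapping_eqI lookup_zero)
    then have "X m = t + X n" by (auto simp: w lookup_single when_def split: if_splits)
    then have mn: "m i = Poly_Mapping.lookup t i + n i" for i
      by (metis lookup_X lookup_add)
    have "(\<Sum>i\<in>UNIV. m i) \<le> (\<Sum>i\<in>UNIV. n i)" using * n by (intro least) auto
    then have "(\<Sum>i\<in>UNIV. Poly_Mapping.lookup t i) = 0" by (simp add: mn sum.distrib)
    then have "m = n" by (auto simp: fun_eq_iff mn)
    then show False using n by simp
  qed
  obtain q w where q: "dpow m f = Fract q 1" and w: "\<And>t. w t > (0::nat)"
      "\<And>t. Poly_Mapping.lookup q t =
        of_nat (w t) * Poly_Mapping.lookup (Poly_Mapping.single (X m) 1) (t + X m)"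
    using poly[of m] by blast
  have "Poly_Mapping.lookup q 0 \<noteq> 0" using w(1)[of 0] by (simp add: w(2))
  then have "dpow m f \<noteq> 0" by (auto simp: q Zero_fract_def eq_fract)
  moreover have "(\<Sum>n\<in>S. c n * dpow n f) = c m * dpow m f"
    using sum.remove[OF fin m(1), of "\<lambda>n. c n * dpow n f"] sum.neutral[of "S - {m}" "\<lambda>n. c n * dpow n f"] other
    by simp
  ultimately show False using zero[of f] m(2) by simp
qed

section \<open>Left ideals, quotient modules, simplicity\<close>

text \<open>
  HOL-Algebra has additive cosets but only two-sided ideals, and its modules live over
  commutative rings. Its record of modules and its notion of submodule make sense over any ring.
  The scalar multiplication on a quotient is written in the style of \<open>rcoset_mult\<close>; the fields
  \<open>mult\<close> and \<open>one\<close> of the module record carry no meaning.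
\<close>

locale left_ideal = additive_subgroup I R + ring R for I and R (structure) +
  assumes I_l_closed: "\<lbrakk>a \<in> I; x \<in> carrier R\<rbrakk> \<Longrightarrow> x \<otimes> a \<in> I"

definition genlideal :: "('a, 'b) ring_scheme \<Rightarrow> 'a set \<Rightarrow> 'a set"
  where "genlideal R S = \<Inter>{I. left_ideal I R \<and> S \<subseteq> I}"

definition lquot :: "('a, 'b) ring_scheme \<Rightarrow> 'a set \<Rightarrow> ('a, 'a set) module"
  where "lquot R I =
    \<lparr>carrier = a_rcosets\<^bsub>R\<^esub> I, mult = undefined, one = undefined,
     zero = I, add = set_add R, smult = (\<lambda>p X. \<Union>q\<in>X. I +>\<^bsub>R\<^esub> (p \<otimes>\<^bsub>R\<^esub> q))\<rparr>"

lemma (in left_ideal) lquot_smult: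
  assumes p: "p \<in> carrier R" and q: "q \<in> carrier R"
  shows "p \<odot>\<^bsub>lquot R I\<^esub> (I +> q) = I +> (p \<otimes> q)"
proof -
  have "I +> (p \<otimes> (i \<oplus> q)) = I +> (p \<otimes> q)" if i: "i \<in> I" for i
  proof -
    have "I +> (p \<otimes> (i \<oplus> q)) = (I +> (p \<otimes> i)) +> (p \<otimes> q)"
      using p q a_Hcarr[OF i] a_subset by (simp add: r_distr a_coset_add_assoc)
    also have "I +> (p \<otimes> i) = I"
      using I_l_closed[OF i p] a_subgroup p a_Hcarr[OF i] by (intro a_coset_join2) auto
    finally show ?thesis .
  qed
  moreover have "I +> q = (\<lambda>i. i \<oplus> q) ` I" by (auto simp: a_r_coset_def')
  moreover have "I \<noteq> {}" using additive_subgroup.zero_closed[OF additive_subgroup_axioms] by blast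
  ultimately show ?thesis by (simp add: lquot_def)
qed

definition simple_lmodule :: "('a, 'b) ring_scheme \<Rightarrow> ('a, 'c, 'd) module_scheme \<Rightarrow> bool"
  where "simple_lmodule R M \<longleftrightarrow> (\<forall>S. submodule S R M \<longrightarrow> S = {\<zero>\<^bsub>M\<^esub>} \<or> S = carrier M)"

section \<open>The A-hypergeometric system and its D-module\<close>

definition euler_op :: "('n::{finite,linorder} \<Rightarrow> int ^ 'r) \<Rightarrow> 'r \<Rightarrow> 'n ratfun \<Rightarrow> 'n ratfun"
  where "euler_op a i f = (\<Sum>j\<in>UNIV. of_int (a j $ i) * var j * pd j f)"

definition rel_lattice :: "('n::finite \<Rightarrow> int ^ 'r) \<Rightarrow> ('n \<Rightarrow> int) set"
  where "rel_lattice a = {l. (\<Sum>j\<in>UNIV. l j *s a j) = 0}"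

text \<open>\<open>nat\<close> truncates negative integers to 0, so the two monomials of \<open>box_op l\<close> are the products
  over \<open>l\<^sub>j > 0\<close> and over \<open>l\<^sub>j < 0\<close>.\<close>

definition box_op :: "('n::{finite,linorder} \<Rightarrow> int) \<Rightarrow> 'n ratfun \<Rightarrow> 'n ratfun"
  where "box_op l f = dpow (\<lambda>j. nat (l j)) f - dpow (\<lambda>j. nat (- l j)) f"

definition hg_ops :: "('n::{finite,linorder} \<Rightarrow> int ^ 'r) \<Rightarrow> complex ^ 'r \<Rightarrow> ('n ratfun \<Rightarrow> 'n ratfun) set"
  where "hg_ops a \<alpha> =
    range (\<lambda>i f. euler_op a i f - scalar (\<alpha> $ i) * f) \<union> box_op ` rel_lattice a"

lemma dops_diff: "P \<in> dops \<Longrightarrow> Q \<in> dops \<Longrightarrow> (\<lambda>f. P f - Q f) \<in> dops"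
  using dops_add[of P "\<lambda>f. (- 1) * Q f"] dops_smult[of Q "- 1"] by simp

lemma hg_ops_subset: "hg_ops a \<alpha> \<subseteq> dops"
proof -
  have sc: "(\<lambda>f. g * f) \<in> dops" for g :: "'a ratfun"
    using dops_smult[OF dops_id, of g] by simp
  have "euler_op a i \<in> dops" for i
    unfolding euler_op_def[abs_def] by (rule dops_sum[OF dops_smult[OF dops_pd]])
  moreover have "box_op l \<in> dops" for l :: "'a \<Rightarrow> int"
    using dops_diff[OF dops_dpow dops_dpow] by (simp add: box_op_def[abs_def])
  ultimately show ?thesis by (auto simp: hg_ops_def intro!: dops_diff sc)
qed

definition hg_module :: "('n::{finite,linorder} \<Rightarrow> int ^ 'r) \<Rightarrow> complex ^ 'r \<Rightarrow>
    ('n ratfun \<Rightarrow> 'n ratfun, ('n ratfun \<Rightarrow> 'n ratfun) set) module"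
  where "hg_module a \<alpha> = lquot diffop_ring (genlideal diffop_ring (hg_ops a \<alpha>))"

definition hg_irreducible :: "('n::{finite,linorder} \<Rightarrow> int ^ 'r) \<Rightarrow> complex ^ 'r \<Rightarrow> bool"
  where "hg_irreducible a \<alpha> \<longleftrightarrow> simple_lmodule diffop_ring (hg_module a \<alpha>)"

section \<open>Non-resonance\<close>

definition real_vec :: "int ^ 'r \<Rightarrow> real ^ 'r"
  where "real_vec x = (\<chi> i. real_of_int (x $ i))"

definition complex_vec :: "real ^ 'r \<Rightarrow> complex ^ 'r"
  where "complex_vec x = (\<chi> i. complex_of_real (x $ i))"

definition pos_cone :: "('n::finite \<Rightarrow> int ^ 'r) \<Rightarrow> (real ^ 'r) set"
  where "pos_cone a = {(\<Sum>j\<in>UNIV. c j *\<^sub>R real_vec (a j)) | c. \<forall>j. 0 \<le> c j}"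

text \<open>
  The shifted lattice \<open>\<alpha> + \<int>\<^sup>r\<close> lies in \<open>\<complex>\<^sup>r\<close>, so the boundary of the cone (the union of its facets) has
  to be complexified: each facet is replaced by its complex linear span, the usual convention of
  Gelfand, Kapranov and Zelevinsky. For real \<open>\<alpha>\<close> this is the condition that
  \<open>\<alpha> + \<int>\<^sup>r\<close> does not meet the topological boundary of the cone, see \<open>nonresonant_real_iff\<close>.
  For non-real \<open>\<alpha>\<close>, intersecting with the boundary as a subset of \<open>\<real>\<^sup>r\<close> would be too weak: with
  \<open>a\<^sub>j = (1, 0), (1, 1), (1, 2)\<close> and \<open>\<alpha> = (\<i>, 0)\<close> the intersection is empty, but \<open>v\<^sub>1 powr \<i>\<close> is
  a solution of the rank two system, which is therefore reducible.
\<close>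

definition nonresonant :: "('n::finite \<Rightarrow> int ^ 'r) \<Rightarrow> complex ^ 'r \<Rightarrow> bool"
  where "nonresonant a \<alpha> \<longleftrightarrow>
    range (\<lambda>k. \<alpha> + complex_vec (real_vec k)) \<inter>
      (\<Union>F\<in>{F. F facet_of pos_cone a}. vec.span (complex_vec ` F)) = {}"

lemma pos_cone_add: "x \<in> pos_cone a \<Longrightarrow> y \<in> pos_cone a \<Longrightarrow> x + y \<in> pos_cone a"
proof -
  assume "x \<in> pos_cone a" "y \<in> pos_cone a"
  then obtain c d where "\<And>j. c j \<ge> 0" "\<And>j. d j \<ge> 0"
    and "x = (\<Sum>j\<in>UNIV. c j *\<^sub>R real_vec (a j))" "y = (\<Sum>j\<in>UNIV. d j *\<^sub>R real_vec (a j))"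
    by (auto simp: pos_cone_def)
  then show ?thesis unfolding pos_cone_def
    by (intro CollectI exI[of _ "\<lambda>j. c j + d j"]) (simp add: sum.distrib scaleR_add_left)
qed

lemma pos_cone_scaleR: "x \<in> pos_cone a \<Longrightarrow> t \<ge> 0 \<Longrightarrow> t *\<^sub>R x \<in> pos_cone a"
proof -
  assume "x \<in> pos_cone a" and t: "t \<ge> 0"
  then obtain c where "\<And>j. c j \<ge> 0" and "x = (\<Sum>j\<in>UNIV. c j *\<^sub>R real_vec (a j))"
    by (auto simp: pos_cone_def)
  then show ?thesis unfolding pos_cone_def using t
    by (intro CollectI exI[of _ "\<lambda>j. t * c j"]) (simp add: scaleR_sum_right)
qed

lemma pos_cone_0: "0 \<in> pos_cone a"
  unfolding pos_cone_def by (intro CollectI exI[of _ "\<lambda>j. 0"]) simp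

lemma pos_cone_gen: "real_vec (a j) \<in> pos_cone a"
  unfolding pos_cone_def
  by (intro CollectI exI[of _ "\<lambda>i. if i = j then 1 else 0"])
    (simp add: if_distrib[of "\<lambda>c. c *\<^sub>R _"] cong: if_cong)

lemma pos_cone_eq_hull: "pos_cone a = convex_cone hull (range (\<lambda>j. real_vec (a j)))"
proof (rule hull_unique[symmetric])
  show "range (\<lambda>j. real_vec (a j)) \<subseteq> pos_cone a" using pos_cone_gen by auto
  show "convex_cone (pos_cone a)"
    unfolding convex_cone_iff using pos_cone_0 by (auto intro: pos_cone_add pos_cone_scaleR)
  fix T assume T: "range (\<lambda>j. real_vec (a j)) \<subseteq> T" "convex_cone T"
  have cl: "0 \<in> T" "\<And>x y. x \<in> T \<Longrightarrow> y \<in> T \<Longrightarrow> x + y \<in> T" "\<And>c x. x \<in> T \<Longrightarrow> c \<ge> 0 \<Longrightarrow> c *\<^sub>R x \<in> T"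
    using T(2) by (auto simp: convex_cone_iff)
  have "(\<Sum>j\<in>J. c j *\<^sub>R real_vec (a j)) \<in> T" if "\<forall>j. 0 \<le> c j" for c J
    using that T(1) by (induction J rule: infinite_finite_induct) (auto intro!: cl)
  then show "pos_cone a \<subseteq> T" by (auto simp: pos_cone_def)
qed

lemma facet_lattice_shift:
  fixes a :: "'n::finite \<Rightarrow> int ^ 'r"
  assumes face: "F face_of pos_cone a" "F \<noteq> {}" and y: "y \<in> span F"
  shows "\<exists>k. y + real_vec k \<in> F"
proof -
  let ?C = "pos_cone a"
  have FC: "F \<subseteq> ?C" and "convex F" using face face_of_imp_subset face_of_imp_convex by auto
  have mid: "u \<in> F" if "u \<in> ?C" "v \<in> ?C" "u + v = w + w" "w \<in> F" for u v w :: "real ^ 'r"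
  proof (cases "u = v")
    case True
    with that(3) have "2 *\<^sub>R u = 2 *\<^sub>R w" by (simp add: scaleR_2)
    then show ?thesis using that by simp
  next
    case False
    have "w = (1/2) *\<^sub>R (u + v)" by (simp add: that(3) flip: scaleR_2)
    then have "w \<in> open_segment u v"
      using False by (auto simp: in_segment intro!: exI[of _ "1/2"] simp: scaleR_add_right)
    then show ?thesis using face(1) that by (auto simp: face_of_def)
  qed
  have zero: "0 \<in> F"
  proof -
    obtain x where "x \<in> F" using face by auto
    then show ?thesis
      using mid[of 0 "x + x" x] FC pos_cone_0[of a] pos_cone_add[of x a x] by auto
  qed
  have double: "x + x \<in> F" if "x \<in> F" for x
    using mid[of "x + x" 0 x] FC pos_cone_0[of a] pos_cone_add[of x a x] that by auto
  have add: "x + y \<in> F" if "x \<in> F" "y \<in> F" for x y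
  proof -
    have "(1/2) *\<^sub>R x + (1/2) *\<^sub>R y \<in> F" using \<open>convex F\<close> that by (auto simp: convex_def)
    then have "((1/2) *\<^sub>R x + (1/2) *\<^sub>R y) + ((1/2) *\<^sub>R x + (1/2) *\<^sub>R y) \<in> F" by (rule double)
    moreover have "((1/2) *\<^sub>R x + (1/2) *\<^sub>R y) + ((1/2) *\<^sub>R x + (1/2) *\<^sub>R y) = x + y"
      by (simp add: algebra_simps flip: scaleR_2)
    ultimately show ?thesis by simp
  qed
  have sub: "x \<in> F" if "x + y \<in> F" "x \<in> ?C" "y \<in> ?C" for x y
    using mid[of "x + x" "y + y" "x + y"] pos_cone_add[of x a x] pos_cone_add[of y a y] that
      mid[of x "x + (y + y)" "x + y"] pos_cone_add[of x a "y + y"] by (auto simp: algebra_simps)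
  have nat: "real n *\<^sub>R x \<in> F" if "x \<in> F" for n x
    by (induction n) (auto simp: zero scaleR_add_left intro: add that)
  have scale: "t *\<^sub>R x \<in> F" if "x \<in> F" "t \<ge> 0" for t x
  proof -
    obtain n where n: "t \<le> real n" using real_arch_simple by blast
    have "t *\<^sub>R x + (real n - t) *\<^sub>R x \<in> F" using nat[OF that(1), of n] by (simp flip: scaleR_add_left)
    then show ?thesis by (rule sub) (use FC that n in \<open>auto intro!: pos_cone_scaleR\<close>)
  qed
  define J where "J = {j. real_vec (a j) \<in> F}"
  have "F \<subseteq> range (\<lambda>c. \<Sum>j\<in>J. c j *\<^sub>R real_vec (a j))"
  proof
    fix x assume x: "x \<in> F"
    then obtain c where c: "\<And>j. c j \<ge> 0" "x = (\<Sum>j\<in>UNIV. c j *\<^sub>R real_vec (a j))"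
      using FC by (auto simp: pos_cone_def)
    have "c j = 0" if "j \<notin> J" for j
    proof (rule ccontr)
      assume "c j \<noteq> 0"
      have *: "(\<Sum>i\<in>K. c i *\<^sub>R real_vec (a i)) \<in> ?C" for K
        using c(1) by (induction K rule: infinite_finite_induct)
          (auto intro!: pos_cone_add pos_cone_scaleR pos_cone_gen simp: pos_cone_0)
      have "c j *\<^sub>R real_vec (a j) \<in> F"
        by (rule sub[of _ "\<Sum>i\<in>UNIV - {j}. c i *\<^sub>R real_vec (a i)"])
          (use x c * pos_cone_scaleR[OF pos_cone_gen c(1)] in \<open>auto simp: sum.remove[of UNIV j]\<close>)
      from scale[OF this, of "1 / c j"] have "real_vec (a j) \<in> F"
        using c(1)[of j] \<open>c j \<noteq> 0\<close> by simp
      with that show False by (simp add: J_def)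
    qed
    then have "x = (\<Sum>j\<in>J. c j *\<^sub>R real_vec (a j))"
      unfolding c(2) by (intro sum.mono_neutral_right) auto
    then show "x \<in> range (\<lambda>c. \<Sum>j\<in>J. c j *\<^sub>R real_vec (a j))" by blast
  qed
  moreover have "subspace (range (\<lambda>c. \<Sum>j\<in>J. c j *\<^sub>R real_vec (a j)))"
  proof (rule subspaceI)
    show "0 \<in> range (\<lambda>c. \<Sum>j\<in>J. c j *\<^sub>R real_vec (a j))"
      by (rule range_eqI[of _ _ "\<lambda>j. 0"]) simp
  next
    fix x y assume "x \<in> range (\<lambda>c. \<Sum>j\<in>J. c j *\<^sub>R real_vec (a j))" "y \<in> range (\<lambda>c. \<Sum>j\<in>J. c j *\<^sub>R real_vec (a j))"
    then obtain c d where "x = (\<Sum>j\<in>J. c j *\<^sub>R real_vec (a j))" "y = (\<Sum>j\<in>J. d j *\<^sub>R real_vec (a j))" by blast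
    then show "x + y \<in> range (\<lambda>c. \<Sum>j\<in>J. c j *\<^sub>R real_vec (a j))"
      by (intro range_eqI[of _ _ "\<lambda>j. c j + d j"]) (simp add: sum.distrib scaleR_add_left)
  next
    fix x and t :: real assume "x \<in> range (\<lambda>c. \<Sum>j\<in>J. c j *\<^sub>R real_vec (a j))"
    then obtain c where "x = (\<Sum>j\<in>J. c j *\<^sub>R real_vec (a j))" by blast
    then show "t *\<^sub>R x \<in> range (\<lambda>c. \<Sum>j\<in>J. c j *\<^sub>R real_vec (a j))"
      by (intro range_eqI[of _ _ "\<lambda>j. t * c j"]) (simp add: scaleR_sum_right)
  qed
  ultimately have "span F \<subseteq> range (\<lambda>c. \<Sum>j\<in>J. c j *\<^sub>R real_vec (a j))" by (rule span_minimal)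
  with y obtain c where c: "y = (\<Sum>j\<in>J. c j *\<^sub>R real_vec (a j))" by blast
  define k where "k = (\<Sum>j\<in>J. \<lceil>\<bar>c j\<bar>\<rceil> *s a j)"
  have "real_vec k = (\<Sum>j\<in>J. real_of_int \<lceil>\<bar>c j\<bar>\<rceil> *\<^sub>R real_vec (a j))"
    by (simp add: k_def real_vec_def vec_eq_iff)
  then have "y + real_vec k = (\<Sum>j\<in>J. (c j + real_of_int \<lceil>\<bar>c j\<bar>\<rceil>) *\<^sub>R real_vec (a j))"
    by (simp add: c sum.distrib scaleR_add_left)
  also have "\<dots> \<in> F"
  proof -
    have nn: "c j + real_of_int \<lceil>\<bar>c j\<bar>\<rceil> \<ge> 0" for j by linarith
    have "(\<Sum>j\<in>K. (c j + real_of_int \<lceil>\<bar>c j\<bar>\<rceil>) *\<^sub>R real_vec (a j)) \<in> F" if "K \<subseteq> J" for K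
      using that by (induction K rule: infinite_finite_induct) (auto simp: zero J_def intro!: add scale nn)
    then show ?thesis by blast
  qed
  finally show ?thesis by blast
qed

lemma real_in_complex_span:
  assumes "complex_vec y \<in> vec.span (complex_vec ` F)"
  shows "y \<in> span F"
proof -
  define T where "T = {z :: complex ^ 'a. (\<chi> i. Re (z $ i)) \<in> span F \<and> (\<chi> i. Im (z $ i)) \<in> span F}"
  have "vec.subspace T"
  proof (rule vec.subspaceI)
    show "0 \<in> T" using span_zero[of F] by (simp add: T_def zero_vec_def)
  next
    fix x y assume "x \<in> T" "y \<in> T"
    moreover have "(\<chi> i. Re ((x + y) $ i)) = (\<chi> i. Re (x $ i)) + (\<chi> i. Re (y $ i))"
      "(\<chi> i. Im ((x + y) $ i)) = (\<chi> i. Im (x $ i)) + (\<chi> i. Im (y $ i))" by (simp_all add: vec_eq_iff)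
    ultimately show "x + y \<in> T" by (simp add: T_def span_add)
  next
    fix x and c :: complex assume "x \<in> T"
    moreover have "(\<chi> i. Re ((c *s x) $ i)) = Re c *\<^sub>R (\<chi> i. Re (x $ i)) - Im c *\<^sub>R (\<chi> i. Im (x $ i))"
      "(\<chi> i. Im ((c *s x) $ i)) = Re c *\<^sub>R (\<chi> i. Im (x $ i)) + Im c *\<^sub>R (\<chi> i. Re (x $ i))"
      by (simp_all add: vec_eq_iff)
    ultimately show "c *s x \<in> T" by (simp add: T_def span_add span_diff span_scale)
  qed
  moreover have "complex_vec ` F \<subseteq> T"
    using span_base[of _ F] span_zero[of F] by (auto simp: T_def complex_vec_def zero_vec_def[symmetric])
  ultimately have "complex_vec y \<in> T" using assms vec.span_minimal by blast
  then show ?thesis by (simp add: T_def complex_vec_def)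
qed

lemma nonresonant_real_iff:
  fixes a :: "'n::finite \<Rightarrow> int ^ 'r"
  assumes gen: "range (\<lambda>c. \<Sum>j\<in>UNIV. c j *s a j) = UNIV"
  shows "nonresonant a (complex_vec x) \<longleftrightarrow> range (\<lambda>k. x + real_vec k) \<inter> frontier (pos_cone a) = {}"
proof -
  let ?C = "pos_cone a"
  have cv: "complex_vec u + complex_vec v = complex_vec (u + v)" for u v :: "real ^ 'r"
    by (simp add: complex_vec_def vec_eq_iff)
  have rv: "real_vec u + real_vec v = real_vec (u + v)" for u v :: "int ^ 'r"
    by (simp add: real_vec_def vec_eq_iff)
  have "axis i 1 \<in> span ?C" for i :: 'r
  proof -
    have "(axis i 1 :: int ^ 'r) \<in> range (\<lambda>c. \<Sum>j\<in>UNIV. c j *s a j)" using gen by simp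
    then obtain c where c: "(axis i 1 :: int ^ 'r) = (\<Sum>j\<in>UNIV. c j *s a j)" by blast
    have "(axis i 1 :: real ^ 'r) = real_vec (axis i 1)" by (simp add: real_vec_def axis_def vec_eq_iff)
    also have "\<dots> = (\<Sum>j\<in>UNIV. real_of_int (c j) *\<^sub>R real_vec (a j))"
      unfolding c by (simp add: real_vec_def vec_eq_iff)
    also have "\<dots> \<in> span ?C" by (intro span_sum span_scale span_base pos_cone_gen)
    finally show ?thesis .
  qed
  then have "Basis \<subseteq> span ?C" by (auto simp: Basis_vec_def)
  then have "span ?C = UNIV" using span_minimal[of Basis "span ?C"] by auto
  then have "affine hull ?C = UNIV" using pos_cone_0[of a] by (simp add: affine_hull_span_0 hull_inc)
  then have "frontier ?C = rel_frontier ?C" by (simp add: rel_frontier_frontier)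
  also have "\<dots> = \<Union>{F. F facet_of ?C}"
    by (intro rel_frontier_of_polyhedron) (simp add: pos_cone_eq_hull polyhedron_convex_cone_hull)
  finally have fr: "frontier ?C = \<Union>{F. F facet_of ?C}" .
  show ?thesis
  proof
    assume nr: "nonresonant a (complex_vec x)"
    have False if k: "x + real_vec k \<in> F" "F facet_of ?C" for k F
    proof -
      have "complex_vec x + complex_vec (real_vec k) \<in> vec.span (complex_vec ` F)"
        using k by (auto simp: cv intro!: vec.span_base)
      then show False using nr k(2) by (auto simp: nonresonant_def)
    qed
    then show "range (\<lambda>k. x + real_vec k) \<inter> frontier ?C = {}" by (auto simp: fr)
  next
    assume lit: "range (\<lambda>k. x + real_vec k) \<inter> frontier ?C = {}"
    have False if k: "complex_vec x + complex_vec (real_vec k) \<in> vec.span (complex_vec ` F)"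
      and F: "F facet_of ?C" for k F
    proof -
      have "x + real_vec k \<in> span F" using k by (simp add: cv real_in_complex_span)
      then obtain l where "x + real_vec k + real_vec l \<in> F"
        using facet_lattice_shift[of F a] F by (auto simp: facet_of_def)
      then have "x + real_vec (k + l) \<in> frontier ?C" using F by (auto simp: fr add.assoc rv)
      then show False using lit by auto
    qed
    then show "nonresonant a (complex_vec x)" by (auto simp: nonresonant_def)
  qed
qed

end

theory Submission
  imports Defs
begin

text \<open>
  Write \<open>\<theta>\<^sub>j = v\<^sub>j \<partial>\<^sub>j\<close>, let \<open>A\<close> be the matrix with columns \<open>a\<^sub>j\<close>, and give \<open>\<partial>\<^sup>m\<close> the weight \<open>A m\<close>.
  Irreducibility says that a left ideal \<open>J\<close> that properly contains the hypergeometric ideal \<open>H(\<alpha>)\<close>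
  contains \<open>1\<close>. Modulo the toric left ideal \<open>I \<subseteq> H(\<alpha>)\<close> of the box operators, \<open>\<partial>\<^sup>m\<close> depends only on its
  weight. The proof rests on two ideas.

  Non-resonance makes the \<open>\<partial>\<^sup>w\<close> invertible. There is a polynomial \<open>b\<close> on the weight space with
  \<open>b(A\<theta>) - Q \<partial>\<^sup>w \<in> I\<close> for some operator \<open>Q\<close>, and \<open>b\<close> is a product of factors \<open>\<ell> - \<ell>(s)\<close> with \<open>\<ell>\<close>
  the linear form of a facet and \<open>s\<close> a lattice point (\<open>nonresonant_imp_has_b_functions\<close>, \<open>b_operator\<close>).
  Non-resonance says exactly that such a factor does not vanish at a point of \<open>\<alpha> + \<int>\<^sup>r\<close>, while
  \<open>b(A\<theta>) - b(\<alpha>) \<in> H(\<alpha>)\<close>. Hence a left ideal that contains \<open>H(\<alpha>)\<close> and some \<open>\<partial>\<^sup>w\<close> contains \<open>1\<close>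
  (\<open>unit_if_dpow_mem\<close>), and \<open>X \<partial>\<^sup>w \<in> H(\<alpha> + A w)\<close> implies \<open>X \<in> H(\<alpha>)\<close> (\<open>hg_ideal_dpow_right_cancel\<close>).

  Homogeneous operators are polynomials, and box operators act on them as difference operators.
  Take \<open>P \<in> J\<close> outside \<open>H(\<alpha>)\<close>, with polynomial coefficients. For large \<open>w\<close> the product \<open>P \<partial>\<^sup>w\<close> is a sum of
  operators \<open>p(\<theta>) \<partial>\<^sup>m\<close>, the Euler operators separate its weights, and modulo \<open>I\<close> one component is a
  single \<open>p(\<theta>) \<partial>\<^sup>u\<close>; by the cancellation law \<open>J\<close> may be replaced by \<open>J \<partial>\<^sup>w + H(\<alpha> + A w)\<close>, and \<open>\<alpha>\<close>
  by \<open>\<alpha> + A w\<close>. Modulo \<open>H(\<alpha>)\<close> only the values of \<open>p\<close> on the affine space \<open>A \<theta> = \<alpha> - A u\<close> matter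
  (\<open>Theta_in_hg_ideal\<close>). If \<open>A m = A k\<close>, left multiplication by \<open>\<partial>\<^sup>m - \<partial>\<^sup>k\<close> replaces \<open>p\<close> by \<open>p(\<theta> + m) - p(\<theta> + k)\<close>,
  of smaller degree. When all these differences vanish, \<open>p\<close> is invariant under the lattice of
  relations, which spans the direction of the affine space over \<open>\<complex>\<close>, so \<open>p\<close> is a nonzero constant
  there and \<open>\<partial>\<^sup>u \<in> J\<close> (\<open>unit_if_Theta_mem\<close>).
\<close>

section \<open>Calculus of differential operators\<close>

type_synonym 'n ratop = "'n ratfun \<Rightarrow> 'n ratfun"

lemma multiindex_induct [case_names zero step]:
  fixes P :: "('n::finite \<Rightarrow> nat) \<Rightarrow> bool"
  assumes zero: "P (\<lambda>_. 0)" and step: "\<And>m i. P m \<Longrightarrow> P (m(i := Suc (m i)))"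
  shows "P m"
proof (induction "\<Sum>i\<in>UNIV. m i" arbitrary: m)
  case 0
  then have "m = (\<lambda>_. 0)" by auto
  then show ?case using zero by simp
next
  case (Suc s)
  then obtain i where i: "m i \<noteq> 0" by (metis nat.distinct(1) sum.neutral)
  define m' where "m' = m(i := m i - 1)"
  have m: "m = m'(i := Suc (m' i))" using i by (auto simp: m'_def)
  have "sum m' (UNIV - {i}) = sum m (UNIV - {i})" by (rule sum.cong) (auto simp: m'_def)
  then have "sum m UNIV = Suc (sum m' UNIV)"
    using i by (simp add: sum.remove[of UNIV i] m'_def)
  then have "P m'" using Suc by (intro Suc.hyps(1)) simp
  then have "P (m'(i := Suc (m' i)))" by (rule step)
  then show ?case by (simp only: m[symmetric])
qed

lemma dpow_dpow: "dpow m (dpow n f) = dpow (\<lambda>j. m j + n j) f"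
proof (induction m arbitrary: f rule: multiindex_induct)
  case zero
  show ?case by (simp add: dpow_0)
next
  case (step m i)
  have "(\<lambda>j. (m(i := Suc (m i))) j + n j) = (\<lambda>j. m j + n j)(i := Suc (m i + n i))" by auto
  then show ?case by (simp only: step.IH pd_dpow flip: pd_dpow[of i m])
qed

lemma scalar_0 [simp]: "scalar 0 = 0"
  by (simp add: scalar_def Zero_fract_def)

lemma scalar_1 [simp]: "scalar 1 = 1"
  by (simp add: scalar_def One_fract_def)

lemma scalar_add: "scalar (c + d) = scalar c + scalar d"
  by (simp add: scalar_def single_add)

lemma scalar_mult: "scalar (c * d) = scalar c * scalar d"
  by (simp add: scalar_def mult_single)

lemma scalar_minus: "scalar (- c) = - scalar c"
  using scalar_add[of c "- c"] by (simp add: eq_neg_iff_add_eq_0 add.commute)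

lemma scalar_diff: "scalar (c - d) = scalar c - scalar d"
  using scalar_add[of c "- d"] by (simp add: scalar_minus)

lemma scalar_of_nat: "scalar (of_nat n) = of_nat n"
  by (induction n) (simp_all add: scalar_add)

lemma scalar_of_int: "scalar (of_int n) = of_int n"
  by (cases n) (simp_all add: scalar_of_nat scalar_diff scalar_minus scalar_add)

lemma pd_scalar_mult: "pd i (scalar c * f) = scalar c * pd i f"
  by (simp add: pd_mult pd_scalar)

lemma dpow_scalar_mult: "dpow m (scalar c * f) = scalar c * dpow m f"
  by (induction m rule: multiindex_induct) (simp_all add: dpow_0 pd_scalar_mult del: fun_upd_apply flip: pd_dpow)

lemma dops_zero_arg: "P \<in> dops \<Longrightarrow> P 0 = 0"
  using dops_additive[of P 0 0] by (simp only: add_0_left add_cancel_right_right)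

lemma dops_minus_arg: "P \<in> dops \<Longrightarrow> P (- f) = - P f"
  using dops_additive[of P f "- f"] dops_zero_arg[of P] by (simp add: eq_neg_iff_add_eq_0 add.commute)

lemma dops_diff_arg: "P \<in> dops \<Longrightarrow> P (f - g) = P f - P g"
  using dops_additive[of P f "- g"] by (simp add: dops_minus_arg)

lemma dops_sum_arg: "P \<in> dops \<Longrightarrow> P (sum g S) = (\<Sum>s\<in>S. P (g s))"
  by (induction S rule: infinite_finite_induct) (simp_all add: dops_additive dops_zero_arg)

lemma dops_scalar_arg: "P \<in> dops \<Longrightarrow> P (scalar c * f) = scalar c * P f"
  by (erule dopsE) (simp add: dpow_scalar_mult sum_distrib_left mult.left_commute)

lemma dops_compose: "P \<in> dops \<Longrightarrow> Q \<in> dops \<Longrightarrow> (\<lambda>f. P (Q f)) \<in> dops"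
  using dops_comp[of P Q] by (simp add: comp_def)

lemma dops_mult: "(\<lambda>f. g * f) \<in> dops"
  using dops_smult[OF dops_id, of g] by simp

lemma dops_euler_op: "euler_op a i \<in> dops"
  unfolding euler_op_def[abs_def] by (rule dops_sum[OF dops_smult[OF dops_pd]])

lemma diffop_ring_simps:
  "P \<otimes>\<^bsub>diffop_ring\<^esub> Q = (\<lambda>f. P (Q f))" "P \<oplus>\<^bsub>diffop_ring\<^esub> Q = (\<lambda>f. P f + Q f)"
  "\<zero>\<^bsub>diffop_ring\<^esub> = (\<lambda>f. 0)" "\<one>\<^bsub>diffop_ring\<^esub> = id"
  by (simp_all add: diffop_ring_def comp_def)

section \<open>Left ideals and submodules\<close>

text \<open>
  Operators act on functions, so left ideals are written here with pointwise sums and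
  compositions; \<open>left_ideal_iff_lideal\<close> relates this to the ring structure.
\<close>

definition lideal :: "'n::{finite,linorder} ratop set \<Rightarrow> bool"
  where "lideal J \<longleftrightarrow> J \<subseteq> dops \<and> (\<lambda>f. 0) \<in> J \<and>
    (\<forall>P\<in>J. \<forall>Q\<in>J. (\<lambda>f. P f + Q f) \<in> J) \<and> (\<forall>Q\<in>dops. \<forall>P\<in>J. (\<lambda>f. Q (P f)) \<in> J)"

lemma lideal_dops: "lideal J \<Longrightarrow> P \<in> J \<Longrightarrow> P \<in> dops"
  by (auto simp: lideal_def)

lemma lideal_zero: "lideal J \<Longrightarrow> (\<lambda>f. 0) \<in> J"
  by (simp add: lideal_def)

lemma lideal_add: "lideal J \<Longrightarrow> P \<in> J \<Longrightarrow> Q \<in> J \<Longrightarrow> (\<lambda>f. P f + Q f) \<in> J"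
  by (simp add: lideal_def)

lemma lideal_comp: "lideal J \<Longrightarrow> Q \<in> dops \<Longrightarrow> P \<in> J \<Longrightarrow> (\<lambda>f. Q (P f)) \<in> J"
  by (simp add: lideal_def)

lemma lideal_smult: "lideal J \<Longrightarrow> P \<in> J \<Longrightarrow> (\<lambda>f. g * P f) \<in> J"
  by (rule lideal_comp[OF _ dops_mult])

lemma lideal_diff: "lideal J \<Longrightarrow> P \<in> J \<Longrightarrow> Q \<in> J \<Longrightarrow> (\<lambda>f. P f - Q f) \<in> J"
  using lideal_add[of J P "\<lambda>f. (- 1) * Q f"] lideal_smult[of J Q "- 1"] by simp

lemma lideal_sum: "lideal J \<Longrightarrow> (\<And>s. s \<in> S \<Longrightarrow> P s \<in> J) \<Longrightarrow> (\<lambda>f. \<Sum>s\<in>S. P s f) \<in> J"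
  by (induction S rule: infinite_finite_induct) (auto simp: lideal_zero intro: lideal_add)

lemma lideal_unit_smult:
  assumes "lideal J" "(\<lambda>f. g * P f) \<in> J" "g \<noteq> 0"
  shows "P \<in> J"
proof -
  have "(\<lambda>f. inverse g * (g * P f)) \<in> J" using assms(1,2) by (rule lideal_smult)
  then show ?thesis using assms(3) by (simp flip: mult.assoc)
qed

text \<open>
  Multiplication by rational functions and the derivations generate all operators, so closure
  under these suffices.
\<close>

lemma lidealI:
  fixes J :: "'n::{finite,linorder} ratop set"
  assumes dops: "J \<subseteq> dops" and zero: "(\<lambda>f. 0) \<in> J"
    and add: "\<And>P Q. P \<in> J \<Longrightarrow> Q \<in> J \<Longrightarrow> (\<lambda>f. P f + Q f) \<in> J"
    and smult: "\<And>g P. P \<in> J \<Longrightarrow> (\<lambda>f. g * P f) \<in> J"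
    and pd: "\<And>i P. P \<in> J \<Longrightarrow> (\<lambda>f. pd i (P f)) \<in> J"
  shows "lideal J"
  unfolding lideal_def
proof (intro conjI ballI)
  fix Q P :: "'n ratop" assume Q: "Q \<in> dops" and P: "P \<in> J"
  have dpow: "(\<lambda>f. dpow m (P f)) \<in> J" for m
  proof (induction m rule: multiindex_induct)
    case zero
    then show ?case using P by (simp add: dpow_0)
  next
    case (step m i)
    from pd[OF this, of i] show ?case by (simp only: pd_dpow)
  qed
  from Q obtain S c where "finite S" and Qeq: "Q = (\<lambda>f. \<Sum>m\<in>S. c m * dpow m f)"
    by (rule dopsE)
  have "(\<lambda>f. \<Sum>m\<in>T. c m * dpow m (P f)) \<in> J" for T
    by (induction T rule: infinite_finite_induct) (auto intro: zero add smult[OF dpow])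
  then show "(\<lambda>f. Q (P f)) \<in> J" by (simp add: Qeq)
qed (use dops zero add in auto)

lemma left_ideal_iff_lideal: "left_ideal J diffop_ring \<longleftrightarrow> lideal J"
proof
  assume "left_ideal J diffop_ring"
  then interpret left_ideal J diffop_ring .
  show "lideal J"
    using a_subset additive_subgroup.zero_closed[OF additive_subgroup_axioms]
      additive_subgroup.a_closed[OF additive_subgroup_axioms] I_l_closed
    by (simp add: lideal_def diffop_ring_simps)
next
  assume J: "lideal J"
  interpret R: ring "diffop_ring :: ('a ratfun \<Rightarrow> 'a ratfun) ring" by (rule ring_diffop_ring)
  have neg: "\<ominus>\<^bsub>diffop_ring\<^esub> P = (\<lambda>f. - P f)" if "P \<in> dops" for P :: "'a ratfun \<Rightarrow> 'a ratfun"
    using that dops_smult[OF that, of "- 1"]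
    by (intro R.minus_equality) (simp_all add: diffop_ring_simps)
  have "subgroup J (add_monoid diffop_ring)"
  proof (rule R.add.subgroupI)
    show "J \<subseteq> dops" using J by (simp add: lideal_def)
    show "J \<noteq> {}" using lideal_zero[OF J] by blast
    fix P Q assume "P \<in> J" "Q \<in> J"
    then show "P \<oplus>\<^bsub>diffop_ring\<^esub> Q \<in> J"
      using lideal_add[OF J] by (simp add: diffop_ring_simps)
  next
    fix P assume P: "P \<in> J"
    then have "(\<lambda>f. (- 1) * P f) \<in> J" by (rule lideal_smult[OF J])
    then show "\<ominus>\<^bsub>diffop_ring\<^esub> P \<in> J" using neg[OF lideal_dops[OF J P]] by simp
  qed
  then show "left_ideal J diffop_ring"
    using lideal_comp[OF J]
    by (intro left_ideal.intro left_ideal_axioms.intro additive_subgroup.intro ring_diffop_ring)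
      (simp_all add: diffop_ring_simps)
qed

abbreviation hg_ideal :: "('n::{finite,linorder} \<Rightarrow> int ^ 'r) \<Rightarrow> complex ^ 'r \<Rightarrow>
    ('n ratfun \<Rightarrow> 'n ratfun) set"
  where "hg_ideal a \<alpha> \<equiv> genlideal diffop_ring (hg_ops a \<alpha>)"

lemma hg_ideal_eq: "hg_ideal a \<alpha> = \<Inter>{J. lideal J \<and> hg_ops a \<alpha> \<subseteq> J}"
  by (simp add: genlideal_def left_ideal_iff_lideal)

lemma lideal_dops_set: "lideal dops"
  by (simp add: lideal_def dops_zero dops_add dops_compose)

lemma lideal_hg_ideal: "lideal (hg_ideal a \<alpha>)"
proof -
  have "hg_ideal a \<alpha> \<subseteq> dops"
    using lideal_dops_set hg_ops_subset[of a \<alpha>] by (auto simp: hg_ideal_eq)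
  then show ?thesis unfolding lideal_def
    by (auto simp: hg_ideal_eq lideal_zero lideal_add lideal_comp)
qed

lemma hg_ideal_least: "lideal J \<Longrightarrow> hg_ops a \<alpha> \<subseteq> J \<Longrightarrow> hg_ideal a \<alpha> \<subseteq> J"
  by (auto simp: hg_ideal_eq)

lemma hg_ops_in_hg_ideal: "hg_ops a \<alpha> \<subseteq> hg_ideal a \<alpha>"
  by (auto simp: hg_ideal_eq)

lemma euler_in_hg_ideal: "(\<lambda>f. euler_op a i f - scalar (\<alpha> $ i) * f) \<in> hg_ideal a \<alpha>"
  by (rule subsetD[OF hg_ops_in_hg_ideal]) (auto simp: hg_ops_def)

lemma box_in_hg_ideal: "l \<in> rel_lattice a \<Longrightarrow> box_op l \<in> hg_ideal a \<alpha>"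
  by (rule subsetD[OF hg_ops_in_hg_ideal]) (auto simp: hg_ops_def)

text \<open>
  Submodules of the quotient correspond to left ideals containing the hypergeometric ideal.
\<close>

lemma hg_irreducibleI:
  fixes a :: "'n::{finite,linorder} \<Rightarrow> int ^ 'r"
  assumes max: "\<And>J. lideal J \<Longrightarrow> hg_ideal a \<alpha> \<subseteq> J \<Longrightarrow> J \<noteq> hg_ideal a \<alpha> \<Longrightarrow> id \<in> J"
  shows "hg_irreducible a \<alpha>"
  unfolding hg_irreducible_def simple_lmodule_def
proof (intro allI impI)
  let ?R = "diffop_ring :: ('n ratfun \<Rightarrow> 'n ratfun) ring"
  let ?H = "hg_ideal a \<alpha>" and ?M = "hg_module a \<alpha>"
  fix S assume "submodule S ?R ?M"
  then interpret S: submodule S ?R ?M .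
  interpret H: left_ideal ?H ?R using lideal_hg_ideal left_ideal_iff_lideal by blast
  have carr: "carrier ?M = {?H +>\<^bsub>?R\<^esub> P | P. P \<in> dops}"
    by (auto simp: hg_module_def lquot_def A_RCOSETS_def')
  have zero: "\<zero>\<^bsub>?M\<^esub> = ?H" by (simp add: hg_module_def lquot_def)
  have coset_zero: "?H +>\<^bsub>?R\<^esub> P = ?H \<longleftrightarrow> P \<in> ?H" if "P \<in> dops" for P
  proof
    assume "?H +>\<^bsub>?R\<^esub> P = ?H"
    moreover have "P \<in> ?H +>\<^bsub>?R\<^esub> P"
      using additive_subgroup.zero_closed[OF H.is_additive_subgroup] that by (force simp: a_r_coset_def' intro!: bexI[of _ "\<zero>\<^bsub>?R\<^esub>"])
    ultimately show "P \<in> ?H" by simp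
  next
    assume "P \<in> ?H"
    then show "?H +>\<^bsub>?R\<^esub> P = ?H"
      using H.a_subgroup that by (intro H.a_coset_join2) auto
  qed
  define J where "J = {P \<in> dops. ?H +>\<^bsub>?R\<^esub> P \<in> S}"
  have add: "?H +>\<^bsub>?R\<^esub> (P \<oplus>\<^bsub>?R\<^esub> Q) \<in> S" if "P \<in> J" "Q \<in> J" for P Q
  proof -
    interpret abelian_subgroup ?H ?R
      by (rule abelian_subgroupI3) (rule H.is_additive_subgroup, rule H.is_abelian_group)
    have "(?H +>\<^bsub>?R\<^esub> P) <+>\<^bsub>?R\<^esub> (?H +>\<^bsub>?R\<^esub> Q) \<in> S"
      using S.m_closed that by (auto simp: J_def hg_module_def lquot_def)
    then show ?thesis using that by (simp add: J_def a_rcos_sum)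
  qed
  have HS: "?H \<in> S" using S.one_closed by (simp add: hg_module_def lquot_def)
  have J: "lideal J"
    unfolding lideal_def
  proof (intro conjI ballI)
    have "(\<lambda>f. 0) \<in> ?H" by (rule lideal_zero[OF lideal_hg_ideal])
    then show "(\<lambda>f. 0) \<in> J" using HS coset_zero[of "\<lambda>f. 0"] by (simp add: J_def dops_zero)
    fix P Q assume P: "P \<in> J" and Q: "Q \<in> J"
    show "(\<lambda>f. P f + Q f) \<in> J"
      using add[OF P Q] P Q by (simp add: J_def dops_add diffop_ring_simps)
  next
    fix Q P :: "'n ratop" assume Q: "Q \<in> dops" and P: "P \<in> J"
    have "?H +>\<^bsub>?R\<^esub> (Q \<otimes>\<^bsub>?R\<^esub> P) \<in> S"
      using S.smult_closed[OF Q, of "?H +>\<^bsub>?R\<^esub> P"] P Q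
      by (simp add: J_def hg_module_def H.lquot_smult)
    then show "(\<lambda>f. Q (P f)) \<in> J"
      using P Q by (simp add: J_def dops_compose diffop_ring_simps)
  qed (auto simp: J_def)
  have HJ: "?H \<subseteq> J"
  proof
    fix P assume "P \<in> ?H"
    then show "P \<in> J" using HS coset_zero[of P] lideal_dops[OF lideal_hg_ideal] by (simp add: J_def)
  qed
  have S_sub: "S \<subseteq> carrier ?M" using S.subset by simp
  show "S = {\<zero>\<^bsub>?M\<^esub>} \<or> S = carrier ?M"
  proof (cases "J = ?H")
    case True
    have "X = ?H" if X: "X \<in> S" for X
    proof -
      have "X \<in> carrier ?M" using S_sub X by (rule subsetD)
      then obtain P where P: "P \<in> dops" and XP: "X = ?H +>\<^bsub>?R\<^esub> P" unfolding carr mem_Collect_eq by (elim exE conjE)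
      then have "P \<in> J" using X by (simp add: J_def)
      then have "P \<in> ?H" by (simp only: True)
      then show ?thesis unfolding XP by (simp only: coset_zero[OF P])
    qed
    then have "S = {?H}" using HS by blast
    then show ?thesis unfolding zero by (rule disjI1)
  next
    case False
    then have id: "id \<in> J" by (rule max[OF J HJ])
    have "X \<in> S" if "X \<in> carrier ?M" for X
    proof -
      from that obtain P where P: "P \<in> dops" "X = ?H +>\<^bsub>?R\<^esub> P" unfolding carr mem_Collect_eq by (elim exE conjE)
      have "(\<lambda>f. P (id f)) \<in> J" by (rule lideal_comp[OF J P(1) id])
      then show ?thesis unfolding P(2) by (simp add: J_def)
    qed
    then show ?thesis using S_sub by blast
  qed
qed

section \<open>Weights and the toric left ideal\<close>

definition wt :: "('n::finite \<Rightarrow> int ^ 'r) \<Rightarrow> ('n \<Rightarrow> nat) \<Rightarrow> int ^ 'r"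
  where "wt a m = (\<Sum>j\<in>UNIV. int (m j) *s a j)"

lemma wt_nth: "wt a m $ i = (\<Sum>j\<in>UNIV. int (m j) * a j $ i)"
  by (simp add: wt_def)

lemma wt_add: "wt a (\<lambda>j. m j + n j) = wt a m + wt a n"
  by (simp add: wt_def sum.distrib vector_sadd_rdistrib)

lemma wt_0: "wt a (\<lambda>_. 0) = 0"
  by (simp add: wt_def)

lemma wt_Suc: "wt a (m(i := Suc (m i))) = wt a m + a i"
proof -
  have "m(i := Suc (m i)) = (\<lambda>j. m j + (if j = i then 1 else 0))" by auto
  moreover have "wt a (\<lambda>j. if j = i then 1 else 0) = a i"
    by (simp add: wt_nth vec_eq_iff if_distrib[of "\<lambda>x. x * _"] if_distrib[of int] cong: if_cong)
  ultimately show ?thesis by (simp only: wt_add)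
qed

text \<open>
  The \<open>\<partial>\<^sup>m\<close> are linearly independent, so the sum of the coefficients over one weight depends only
  on the operator. This makes the symbol below well defined.
\<close>

lemma weight_sum_unique:
  fixes c d :: "('n::{finite,linorder} \<Rightarrow> nat) \<Rightarrow> 'n ratfun"
  assumes S: "finite S" and T: "finite T"
    and eq: "(\<lambda>f. \<Sum>m\<in>S. c m * dpow m f) = (\<lambda>f. \<Sum>m\<in>T. d m * dpow m f)"
  shows "(\<Sum>m\<in>{m\<in>S. wt a m = \<gamma>}. c m) = (\<Sum>m\<in>{m\<in>T. wt a m = \<gamma>}. d m)"
proof -
  define c' where "c' m = (if m \<in> S then c m else 0)" for m
  define d' where "d' m = (if m \<in> T then d m else 0)" for m
  have "(\<Sum>m\<in>S \<union> T. c' m * dpow m f) = (\<Sum>m\<in>S. c m * dpow m f)" for f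
    using S T by (intro sum.mono_neutral_cong_right) (auto simp: c'_def)
  moreover have "(\<Sum>m\<in>S \<union> T. d' m * dpow m f) = (\<Sum>m\<in>T. d m * dpow m f)" for f
    using S T by (intro sum.mono_neutral_cong_right) (auto simp: d'_def)
  ultimately have "(\<Sum>m\<in>S \<union> T. (c' m - d' m) * dpow m f) = 0" for f
    using fun_cong[OF eq, of f] by (simp add: left_diff_distrib sum_subtractf)
  from dpow_independent[OF _ this] have "c' m = d' m" if "m \<in> S \<union> T" for m
    using that S T by auto
  then have "(\<Sum>m\<in>{m\<in>S \<union> T. wt a m = \<gamma>}. c' m) = (\<Sum>m\<in>{m\<in>S \<union> T. wt a m = \<gamma>}. d' m)"
    by (intro sum.cong) auto
  moreover have "(\<Sum>m\<in>{m\<in>S \<union> T. wt a m = \<gamma>}. c' m) = (\<Sum>m\<in>{m\<in>S. wt a m = \<gamma>}. c m)"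
    using S T by (intro sum.mono_neutral_cong_right) (auto simp: c'_def)
  moreover have "(\<Sum>m\<in>{m\<in>S \<union> T. wt a m = \<gamma>}. d' m) = (\<Sum>m\<in>{m\<in>T. wt a m = \<gamma>}. d m)"
    using S T by (intro sum.mono_neutral_cong_right) (auto simp: d'_def)
  ultimately show ?thesis by simp
qed

text \<open>
  The coefficients of the Laurent polynomial in \<open>t\<close> that arises when \<open>X\<close> is applied to the function
  \<open>exp (\<Sum>\<^sub>j v\<^sub>j t^(a\<^sub>j))\<close> and the result is divided by that function: each \<open>\<partial>\<^sup>m\<close> contributes \<open>t^(A m)\<close>.
  The box operators are differences of monomials of equal weight, so they annihilate this function.
\<close>

definition toric_symbol :: "('n::{finite,linorder} \<Rightarrow> int ^ 'r) \<Rightarrow> 'n ratop \<Rightarrow> int ^ 'r \<Rightarrow> 'n ratfun"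
  where "toric_symbol a X \<gamma> = (THE s. \<exists>S c. finite S \<and> X = (\<lambda>f. \<Sum>m\<in>S. c m * dpow m f) \<and>
    s = (\<Sum>m\<in>{m\<in>S. wt a m = \<gamma>}. c m))"

lemma toric_symbol_eq:
  assumes "finite S"
  shows "toric_symbol a (\<lambda>f. \<Sum>m\<in>S. c m * dpow m f) \<gamma> = (\<Sum>m\<in>{m\<in>S. wt a m = \<gamma>}. c m)"
  unfolding toric_symbol_def
proof (rule the_equality)
  fix s
  assume "\<exists>T d. finite T \<and> (\<lambda>f. \<Sum>m\<in>S. c m * dpow m f) = (\<lambda>f. \<Sum>m\<in>T. d m * dpow m f) \<and>
    s = (\<Sum>m\<in>{m\<in>T. wt a m = \<gamma>}. d m)"
  then obtain T d where T: "finite T"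
    and eq: "(\<lambda>f. \<Sum>m\<in>S. c m * dpow m f) = (\<lambda>f. \<Sum>m\<in>T. d m * dpow m f)"
    and s: "s = (\<Sum>m\<in>{m\<in>T. wt a m = \<gamma>}. d m)" by auto
  show "s = (\<Sum>m\<in>{m\<in>S. wt a m = \<gamma>}. c m)"
    unfolding s by (rule weight_sum_unique[OF assms T eq, symmetric])
qed (use assms in blast)

lemma toric_symbol_dpow: "toric_symbol a (\<lambda>f. g * dpow m f) \<gamma> = (if wt a m = \<gamma> then g else 0)"
proof -
  have "{x. x = m \<and> wt a x = \<gamma>} = (if wt a m = \<gamma> then {m} else {})" by auto
  then show ?thesis using toric_symbol_eq[of "{m}" a "\<lambda>_. g" \<gamma>] by simp
qed

lemma toric_symbol_add:
  assumes "X \<in> dops" "Y \<in> dops"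
  shows "toric_symbol a (\<lambda>f. X f + Y f) \<gamma> = toric_symbol a X \<gamma> + toric_symbol a Y \<gamma>"
proof -
  from assms(1) obtain S c where S: "finite S" and X: "X = (\<lambda>f. \<Sum>m\<in>S. c m * dpow m f)" by (rule dopsE)
  from assms(2) obtain T d where T: "finite T" and Y: "Y = (\<lambda>f. \<Sum>m\<in>T. d m * dpow m f)" by (rule dopsE)
  define c' where "c' m = (if m \<in> S then c m else 0)" for m
  define d' where "d' m = (if m \<in> T then d m else 0)" for m
  have X': "X = (\<lambda>f. \<Sum>m\<in>S \<union> T. c' m * dpow m f)"
    unfolding X using S T by (intro ext sum.mono_neutral_cong_left) (auto simp: c'_def)
  have Y': "Y = (\<lambda>f. \<Sum>m\<in>S \<union> T. d' m * dpow m f)"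
    unfolding Y using S T by (intro ext sum.mono_neutral_cong_left) (auto simp: d'_def)
  have XY: "(\<lambda>f. X f + Y f) = (\<lambda>f. \<Sum>m\<in>S \<union> T. (c' m + d' m) * dpow m f)"
    by (simp add: X' Y' distrib_right sum.distrib)
  have fin: "finite (S \<union> T)" using S T by simp
  show ?thesis unfolding XY toric_symbol_eq[OF fin] unfolding X' Y' toric_symbol_eq[OF fin]
    by (simp add: sum.distrib)
qed

lemma toric_symbol_smult:
  assumes "X \<in> dops"
  shows "toric_symbol a (\<lambda>f. g * X f) \<gamma> = g * toric_symbol a X \<gamma>"
proof -
  from assms obtain S c where S: "finite S" and X: "X = (\<lambda>f. \<Sum>m\<in>S. c m * dpow m f)" by (rule dopsE)
  have gX: "(\<lambda>f. g * X f) = (\<lambda>f. \<Sum>m\<in>S. (g * c m) * dpow m f)"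
    by (simp add: X sum_distrib_left mult.assoc)
  show ?thesis unfolding gX toric_symbol_eq[OF S] unfolding X toric_symbol_eq[OF S]
    by (simp add: sum_distrib_left)
qed

lemma toric_symbol_zero: "toric_symbol a (\<lambda>f. 0) \<gamma> = 0"
  using toric_symbol_eq[of "{}" a _ \<gamma>] by simp

lemma toric_symbol_sum:
  assumes "\<And>s. s \<in> S \<Longrightarrow> X s \<in> dops"
  shows "toric_symbol a (\<lambda>f. \<Sum>s\<in>S. X s f) \<gamma> = (\<Sum>s\<in>S. toric_symbol a (X s) \<gamma>)"
  using assms
  by (induction S rule: infinite_finite_induct) (auto simp: toric_symbol_zero toric_symbol_add dops_sum)

lemma toric_symbol_pd:
  assumes "X \<in> dops"
  shows "toric_symbol a (\<lambda>f. pd i (X f)) \<gamma> = pd i (toric_symbol a X \<gamma>) + toric_symbol a X (\<gamma> - a i)"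
proof -
  from assms obtain S c where S: "finite S" and X: "X = (\<lambda>f. \<Sum>m\<in>S. c m * dpow m f)" by (rule dopsE)
  have pdX: "(\<lambda>f. pd i (X f)) =
      (\<lambda>f. \<Sum>m\<in>S. pd i (c m) * dpow m f + c m * dpow (m(i := Suc (m i))) f)"
    by (simp add: X pd_sum pd_mult pd_dpow)
  have sX: "toric_symbol a X \<delta> = (\<Sum>m\<in>S. if wt a m = \<delta> then c m else 0)" for \<delta>
    unfolding X by (simp add: toric_symbol_eq[OF S] sum.inter_filter[OF S])
  have pd0: "pd i 0 = 0" using pd_scalar[of i 0] by simp
  have "wt a m + a i = \<gamma> \<longleftrightarrow> wt a m = \<gamma> - a i" for m by (auto simp: algebra_simps)
  then have "toric_symbol a (\<lambda>f. pd i (X f)) \<gamma> =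
      (\<Sum>m\<in>S. (if wt a m = \<gamma> then pd i (c m) else 0) + (if wt a m = \<gamma> - a i then c m else 0))"
    unfolding pdX
    by (subst toric_symbol_sum)
      (auto intro!: dops_add dops_smult dops_dpow sum.cong
        simp: toric_symbol_add toric_symbol_dpow dops_smult dops_dpow wt_Suc simp del: fun_upd_apply)
  then show ?thesis by (simp add: sX sum.distrib pd_sum if_distrib[of "pd i"] pd0 cong: if_cong)
qed

lemma toric_symbol_dpow_right:
  assumes "X \<in> dops"
  shows "toric_symbol a (\<lambda>f. X (dpow w f)) \<gamma> = toric_symbol a X (\<gamma> - wt a w)"
proof -
  from assms obtain S c where S: "finite S" and X: "X = (\<lambda>f. \<Sum>m\<in>S. c m * dpow m f)" by (rule dopsE)
  have "wt a m + wt a w = \<gamma> \<longleftrightarrow> wt a m = \<gamma> - wt a w" for m by (auto simp: algebra_simps)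
  then have "toric_symbol a (\<lambda>f. X (dpow w f)) \<gamma> = (\<Sum>m\<in>S. if wt a m = \<gamma> - wt a w then c m else 0)"
    unfolding X dpow_dpow
    by (subst toric_symbol_sum) (auto intro!: dops_smult dops_dpow simp: toric_symbol_dpow wt_add)
  also have "\<dots> = toric_symbol a X (\<gamma> - wt a w)"
    unfolding X by (simp add: toric_symbol_eq[OF S] sum.inter_filter[OF S])
  finally show ?thesis .
qed

text \<open>
  The left ideal generated by the box operators. Taking the kernel of the symbol as its
  definition gives cancellation of a right factor \<open>\<partial>\<^sup>w\<close> without further work.
\<close>

definition toric_ideal :: "('n::{finite,linorder} \<Rightarrow> int ^ 'r) \<Rightarrow> 'n ratop set"
  where "toric_ideal a = {X \<in> dops. \<forall>\<gamma>. toric_symbol a X \<gamma> = 0}"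

lemma lideal_toric_ideal: "lideal (toric_ideal a)"
proof (rule lidealI)
  show "(\<lambda>f. pd i (P f)) \<in> toric_ideal a" if "P \<in> toric_ideal a" for i P
    using that pd_scalar[of i 0] by (simp add: toric_ideal_def toric_symbol_pd dops_compose[OF dops_pd])
qed (auto simp: toric_ideal_def dops_zero dops_add dops_smult toric_symbol_zero toric_symbol_add
      toric_symbol_smult)

text \<open>
  A right factor \<open>\<partial>\<^sup>w\<close> translates the symbol by the weight of \<open>w\<close>, and a translation of
  \<open>\<int>\<^sup>r\<close> loses no coefficients.
\<close>

lemma toric_ideal_dpow_right_iff:
  assumes "X \<in> dops"
  shows "(\<lambda>f. X (dpow w f)) \<in> toric_ideal a \<longleftrightarrow> X \<in> toric_ideal a"
proof -
  have "(\<forall>\<gamma>. toric_symbol a X (\<gamma> - wt a w) = 0) \<longleftrightarrow> (\<forall>\<gamma>. toric_symbol a X \<gamma> = 0)"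
    by (metis add_diff_cancel_right')
  then show ?thesis
    using assms by (simp add: toric_ideal_def toric_symbol_dpow_right dops_compose dops_dpow)
qed

lemma dpow_diff_in_toric_ideal:
  assumes "wt a m = wt a n"
  shows "(\<lambda>f. dpow m f - dpow n f) \<in> toric_ideal a"
proof -
  have "(\<lambda>f. 1 * dpow m f + (- 1) * dpow n f) \<in> toric_ideal a"
    unfolding toric_ideal_def
    by (simp only: mem_Collect_eq toric_symbol_add[OF dops_smult dops_smult, OF dops_dpow dops_dpow]
        toric_symbol_dpow assms) (auto intro!: dops_add[OF dops_smult dops_smult] dops_diff dops_dpow)
  then show ?thesis by simp
qed

text \<open>
  Choose one monomial in every weight and replace each \<open>\<partial>\<^sup>m\<close> by the chosen monomial of the same
  weight: what is subtracted has the vanishing symbol sums as its coefficients.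
\<close>

lemma toric_idealE:
  assumes "X \<in> toric_ideal a"
  obtains S c r where "finite S" "\<forall>m\<in>S. wt a (r m) = wt a m"
    "X = (\<lambda>f. \<Sum>m\<in>S. c m * (dpow m f - dpow (r m) f))"
proof -
  from assms have "X \<in> dops" by (simp add: toric_ideal_def)
  then obtain S c where S: "finite S" and X: "X = (\<lambda>f. \<Sum>m\<in>S. c m * dpow m f)" by (rule dopsE)
  define \<rho> where "\<rho> \<gamma> = (SOME n. wt a n = \<gamma>)" for \<gamma>
  have \<rho>: "wt a (\<rho> (wt a m)) = wt a m" for m
    unfolding \<rho>_def using someI[of "\<lambda>n. wt a n = wt a m" m] by simp
  have zero: "(\<Sum>m\<in>{m\<in>S. wt a m = \<gamma>}. c m) = 0" for \<gamma>
    using assms by (simp add: toric_ideal_def X toric_symbol_eq[OF S])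
  have "(\<Sum>m\<in>S. c m * dpow (\<rho> (wt a m)) f) = 0" for f
  proof -
    have "(\<Sum>m\<in>S. c m * dpow (\<rho> (wt a m)) f) =
        (\<Sum>\<gamma>\<in>wt a ` S. \<Sum>m\<in>{m\<in>S. wt a m = \<gamma>}. c m * dpow (\<rho> (wt a m)) f)"
      by (rule sum.image_gen[OF S])
    also have "\<dots> = (\<Sum>\<gamma>\<in>wt a ` S. (\<Sum>m\<in>{m\<in>S. wt a m = \<gamma>}. c m) * dpow (\<rho> \<gamma>) f)"
      unfolding sum_distrib_right by (intro sum.cong) auto
    finally show ?thesis by (simp add: zero)
  qed
  then have "X = (\<lambda>f. \<Sum>m\<in>S. c m * (dpow m f - dpow (\<rho> (wt a m)) f))"
    by (simp add: X right_diff_distrib sum_subtractf)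
  with S \<rho> show thesis by (intro that[of S "\<lambda>m. \<rho> (wt a m)" c]) auto
qed

lemma toric_ideal_subset_hg_ideal: "toric_ideal a \<subseteq> hg_ideal a \<alpha>"
proof
  fix X assume "X \<in> toric_ideal a"
  then obtain S c r where S: "finite S" and r: "\<forall>m\<in>S. wt a (r m) = wt a m"
    and X: "X = (\<lambda>f. \<Sum>m\<in>S. c m * (dpow m f - dpow (r m) f))"
    by (rule toric_idealE)
  have "(\<lambda>f. dpow m f - dpow n f) \<in> hg_ideal a \<alpha>" if "wt a n = wt a m" for m n
  proof -
    define l where "l j = int (m j) - int (n j)" for j
    define k where "k j = min (m j) (n j)" for j
    have "l \<in> rel_lattice a"
      using that by (simp add: rel_lattice_def l_def wt_def vec.scale_left_diff_distrib sum_subtractf)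
    then have "(\<lambda>f. dpow k (box_op l f)) \<in> hg_ideal a \<alpha>"
      by (intro lideal_comp[OF lideal_hg_ideal dops_dpow] box_in_hg_ideal)
    moreover have "(\<lambda>j. k j + nat (l j)) = m" "(\<lambda>j. k j + nat (- l j)) = n"
      by (auto simp: k_def l_def)
    ultimately show ?thesis
      by (simp add: box_op_def dops_diff_arg[OF dops_dpow] dpow_dpow)
  qed
  then show "X \<in> hg_ideal a \<alpha>"
    unfolding X using r by (intro lideal_sum lideal_smult lideal_hg_ideal) auto
qed

section \<open>Polynomials in the operators \<open>v\<^sub>j \<partial>\<^sub>j\<close>\<close>

definition vmon :: "('n::{finite,linorder} \<Rightarrow> nat) \<Rightarrow> 'n ratfun"
  where "vmon k = (\<Prod>j\<in>UNIV. var j ^ k j)"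

lemma vmon_0: "vmon (\<lambda>_. 0) = 1"
  by (simp add: vmon_def)

lemma vmon_Suc: "vmon (k(i := Suc (k i))) = var i * vmon k"
proof -
  have "(\<Prod>j\<in>UNIV - {i}. var j ^ (k(i := Suc (k i))) j) = (\<Prod>j\<in>UNIV - {i}. var j ^ k j)"
    by (rule prod.cong) auto
  then show ?thesis by (simp add: vmon_def prod.remove[of UNIV i] mult.assoc)
qed

lemma var_pd_vmon: "var j * pd j (vmon k) = of_nat (k j) * vmon k"
proof (induction k rule: multiindex_induct)
  case zero
  then show ?case using pd_scalar[of j 1] by (simp add: vmon_0)
next
  case (step k i)
  have "var j * pd j (vmon (k(i := Suc (k i)))) =
      (if j = i then var j * vmon k else 0) + var i * (var j * pd j (vmon k))"
    by (simp only: vmon_Suc pd_mult pd_var) (auto simp: algebra_simps)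
  also have "\<dots> = of_nat ((k(i := Suc (k i))) j) * (var i * vmon k)"
    by (simp add: step algebra_simps)
  finally show ?case by (simp only: vmon_Suc)
qed

text \<open>
  The Newton basis of the polynomials. Its relevance is that substituting the operators
  \<open>\<theta>\<^sub>j = v\<^sub>j \<partial>\<^sub>j\<close> for the coordinates gives \<open>v\<^sup>k \<partial>\<^sup>k\<close>.
\<close>

definition falling :: "('n::finite \<Rightarrow> nat) \<Rightarrow> ('n \<Rightarrow> complex) \<Rightarrow> complex"
  where "falling k \<theta> = (\<Prod>j\<in>UNIV. \<Prod>i<k j. \<theta> j - of_nat i)"

lemma falling_0: "falling (\<lambda>_. 0) \<theta> = 1"
  by (simp add: falling_def)

lemma falling_Suc: "falling (k(i := Suc (k i))) \<theta> = falling k \<theta> * (\<theta> i - of_nat (k i))"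
proof -
  have "(\<Prod>j\<in>UNIV - {i}. \<Prod>l<(k(i := Suc (k i))) j. \<theta> j - of_nat l) =
      (\<Prod>j\<in>UNIV - {i}. \<Prod>l<k j. \<theta> j - of_nat l)"
    by (rule prod.cong) auto
  then show ?thesis by (simp add: falling_def prod.remove[of UNIV i] algebra_simps)
qed

lemma falling_of_nat_eq_0_iff: "falling k (\<lambda>j. of_nat (w j)) = 0 \<longleftrightarrow> \<not> k \<le> w"
  by (auto simp: falling_def le_fun_def not_le)

text \<open>
  The Newton basis is triangular for the componentwise order: at the point \<open>m\<close> only the basis
  elements with \<open>k \<le> m\<close> survive. With an upward closed \<open>U\<close>, evaluation at a minimal exponent
  outside \<open>U\<close> isolates its coefficient. For \<open>U = {}\<close> this is uniqueness of Newton expansions; for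
  general \<open>U\<close> it shows that a polynomial which vanishes off a monomial ideal is spanned by the
  falling factorials of that ideal.
\<close>

lemma newton_coeff_eq_0:
  fixes c :: "('n::finite \<Rightarrow> nat) \<Rightarrow> complex"
  assumes S: "finite S"
    and vanish: "\<And>w. w \<notin> U \<Longrightarrow> (\<Sum>k\<in>S. c k * falling k (\<lambda>j. of_nat (w j))) = 0"
    and up: "\<And>k w. k \<in> U \<Longrightarrow> k \<le> w \<Longrightarrow> w \<in> U"
    and k: "k \<in> S" "k \<notin> U"
  shows "c k = 0"
proof (rule ccontr)
  assume "c k \<noteq> 0"
  then obtain m where m: "m \<in> S" "m \<notin> U" "c m \<noteq> 0"
    and least: "\<And>n. n \<in> S \<Longrightarrow> n \<notin> U \<Longrightarrow> c n \<noteq> 0 \<Longrightarrow> sum m UNIV \<le> sum n UNIV"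
    using ex_has_least_nat[of "\<lambda>m. m \<in> S \<and> m \<notin> U \<and> c m \<noteq> 0" k "\<lambda>m. sum m UNIV"] k by blast
  have "c n * falling n (\<lambda>j. of_nat (m j)) = 0" if n: "n \<in> S - {m}" for n
  proof (rule ccontr)
    assume "c n * falling n (\<lambda>j. of_nat (m j)) \<noteq> 0"
    then have "c n \<noteq> 0" "n \<le> m" by (auto simp: falling_of_nat_eq_0_iff)
    then have "sum m UNIV \<le> sum n UNIV" using least up m(2) n by blast
    moreover obtain i where "n i < m i" using n \<open>n \<le> m\<close> by (force simp: le_fun_def fun_eq_iff le_less)
    then have "sum n UNIV < sum m UNIV"
      using \<open>n \<le> m\<close> by (intro sum_strict_mono_ex1) (auto simp: le_fun_def)
    ultimately show False by simp
  qed
  then have "(\<Sum>k\<in>S - {m}. c k * falling k (\<lambda>j. of_nat (m j))) = 0" by (rule sum.neutral[OF ballI])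
  then have "(\<Sum>k\<in>S. c k * falling k (\<lambda>j. of_nat (m j))) = c m * falling m (\<lambda>j. of_nat (m j))"
    by (simp add: sum.remove[OF S m(1)])
  then show False using vanish[OF m(2)] m(3) by (auto simp: falling_of_nat_eq_0_iff)
qed

text \<open>
  \<open>X\<close> is the operator \<open>p(\<theta>)\<close>. Going through the Newton expansion brings \<open>p(\<theta>)\<close> into the normal form
  with coefficients on the left and derivations on the right.
\<close>

definition newton_rep :: "(('n::{finite,linorder} \<Rightarrow> complex) \<Rightarrow> complex) \<Rightarrow> 'n ratop \<Rightarrow> bool"
  where "newton_rep p X \<longleftrightarrow> (\<exists>S c. finite S \<and> p = (\<lambda>\<theta>. \<Sum>k\<in>S. c k * falling k \<theta>) \<and>
    X = (\<lambda>f. \<Sum>k\<in>S. scalar (c k) * (vmon k * dpow k f)))"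

lemma newton_repE:
  assumes "newton_rep p X"
  obtains S c where "finite S" "p = (\<lambda>\<theta>. \<Sum>k\<in>S. c k * falling k \<theta>)"
    "X = (\<lambda>f. \<Sum>k\<in>S. scalar (c k) * (vmon k * dpow k f))"
  using assms by (auto simp: newton_rep_def)

lemma newton_rep_common:
  assumes "newton_rep p X" "newton_rep q Y"
  obtains S c d where "finite S" "p = (\<lambda>\<theta>. \<Sum>k\<in>S. c k * falling k \<theta>)" "q = (\<lambda>\<theta>. \<Sum>k\<in>S. d k * falling k \<theta>)"
    "X = (\<lambda>f. \<Sum>k\<in>S. scalar (c k) * (vmon k * dpow k f))"
    "Y = (\<lambda>f. \<Sum>k\<in>S. scalar (d k) * (vmon k * dpow k f))"
proof -
  from assms(1) obtain S c where S: "finite S" and p: "p = (\<lambda>\<theta>. \<Sum>k\<in>S. c k * falling k \<theta>)"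
    and X: "X = (\<lambda>f. \<Sum>k\<in>S. scalar (c k) * (vmon k * dpow k f))" by (rule newton_repE)
  from assms(2) obtain T d where T: "finite T" and q: "q = (\<lambda>\<theta>. \<Sum>k\<in>T. d k * falling k \<theta>)"
    and Y: "Y = (\<lambda>f. \<Sum>k\<in>T. scalar (d k) * (vmon k * dpow k f))" by (rule newton_repE)
  define c' where "c' m = (if m \<in> S then c m else 0)" for m
  define d' where "d' m = (if m \<in> T then d m else 0)" for m
  have fin: "finite (S \<union> T)" using S T by simp
  have "p = (\<lambda>\<theta>. \<Sum>k\<in>S \<union> T. c' k * falling k \<theta>)"
    unfolding p using fin by (intro ext sum.mono_neutral_cong_left) (auto simp: c'_def)
  moreover have "q = (\<lambda>\<theta>. \<Sum>k\<in>S \<union> T. d' k * falling k \<theta>)"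
    unfolding q using fin by (intro ext sum.mono_neutral_cong_left) (auto simp: d'_def)
  moreover have "X = (\<lambda>f. \<Sum>k\<in>S \<union> T. scalar (c' k) * (vmon k * dpow k f))"
    unfolding X using fin by (intro ext sum.mono_neutral_cong_left) (auto simp: c'_def)
  moreover have "Y = (\<lambda>f. \<Sum>k\<in>S \<union> T. scalar (d' k) * (vmon k * dpow k f))"
    unfolding Y using fin by (intro ext sum.mono_neutral_cong_left) (auto simp: d'_def)
  ultimately show thesis using fin that by blast
qed

lemma newton_rep_unique:
  assumes "newton_rep p X" "newton_rep p Y"
  shows "X = Y"
proof -
  obtain S c d where S: "finite S" and p: "p = (\<lambda>\<theta>. \<Sum>k\<in>S. c k * falling k \<theta>)" "p = (\<lambda>\<theta>. \<Sum>k\<in>S. d k * falling k \<theta>)"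
    and X: "X = (\<lambda>f. \<Sum>k\<in>S. scalar (c k) * (vmon k * dpow k f))"
    and Y: "Y = (\<lambda>f. \<Sum>k\<in>S. scalar (d k) * (vmon k * dpow k f))"
    by (rule newton_rep_common[OF assms])
  have "(\<Sum>k\<in>S. (c k - d k) * falling k \<theta>) = 0" for \<theta>
    using fun_cong[OF p(1), of \<theta>] fun_cong[OF p(2), of \<theta>]
    by (simp add: left_diff_distrib sum_subtractf)
  then have "c k - d k = 0" if "k \<in> S" for k
    using newton_coeff_eq_0[OF S, of "{}" "\<lambda>k. c k - d k" k] that by simp
  then show ?thesis by (auto simp: X Y intro!: sum.cong)
qed

lemma newton_rep_zero: "newton_rep (\<lambda>_. 0) (\<lambda>f. 0)"
  unfolding newton_rep_def by (rule exI[of _ "{}"]) simp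

lemma newton_rep_falling: "newton_rep (falling k) (\<lambda>f. vmon k * dpow k f)"
  unfolding newton_rep_def by (rule exI[of _ "{k}"], rule exI[of _ "\<lambda>_. 1"]) simp

lemma newton_rep_add:
  assumes "newton_rep p X" "newton_rep q Y"
  shows "newton_rep (\<lambda>\<theta>. p \<theta> + q \<theta>) (\<lambda>f. X f + Y f)"
proof -
  obtain S c d where "finite S" and "p = (\<lambda>\<theta>. \<Sum>k\<in>S. c k * falling k \<theta>)" "q = (\<lambda>\<theta>. \<Sum>k\<in>S. d k * falling k \<theta>)"
    and "X = (\<lambda>f. \<Sum>k\<in>S. scalar (c k) * (vmon k * dpow k f))"
    and "Y = (\<lambda>f. \<Sum>k\<in>S. scalar (d k) * (vmon k * dpow k f))"
    by (rule newton_rep_common[OF assms])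
  then show ?thesis unfolding newton_rep_def
    by (intro exI[of _ S] exI[of _ "\<lambda>k. c k + d k"])
      (simp add: distrib_right sum.distrib scalar_add)
qed

lemma newton_rep_scale:
  assumes "newton_rep p X"
  shows "newton_rep (\<lambda>\<theta>. b * p \<theta>) (\<lambda>f. scalar b * X f)"
proof -
  from assms obtain S c where "finite S" "p = (\<lambda>\<theta>. \<Sum>k\<in>S. c k * falling k \<theta>)"
    "X = (\<lambda>f. \<Sum>k\<in>S. scalar (c k) * (vmon k * dpow k f))" by (rule newton_repE)
  then show ?thesis unfolding newton_rep_def
    by (intro exI[of _ S] exI[of _ "\<lambda>k. b * c k"])
      (simp add: sum_distrib_left scalar_mult mult.assoc)
qed

lemma newton_rep_sum:
  "(\<And>s. s \<in> S \<Longrightarrow> newton_rep (p s) (X s)) \<Longrightarrow> newton_rep (\<lambda>\<theta>. \<Sum>s\<in>S. p s \<theta>) (\<lambda>f. \<Sum>s\<in>S. X s f)"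
  by (induction S rule: infinite_finite_induct) (auto simp: newton_rep_zero intro: newton_rep_add)

lemma newton_rep_const: "newton_rep (\<lambda>_. c) (\<lambda>f. scalar c * f)"
  using newton_rep_scale[OF newton_rep_falling[of "\<lambda>_. 0"], of c] by (simp add: falling_0 vmon_0 dpow_0)

lemma newton_rep_coord:
  assumes "newton_rep p X"
  shows "newton_rep (\<lambda>\<theta>. \<theta> j * p \<theta>) (\<lambda>f. var j * pd j (X f))"
proof -
  from assms obtain S c where S: "finite S" and p: "p = (\<lambda>\<theta>. \<Sum>k\<in>S. c k * falling k \<theta>)"
    and X: "X = (\<lambda>f. \<Sum>k\<in>S. scalar (c k) * (vmon k * dpow k f))" by (rule newton_repE)
  have "\<theta> j * falling k \<theta> = falling (k(j := Suc (k j))) \<theta> + of_nat (k j) * falling k \<theta>" for k \<theta>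
    by (simp add: falling_Suc algebra_simps del: fun_upd_apply)
  then have p': "(\<lambda>\<theta>. \<theta> j * p \<theta>) =
      (\<lambda>\<theta>. \<Sum>k\<in>S. c k * (falling (k(j := Suc (k j))) \<theta> + of_nat (k j) * falling k \<theta>))"
    by (simp add: p sum_distrib_left mult.left_commute[of "_ j"] del: fun_upd_apply)
  have "var j * pd j (vmon k * dpow k f) =
      vmon (k(j := Suc (k j))) * dpow (k(j := Suc (k j))) f + scalar (of_nat (k j)) * (vmon k * dpow k f)" for k f
    by (simp only: pd_mult distrib_left vmon_Suc scalar_of_nat flip: mult.assoc)
      (simp add: var_pd_vmon pd_dpow mult.assoc del: fun_upd_apply)
  then have X': "(\<lambda>f. var j * pd j (X f)) =
      (\<lambda>f. \<Sum>k\<in>S. scalar (c k) * (vmon (k(j := Suc (k j))) * dpow (k(j := Suc (k j))) f +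
        scalar (of_nat (k j)) * (vmon k * dpow k f)))"
    by (simp add: X pd_sum pd_scalar_mult sum_distrib_left mult.left_commute[of "var j"] del: fun_upd_apply)
  show ?thesis unfolding p' X'
    by (intro newton_rep_sum newton_rep_scale newton_rep_add newton_rep_falling)
qed

subsection \<open>Polynomial functions\<close>

text \<open>
  Polynomial functions of total degree less than \<open>n\<close>. The strict bound lets the zero polynomial
  be the only one at \<open>n = 0\<close>, where the descent by differences stops.
\<close>

inductive poly_less :: "nat \<Rightarrow> (('n \<Rightarrow> complex) \<Rightarrow> complex) \<Rightarrow> bool" where
  poly_less_zero: "poly_less n (\<lambda>_. 0)"
| poly_less_const: "poly_less (Suc n) (\<lambda>_. c)"
| poly_less_add: "poly_less n p \<Longrightarrow> poly_less n q \<Longrightarrow> poly_less n (\<lambda>\<theta>. p \<theta> + q \<theta>)"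
| poly_less_coord: "poly_less n p \<Longrightarrow> poly_less (Suc n) (\<lambda>\<theta>. \<theta> j * p \<theta>)"

lemma poly_less_Suc: "poly_less n p \<Longrightarrow> poly_less (Suc n) p"
  by (induction rule: poly_less.induct) (auto intro: poly_less.intros)

lemma poly_less_mono: "poly_less m p \<Longrightarrow> m \<le> n \<Longrightarrow> poly_less n p"
  by (rotate_tac, induction rule: dec_induct) (auto intro: poly_less_Suc)

lemma poly_less_0: "poly_less 0 p \<Longrightarrow> p = (\<lambda>_. 0)"
  by (induction "0::nat" p rule: poly_less.induct) auto

lemma poly_less_scale: "poly_less n p \<Longrightarrow> poly_less n (\<lambda>\<theta>. c * p \<theta>)"
proof (induction rule: poly_less.induct)
  case (poly_less_add n p q)
  from poly_less.poly_less_add[OF poly_less_add.IH] show ?case by (simp add: distrib_left)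
next
  case (poly_less_coord n p j)
  from poly_less.poly_less_coord[OF poly_less_coord.IH] show ?case by (simp add: mult.left_commute)
qed (auto intro: poly_less.intros)

lemma poly_less_diff: "poly_less n p \<Longrightarrow> poly_less n q \<Longrightarrow> poly_less n (\<lambda>\<theta>. p \<theta> - q \<theta>)"
  using poly_less_add[of n p "\<lambda>\<theta>. (- 1) * q \<theta>"] poly_less_scale[of n q "- 1"] by simp

lemma poly_less_shift: "poly_less n p \<Longrightarrow> poly_less n (\<lambda>\<theta>. p (\<lambda>j. \<theta> j + s j))"
proof (induction rule: poly_less.induct)
  case (poly_less_coord n p j)
  then have "poly_less (Suc n) (\<lambda>\<theta>. \<theta> j * p (\<lambda>j. \<theta> j + s j) + s j * p (\<lambda>j. \<theta> j + s j))"
    by (intro poly_less.intros poly_less_scale poly_less_Suc)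
  then show ?case by (simp add: distrib_right)
qed (auto intro: poly_less.intros)

lemma poly_less_increment: "poly_less n p \<Longrightarrow> poly_less (n - 1) (\<lambda>\<theta>. p (\<lambda>j. \<theta> j + s j) - p \<theta>)"
proof (induction rule: poly_less.induct)
  case (poly_less_add n p q)
  from poly_less.poly_less_add[OF poly_less_add.IH] show ?case by (simp add: algebra_simps)
next
  case (poly_less_coord n p j)
  have eq: "(\<lambda>\<theta>. (\<theta> j + s j) * p (\<lambda>j. \<theta> j + s j) - \<theta> j * p \<theta>) =
      (\<lambda>\<theta>. \<theta> j * (p (\<lambda>j. \<theta> j + s j) - p \<theta>) + s j * p (\<lambda>j. \<theta> j + s j))"
    by (simp add: algebra_simps)
  have "poly_less n (\<lambda>\<theta>. \<theta> j * (p (\<lambda>j. \<theta> j + s j) - p \<theta>))"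
  proof (cases n)
    case 0
    then have "p = (\<lambda>_. 0)" using poly_less_coord.hyps poly_less_0 by blast
    then show ?thesis by (simp add: poly_less_zero)
  next
    case (Suc m)
    then show ?thesis using poly_less.poly_less_coord[OF poly_less_coord.IH, of j] by simp
  qed
  moreover have "poly_less n (\<lambda>\<theta>. s j * p (\<lambda>j. \<theta> j + s j))"
    by (intro poly_less_scale poly_less_shift poly_less_coord.hyps)
  ultimately show ?case unfolding eq by (simp add: poly_less_add)
qed (auto intro: poly_less.intros)

definition poly_fun :: "(('n \<Rightarrow> complex) \<Rightarrow> complex) \<Rightarrow> bool"
  where "poly_fun p \<longleftrightarrow> (\<exists>n. poly_less n p)"

lemma poly_fun_const: "poly_fun (\<lambda>_. c)"
  unfolding poly_fun_def by (blast intro: poly_less_const)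

lemma poly_fun_add: "poly_fun p \<Longrightarrow> poly_fun q \<Longrightarrow> poly_fun (\<lambda>\<theta>. p \<theta> + q \<theta>)"
  unfolding poly_fun_def by (metis poly_less_add poly_less_mono nat_le_linear)

lemma poly_fun_coord_mult: "poly_fun p \<Longrightarrow> poly_fun (\<lambda>\<theta>. \<theta> j * p \<theta>)"
  unfolding poly_fun_def by (blast intro: poly_less_coord)

lemma poly_fun_induct [consumes 1, case_names const add coord]:
  assumes "poly_fun p" and "\<And>c. P (\<lambda>_. c)"
    and add: "\<And>p q. poly_fun p \<Longrightarrow> poly_fun q \<Longrightarrow> P p \<Longrightarrow> P q \<Longrightarrow> P (\<lambda>\<theta>. p \<theta> + q \<theta>)"
    and coord: "\<And>p j. poly_fun p \<Longrightarrow> P p \<Longrightarrow> P (\<lambda>\<theta>. \<theta> j * p \<theta>)"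
  shows "P p"
proof -
  have "poly_less n p \<Longrightarrow> P p" for n
  proof (induction rule: poly_less.induct)
    case (poly_less_add n p q)
    then show ?case using add poly_fun_def by blast
  next
    case (poly_less_coord n p j)
    then show ?case using coord poly_fun_def by blast
  qed (use assms(2) in auto)
  then show ?thesis using assms(1) by (auto simp: poly_fun_def)
qed

lemma poly_fun_coord: "poly_fun (\<lambda>\<theta>. \<theta> j)"
  using poly_fun_coord_mult[OF poly_fun_const[of 1]] by simp

lemma poly_fun_scale: "poly_fun p \<Longrightarrow> poly_fun (\<lambda>\<theta>. c * p \<theta>)"
  unfolding poly_fun_def by (blast intro: poly_less_scale)

lemma poly_fun_diff: "poly_fun p \<Longrightarrow> poly_fun q \<Longrightarrow> poly_fun (\<lambda>\<theta>. p \<theta> - q \<theta>)"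
  using poly_fun_add[of p "\<lambda>\<theta>. (- 1) * q \<theta>"] poly_fun_scale[of q "- 1"] by simp

lemma poly_fun_mult: "poly_fun p \<Longrightarrow> poly_fun q \<Longrightarrow> poly_fun (\<lambda>\<theta>. p \<theta> * q \<theta>)"
proof (induction rule: poly_fun_induct)
  case (add p p')
  then show ?case using poly_fun_add[of "\<lambda>\<theta>. p \<theta> * q \<theta>" "\<lambda>\<theta>. p' \<theta> * q \<theta>"] by (simp add: distrib_right)
next
  case (coord p j)
  then show ?case using poly_fun_coord_mult[of "\<lambda>\<theta>. p \<theta> * q \<theta>" j] by (simp add: mult.assoc)
qed (rule poly_fun_scale)

lemma poly_fun_sum: "(\<And>s. s \<in> S \<Longrightarrow> poly_fun (p s)) \<Longrightarrow> poly_fun (\<lambda>\<theta>. \<Sum>s\<in>S. p s \<theta>)"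
  by (induction S rule: infinite_finite_induct) (auto intro: poly_fun_const poly_fun_add)

lemma poly_fun_prod: "(\<And>s. s \<in> S \<Longrightarrow> poly_fun (p s)) \<Longrightarrow> poly_fun (\<lambda>\<theta>. \<Prod>s\<in>S. p s \<theta>)"
  by (induction S rule: infinite_finite_induct) (auto intro: poly_fun_const poly_fun_mult)

lemma poly_fun_compose:
  assumes "poly_fun p" and g: "\<And>j. poly_fun (\<lambda>\<theta>. g \<theta> j)"
  shows "poly_fun (\<lambda>\<theta>. p (g \<theta>))"
  using assms(1)
proof (induction rule: poly_fun_induct)
  case (const c)
  show ?case by (rule poly_fun_const)
next
  case (add p q)
  show ?case using add.IH by (rule poly_fun_add)
next
  case (coord p j)
  show ?case using g coord.IH by (rule poly_fun_mult)
qed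

lemma poly_fun_shift: "poly_fun p \<Longrightarrow> poly_fun (\<lambda>\<theta>. p (\<lambda>j. \<theta> j + s j))"
  by (rule poly_fun_compose) (auto intro: poly_fun_add poly_fun_coord poly_fun_const)

lemma poly_fun_on_line:
  assumes "poly_fun p"
  shows "\<exists>q. \<forall>z. p (\<lambda>j. x j + z * y j) = poly q z"
  using assms
proof (induction rule: poly_fun_induct)
  case (const c)
  show ?case by (rule exI[of _ "[:c:]"]) simp
next
  case (add p p')
  then obtain q q' where "\<forall>z. p (\<lambda>j. x j + z * y j) = poly q z" "\<forall>z. p' (\<lambda>j. x j + z * y j) = poly q' z"
    by blast
  then show ?case by (intro exI[of _ "q + q'"]) simp
next
  case (coord p j)
  then obtain q where "\<forall>z. p (\<lambda>j. x j + z * y j) = poly q z" by blast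
  then show ?case by (intro exI[of _ "[:x j, y j:] * q"]) (simp add: algebra_simps)
qed

subsection \<open>Substituting the operators \<open>v\<^sub>j \<partial>\<^sub>j\<close>\<close>

text \<open>
  \<open>Theta p\<close> is \<open>p(\<theta>\<^sub>1, \<dots>, \<theta>\<^sub>N)\<close>. The \<open>\<theta>\<^sub>j\<close> commute, so this is a ring homomorphism from polynomial
  functions to operators (\<open>Theta_add\<close>, \<open>Theta_mult\<close>).
\<close>

definition Theta :: "(('n::{finite,linorder} \<Rightarrow> complex) \<Rightarrow> complex) \<Rightarrow> 'n ratop"
  where "Theta p = (THE X. newton_rep p X)"

lemma Theta_eqI: "newton_rep p X \<Longrightarrow> Theta p = X"
  unfolding Theta_def by (rule the_equality) (auto intro: newton_rep_unique)

lemma newton_rep_Theta: "poly_fun p \<Longrightarrow> newton_rep p (Theta p)"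
proof -
  have "poly_fun p \<Longrightarrow> \<exists>X. newton_rep p X"
    by (induction rule: poly_fun_induct) (blast intro: newton_rep_const newton_rep_add newton_rep_coord)+
  then show "poly_fun p \<Longrightarrow> newton_rep p (Theta p)" using Theta_eqI by metis
qed

lemma Theta_in_dops: "poly_fun p \<Longrightarrow> Theta p \<in> dops"
  by (drule newton_rep_Theta, erule newton_repE) (auto intro!: dops_sum dops_smult dops_dpow)

lemma Theta_falling: "Theta (falling k) f = vmon k * dpow k f"
  by (simp add: Theta_eqI[OF newton_rep_falling])

lemma Theta_const: "Theta (\<lambda>_. c) f = scalar c * f"
  by (simp add: Theta_eqI[OF newton_rep_const])

lemma Theta_add: "poly_fun p \<Longrightarrow> poly_fun q \<Longrightarrow> Theta (\<lambda>\<theta>. p \<theta> + q \<theta>) f = Theta p f + Theta q f"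
  by (simp add: Theta_eqI[OF newton_rep_add[OF newton_rep_Theta newton_rep_Theta]])

lemma Theta_scale: "poly_fun p \<Longrightarrow> Theta (\<lambda>\<theta>. c * p \<theta>) f = scalar c * Theta p f"
  by (simp add: Theta_eqI[OF newton_rep_scale[OF newton_rep_Theta]])

lemma Theta_coord: "poly_fun p \<Longrightarrow> Theta (\<lambda>\<theta>. \<theta> j * p \<theta>) f = var j * pd j (Theta p f)"
  by (simp add: Theta_eqI[OF newton_rep_coord[OF newton_rep_Theta]])

lemma Theta_diff: "poly_fun p \<Longrightarrow> poly_fun q \<Longrightarrow> Theta (\<lambda>\<theta>. p \<theta> - q \<theta>) f = Theta p f - Theta q f"
  using Theta_add[of p "\<lambda>\<theta>. (- 1) * q \<theta>" f] Theta_scale[of q "- 1" f] poly_fun_scale[of q "- 1"]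
  by (simp add: scalar_minus)

lemma Theta_sum:
  "(\<And>s. s \<in> S \<Longrightarrow> poly_fun (p s)) \<Longrightarrow> Theta (\<lambda>\<theta>. \<Sum>s\<in>S. p s \<theta>) f = (\<Sum>s\<in>S. Theta (p s) f)"
  by (induction S rule: infinite_finite_induct) (auto simp: Theta_const Theta_add poly_fun_sum)

lemma Theta_mult: "poly_fun p \<Longrightarrow> poly_fun q \<Longrightarrow> Theta (\<lambda>\<theta>. p \<theta> * q \<theta>) f = Theta p (Theta q f)"
proof (induction arbitrary: f rule: poly_fun_induct)
  case (const c)
  then show ?case by (simp add: Theta_const Theta_scale)
next
  case (add p p')
  then show ?case by (simp add: distrib_right Theta_add poly_fun_mult)
next
  case (coord p j)
  then show ?case by (simp add: mult.assoc Theta_coord poly_fun_mult)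
qed

lemma pd_Theta:
  "poly_fun p \<Longrightarrow> pd i (Theta p f) = Theta (\<lambda>\<theta>. p (\<lambda>j. \<theta> j + (if j = i then 1 else 0))) (pd i f)"
proof (induction rule: poly_fun_induct)
  case (const c)
  show ?case by (simp add: Theta_const pd_scalar_mult)
next
  case (add p q)
  then show ?case
    using poly_fun_shift[OF add.hyps(1), of "\<lambda>j. if j = i then 1 else 0"]
      poly_fun_shift[OF add.hyps(2), of "\<lambda>j. if j = i then 1 else 0"]
    by (simp add: Theta_add pd_add)
next
  case (coord p j)
  define p' where "p' = (\<lambda>\<theta>. p (\<lambda>j. \<theta> j + (if j = i then 1 else 0)))"
  have p': "poly_fun p'" unfolding p'_def by (rule poly_fun_shift[OF coord.hyps])
  have "pd i (Theta (\<lambda>\<theta>. \<theta> j * p \<theta>) f) =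
      (if i = j then 1 else 0) * pd j (Theta p f) + var j * pd j (pd i (Theta p f))"
    by (simp add: Theta_coord coord.hyps pd_mult pd_var pd_commute[of i j])
  also have "\<dots> = (if j = i then Theta p' (pd i f) else 0) + var j * pd j (Theta p' (pd i f))"
    using coord.IH by (auto simp: p'_def)
  also have "\<dots> = Theta (\<lambda>\<theta>. (if j = i then 1 else 0) * p' \<theta> + \<theta> j * p' \<theta>) (pd i f)"
    using p' by (simp add: Theta_add Theta_scale Theta_coord Theta_const poly_fun_scale poly_fun_coord_mult poly_fun_const)
  also have "(\<lambda>\<theta>. (if j = i then 1 else 0) * p' \<theta> + \<theta> j * p' \<theta>) =
      (\<lambda>\<theta>. (\<theta> j + (if j = i then 1 else 0)) * p' \<theta>)" by (simp add: algebra_simps)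
  finally show ?case by (simp add: p'_def)
qed

text \<open>
  Because of this commutation rule a box operator acts on the polynomials \<open>p\<close> as a difference operator.
\<close>

lemma dpow_Theta:
  assumes "poly_fun p"
  shows "dpow w (Theta p f) = Theta (\<lambda>\<theta>. p (\<lambda>j. \<theta> j + of_nat (w j))) (dpow w f)"
proof (induction w rule: multiindex_induct)
  case zero
  show ?case by (simp add: dpow_0)
next
  case (step w i)
  have "dpow (w(i := Suc (w i))) (Theta p f) =
      pd i (Theta (\<lambda>\<theta>. p (\<lambda>j. \<theta> j + of_nat (w j))) (dpow w f))"
    using step by (simp only: flip: pd_dpow)
  also have "\<dots> = Theta (\<lambda>\<theta>. p (\<lambda>j. \<theta> j + (if j = i then 1 else 0) + of_nat (w j))) (dpow (w(i := Suc (w i))) f)"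
    by (simp only: pd_Theta[OF poly_fun_shift[OF assms]] pd_dpow)
  also have "(\<lambda>\<theta> j. \<theta> j + (if j = i then 1 else 0) + of_nat (w j)) =
      (\<lambda>(\<theta> :: 'a \<Rightarrow> complex) j. \<theta> j + of_nat ((w(i := Suc (w i))) j))"
    by (auto simp: fun_eq_iff)
  then have "(\<lambda>\<theta>. p (\<lambda>j. \<theta> j + (if j = i then 1 else 0) + of_nat (w j))) =
      (\<lambda>\<theta>. p (\<lambda>j. \<theta> j + of_nat ((w(i := Suc (w i))) j)))" by (metis (no_types))
  finally show ?case .
qed

section \<open>Euler operators\<close>

definition cvec :: "int ^ 'r \<Rightarrow> complex ^ 'r"
  where "cvec k = (\<chi> i. of_int (k $ i))"

text \<open>
  The linear map \<open>A\<close> over \<open>\<complex>\<close>; its \<open>i\<close>-th component at \<open>\<theta>\<close> is the Euler operator \<open>Z\<^sub>i\<close>.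
\<close>

definition cwt :: "('n::finite \<Rightarrow> int ^ 'r) \<Rightarrow> ('n \<Rightarrow> complex) \<Rightarrow> complex ^ 'r"
  where "cwt a \<theta> = (\<chi> i. \<Sum>j\<in>UNIV. of_int (a j $ i) * \<theta> j)"

lemma cvec_add: "cvec (k + l) = cvec k + cvec l"
  by (simp add: cvec_def vec_eq_iff)

lemma cwt_add: "cwt a (\<lambda>j. \<theta> j + s j) = cwt a \<theta> + cwt a s"
  by (simp add: cwt_def vec_eq_iff distrib_left sum.distrib)

lemma cwt_diff: "cwt a (\<lambda>j. \<theta> j - s j) = cwt a \<theta> - cwt a s"
  by (simp add: cwt_def vec_eq_iff right_diff_distrib sum_subtractf)

lemma cwt_scale: "cwt a (\<lambda>j. c * \<theta> j) = c *s cwt a \<theta>"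
  by (simp add: cwt_def vec_eq_iff sum_distrib_left algebra_simps)

lemma cwt_of_int: "cwt a (\<lambda>j. of_int (l j)) = cvec (\<Sum>j\<in>UNIV. l j *s a j)"
  by (simp add: cwt_def cvec_def vec_eq_iff mult.commute)

lemma cwt_of_nat: "cwt a (\<lambda>j. of_nat (m j)) = cvec (wt a m)"
  using cwt_of_int[of a "\<lambda>j. int (m j)"] by (simp add: wt_def)

lemma poly_fun_cwt_nth: "poly_fun (\<lambda>\<theta>. cwt a \<theta> $ i)"
  by (simp add: cwt_def poly_fun_sum poly_fun_scale poly_fun_coord)

lemma Theta_cwt_nth: "Theta (\<lambda>\<theta>. cwt a \<theta> $ i) f = euler_op a i f"
proof -
  have 1: "Theta (\<lambda>\<theta>. \<theta> j) f = var j * pd j f" for j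
    using Theta_coord[OF poly_fun_const[of 1], of j f] by (simp add: Theta_const)
  have "Theta (\<lambda>\<theta>. cwt a \<theta> $ i) f = (\<Sum>j\<in>UNIV. scalar (of_int (a j $ i)) * Theta (\<lambda>\<theta>. \<theta> j) f)"
    by (simp add: cwt_def Theta_sum Theta_scale poly_fun_scale poly_fun_coord)
  then show ?thesis by (simp add: 1 euler_op_def scalar_of_int mult.assoc)
qed

lemma Theta_euler: "Theta (\<lambda>\<theta>. cwt a \<theta> $ i - c) f = euler_op a i f - scalar c * f"
  by (simp add: Theta_diff poly_fun_cwt_nth poly_fun_const Theta_cwt_nth Theta_const)

lemma shifted_euler_in_hg_ideal:
  "(\<lambda>f. Theta (\<lambda>\<theta>. cwt a \<theta> $ i - (\<alpha> - cvec (wt a u)) $ i) (dpow u f)) \<in> hg_ideal a \<alpha>"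
proof -
  have "(\<lambda>f. dpow u (Theta (\<lambda>\<theta>. cwt a \<theta> $ i - \<alpha> $ i) f)) \<in> hg_ideal a \<alpha>"
    unfolding Theta_euler by (intro lideal_comp[OF lideal_hg_ideal dops_dpow] euler_in_hg_ideal)
  moreover have "dpow u (Theta (\<lambda>\<theta>. cwt a \<theta> $ i - \<alpha> $ i) f) =
      Theta (\<lambda>\<theta>. cwt a \<theta> $ i - (\<alpha> - cvec (wt a u)) $ i) (dpow u f)" for f
  proof -
    have p: "poly_fun (\<lambda>\<theta>. cwt a \<theta> $ i - \<alpha> $ i)" by (intro poly_fun_diff poly_fun_cwt_nth poly_fun_const)
    have "(\<lambda>\<theta>. cwt a (\<lambda>j. \<theta> j + of_nat (u j)) $ i - \<alpha> $ i) =
        (\<lambda>\<theta>. cwt a \<theta> $ i - (\<alpha> - cvec (wt a u)) $ i)"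
      by (simp add: cwt_add cwt_of_nat algebra_simps)
    then show ?thesis by (simp only: dpow_Theta[OF p])
  qed
  ultimately show ?thesis by simp
qed

lemma lattice_section:
  fixes a :: "'n::finite \<Rightarrow> int ^ 'r"
  assumes "range (\<lambda>c. \<Sum>j\<in>UNIV. c j *s a j) = UNIV"
  obtains s :: "'r \<Rightarrow> 'n \<Rightarrow> int" where "\<forall>i. (\<Sum>j\<in>UNIV. s i j *s a j) = axis i 1"
proof -
  have "\<forall>i. \<exists>c. (\<Sum>j\<in>UNIV. c j *s a j) = axis i 1"
  proof
    fix i :: 'r
    have "(axis i 1 :: int ^ 'r) \<in> range (\<lambda>c. \<Sum>j\<in>UNIV. c j *s a j)" unfolding assms by (rule UNIV_I)
    then obtain c where "(axis i 1 :: int ^ 'r) = (\<Sum>j\<in>UNIV. c j *s a j)" by (rule rangeE)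
    then show "\<exists>c. (\<Sum>j\<in>UNIV. c j *s a j) = axis i 1" by (intro exI[of _ c]) (rule sym)
  qed
  then obtain s where "\<forall>i. (\<Sum>j\<in>UNIV. s i j *s a j) = axis i 1" by (rule choice[THEN exE])
  then show thesis by (rule that)
qed

text \<open>
  A polynomial that vanishes on an affine subspace lies in the ideal of its linear equations.
  Here the equations are \<open>A \<theta> = c\<close> with \<open>c = \<alpha> - A u\<close>. An integral right inverse \<open>s\<close> of \<open>A\<close> gives the
  affine projection \<open>\<pi>(\<theta>) = \<theta> - s (A \<theta> - c)\<close> onto the subspace, and \<open>p \<circ> \<pi> = 0\<close>.
\<close>

lemma Theta_in_hg_ideal:
  fixes a :: "'n::{finite,linorder} \<Rightarrow> int ^ 'r"
  assumes gen: "range (\<lambda>c. \<Sum>j\<in>UNIV. c j *s a j) = UNIV"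
    and p: "poly_fun p" and vanish: "\<And>\<theta>. cwt a \<theta> + cvec (wt a u) = \<alpha> \<Longrightarrow> p \<theta> = 0"
  shows "(\<lambda>f. Theta p (dpow u f)) \<in> hg_ideal a \<alpha>"
proof -
  obtain s where s0: "\<forall>i. (\<Sum>j\<in>UNIV. s i j *s a j) = axis i 1" by (rule lattice_section[OF gen])
  note s = spec[OF s0]
  let ?H = "hg_ideal a \<alpha>"
  define c where "c = \<alpha> - cvec (wt a u)"
  define L where "L i \<theta> = cwt a \<theta> $ i - c $ i" for i \<theta>
  define \<pi> where "\<pi> \<theta> j = \<theta> j - (\<Sum>i\<in>UNIV. of_int (s i j) * L i \<theta>)" for \<theta> j
  have L: "poly_fun (L i)" for i
    unfolding L_def by (intro poly_fun_diff poly_fun_cwt_nth poly_fun_const)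
  have \<pi>: "poly_fun (\<lambda>\<theta>. \<pi> \<theta> j)" for j
    unfolding \<pi>_def by (intro poly_fun_diff poly_fun_coord poly_fun_sum poly_fun_scale L)
  have L_mult: "(\<lambda>f. Theta (\<lambda>\<theta>. q \<theta> * L i \<theta>) (dpow u f)) \<in> ?H" if q: "poly_fun q" for q i
  proof -
    have "(\<lambda>f. Theta (L i) (dpow u f)) \<in> ?H"
      using shifted_euler_in_hg_ideal[of a i \<alpha> u] by (simp add: L_def[abs_def] c_def)
    then have "(\<lambda>f. Theta q (Theta (L i) (dpow u f))) \<in> ?H"
      by (rule lideal_comp[OF lideal_hg_ideal Theta_in_dops[OF q]])
    then show ?thesis by (simp add: Theta_mult q L)
  qed
  have "cwt a (\<pi> \<theta>) = c" for \<theta>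
  proof -
    have si: "(\<Sum>j\<in>UNIV. of_int (a j $ k) * of_int (s i j)) = (if k = i then 1 else 0 :: complex)" for i k
    proof -
      have "(\<Sum>j\<in>UNIV. s i j * a j $ k) = (if k = i then 1 else 0)"
        using arg_cong[OF s[of i], of "\<lambda>x. x $ k"] by (simp add: axis_def)
      from arg_cong[OF this, of "of_int :: int \<Rightarrow> complex"] show ?thesis by (simp add: mult.commute)
    qed
    have "cwt a (\<lambda>j. \<Sum>i\<in>UNIV. of_int (s i j) * L i \<theta>) $ k = L k \<theta>" for k
    proof -
      have "cwt a (\<lambda>j. \<Sum>i\<in>UNIV. of_int (s i j) * L i \<theta>) $ k =
          (\<Sum>j\<in>UNIV. \<Sum>i\<in>UNIV. of_int (a j $ k) * (of_int (s i j) * L i \<theta>))"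
        by (simp add: cwt_def sum_distrib_left)
      also have "\<dots> = (\<Sum>i\<in>UNIV. \<Sum>j\<in>UNIV. of_int (a j $ k) * (of_int (s i j) * L i \<theta>))"
        by (rule sum.swap)
      also have "\<dots> = (\<Sum>i\<in>UNIV. (\<Sum>j\<in>UNIV. of_int (a j $ k) * of_int (s i j)) * L i \<theta>)"
        by (simp add: sum_distrib_right mult.assoc)
      finally show ?thesis by (simp add: si if_distrib[of "\<lambda>x. x * _"] cong: if_cong)
    qed
    then show ?thesis by (simp add: \<pi>_def[abs_def] cwt_diff vec_eq_iff L_def)
  qed
  then have zero: "p (\<pi> \<theta>) = 0" for \<theta> by (simp add: vanish c_def)
  \<comment> \<open>Modulo the Euler operators, every polynomial agrees with its pullback along \<open>\<pi>\<close>.\<close>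
  have "(\<lambda>f. Theta (\<lambda>\<theta>. p \<theta> - p (\<pi> \<theta>)) (dpow u f)) \<in> ?H"
    using p
  proof (induction rule: poly_fun_induct)
    case (const b)
    show ?case using lideal_zero[OF lideal_hg_ideal] by (simp add: Theta_const)
  next
    case (add p q)
    have 1: "poly_fun (\<lambda>\<theta>. p \<theta> - p (\<pi> \<theta>))" "poly_fun (\<lambda>\<theta>. q \<theta> - q (\<pi> \<theta>))"
      by (intro poly_fun_diff poly_fun_compose[OF _ \<pi>] add.hyps)+
    have 2: "(\<lambda>\<theta>. p \<theta> + q \<theta> - (p (\<pi> \<theta>) + q (\<pi> \<theta>))) = (\<lambda>\<theta>. (p \<theta> - p (\<pi> \<theta>)) + (q \<theta> - q (\<pi> \<theta>)))"
      by (simp add: algebra_simps)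
    show ?case unfolding 2 Theta_add[OF 1] by (rule lideal_add[OF lideal_hg_ideal add.IH])
  next
    case (coord p j)
    define q where "q \<theta> = \<theta> j * (p \<theta> - p (\<pi> \<theta>))" for \<theta>
    define r where "r i \<theta> = (of_int (s i j) * p (\<pi> \<theta>)) * L i \<theta>" for i \<theta>
    have p\<pi>: "poly_fun (\<lambda>\<theta>. p (\<pi> \<theta>))" by (rule poly_fun_compose[OF coord.hyps \<pi>])
    have pq: "poly_fun q" unfolding q_def by (intro poly_fun_coord_mult poly_fun_diff p\<pi> coord.hyps)
    have pr: "poly_fun (r i)" for i unfolding r_def by (intro poly_fun_mult poly_fun_const p\<pi> L)
    have "\<theta> j * p \<theta> - \<pi> \<theta> j * p (\<pi> \<theta>) = q \<theta> + (\<Sum>i\<in>UNIV. r i \<theta>)" for \<theta>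
    proof -
      define y where "y = p (\<pi> \<theta>)"
      define t where "t = (\<Sum>i\<in>UNIV. of_int (s i j) * L i \<theta>)"
      have sum: "(\<Sum>i\<in>UNIV. r i \<theta>) = t * y"
        unfolding r_def t_def y_def[symmetric] sum_distrib_right by (simp only: mult.assoc mult.commute[of y])
      have \<pi>j: "\<pi> \<theta> j = \<theta> j - t" by (simp only: \<pi>_def t_def)
      show ?thesis unfolding q_def y_def[symmetric] sum \<pi>j by (simp add: algebra_simps)
    qed
    then have eq: "(\<lambda>\<theta>. \<theta> j * p \<theta> - \<pi> \<theta> j * p (\<pi> \<theta>)) = (\<lambda>\<theta>. q \<theta> + (\<Sum>i\<in>UNIV. r i \<theta>))"
      by (rule ext)
    have "(\<lambda>f. var j * pd j (Theta (\<lambda>\<theta>. p \<theta> - p (\<pi> \<theta>)) (dpow u f))) \<in> ?H"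
      by (intro lideal_smult lideal_comp[OF lideal_hg_ideal dops_pd] lideal_hg_ideal coord.IH)
    then have "(\<lambda>f. Theta q (dpow u f)) \<in> ?H"
      unfolding q_def by (simp add: Theta_coord poly_fun_diff p\<pi> coord.hyps)
    moreover have "(\<lambda>f. Theta (r i) (dpow u f)) \<in> ?H" for i
      unfolding r_def by (intro L_mult poly_fun_scale p\<pi>)
    ultimately have "(\<lambda>f. Theta q (dpow u f) + (\<Sum>i\<in>UNIV. Theta (r i) (dpow u f))) \<in> ?H"
      by (intro lideal_add lideal_sum lideal_hg_ideal)
    then show ?case unfolding eq by (simp add: Theta_add Theta_sum pq pr poly_fun_sum)
  qed
  then show ?thesis by (simp add: zero)
qed

section \<open>Contiguity\<close>

lemma scalar_eq_0_iff: "(scalar c :: 'n::linorder ratfun) = 0 \<longleftrightarrow> c = 0"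
proof -
  have ne: "(1 :: 'n mpol) \<noteq> 0" by (rule one_neq_zero)
  have "Poly_Mapping.single (0 :: 'n \<Rightarrow>\<^sub>0 nat) c = 0 \<longleftrightarrow> c = 0"
  proof
    assume "Poly_Mapping.single (0 :: 'n \<Rightarrow>\<^sub>0 nat) c = 0"
    then have "Poly_Mapping.lookup (Poly_Mapping.single (0 :: 'n \<Rightarrow>\<^sub>0 nat) c) 0 = 0"
      by (simp only: lookup_zero)
    then show "c = 0" by (simp only: lookup_single_eq)
  qed (simp only: single_zero)
  then show ?thesis
    unfolding scalar_def Zero_fract_def eq_fract(1)[OF ne ne] mult_1_right .
qed

text \<open>
  The polynomials in the Euler operators alone: they commute with homogeneous operators up to a
  translation of the argument.
\<close>

definition weight_poly :: "('n::finite \<Rightarrow> int ^ 'r) \<Rightarrow> (complex ^ 'r \<Rightarrow> complex) \<Rightarrow> bool"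
  where "weight_poly a B \<longleftrightarrow> poly_fun (\<lambda>\<theta>. B (cwt a \<theta>))"

definition Theta_wt :: "('n::{finite,linorder} \<Rightarrow> int ^ 'r) \<Rightarrow> (complex ^ 'r \<Rightarrow> complex) \<Rightarrow> 'n ratop"
  where "Theta_wt a B = Theta (\<lambda>\<theta>. B (cwt a \<theta>))"

lemma Theta_wt_in_dops: "weight_poly a B \<Longrightarrow> Theta_wt a B \<in> dops"
  by (simp add: weight_poly_def Theta_wt_def Theta_in_dops)

lemma weight_poly_shift:
  assumes "weight_poly a B"
  shows "weight_poly a (\<lambda>x. B (x + cvec (wt a w)))"
  using poly_fun_shift[OF assms[unfolded weight_poly_def], of "\<lambda>j. of_nat (w j)"]
  by (simp only: weight_poly_def cwt_add cwt_of_nat)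

lemma dpow_Theta_wt:
  assumes "weight_poly a B"
  shows "dpow w (Theta_wt a B f) = Theta_wt a (\<lambda>x. B (x + cvec (wt a w))) (dpow w f)"
  using dpow_Theta[OF assms[unfolded weight_poly_def], of w f]
  by (simp only: Theta_wt_def cwt_add cwt_of_nat)

lemma Theta_wt_commute:
  assumes "weight_poly a B" "weight_poly a C"
  shows "Theta_wt a B (Theta_wt a C f) = Theta_wt a C (Theta_wt a B f)"
  unfolding Theta_wt_def Theta_mult[OF assms[unfolded weight_poly_def], symmetric]
    Theta_mult[OF assms(2,1)[unfolded weight_poly_def], symmetric] by (simp only: mult.commute)

text \<open>
  \<open>(\<partial>\<^sup>m - \<partial>\<^sup>k) B(A\<theta>) = B(A\<theta> + A m) (\<partial>\<^sup>m - \<partial>\<^sup>k)\<close> when \<open>A m = A k\<close>.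
\<close>

lemma toric_ideal_Theta_wt_right:
  assumes X: "X \<in> toric_ideal a" and B: "weight_poly a B"
  shows "(\<lambda>f. X (Theta_wt a B f)) \<in> toric_ideal a"
proof -
  from X obtain S c r where S: "finite S" and r: "\<forall>m\<in>S. wt a (r m) = wt a m"
    and Xeq: "X = (\<lambda>f. \<Sum>m\<in>S. c m * (dpow m f - dpow (r m) f))"
    by (rule toric_idealE)
  define T where "T m = Theta_wt a (\<lambda>x. B (x + cvec (wt a m)))" for m
  have T: "T m \<in> dops" for m
    unfolding T_def by (rule Theta_wt_in_dops[OF weight_poly_shift[OF B]])
  have "dpow m (Theta_wt a B f) - dpow (r m) (Theta_wt a B f) = T m (dpow m f - dpow (r m) f)"
    if "m \<in> S" for m f
    using r that by (simp add: dpow_Theta_wt[OF B] T_def[symmetric] dops_diff_arg[OF T])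
  then have "(\<lambda>f. X (Theta_wt a B f)) = (\<lambda>f. \<Sum>m\<in>S. c m * T m (dpow m f - dpow (r m) f))"
    by (simp add: Xeq)
  also have "\<dots> \<in> toric_ideal a"
    using r by (intro lideal_sum lideal_smult lideal_toric_ideal
        lideal_comp[OF lideal_toric_ideal T] dpow_diff_in_toric_ideal) auto
  finally show ?thesis .
qed

text \<open>
  The exponents \<open>k\<close> with \<open>A k \<in> A w + A \<nat>\<^sup>N\<close> form an upward closed set. If \<open>b\<close> vanishes outside it, its
  Newton expansion only involves \<open>v\<^sup>k \<partial>\<^sup>k\<close> with such \<open>k\<close>, and each of these \<open>\<partial>\<^sup>k\<close> has a right factor
  \<open>\<partial>\<^sup>w\<close> modulo the toric ideal.
\<close>

lemma b_operator:
  fixes a :: "'n::{finite,linorder} \<Rightarrow> int ^ 'r"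
  assumes b: "poly_fun b"
    and vanish: "\<And>m. wt a m - wt a w \<notin> range (wt a) \<Longrightarrow> b (\<lambda>j. of_nat (m j)) = 0"
  obtains Q where "Q \<in> dops" "(\<lambda>f. Theta b f - Q (dpow w f)) \<in> toric_ideal a"
proof -
  from newton_rep_Theta[OF b] obtain S c where S: "finite S" and beq: "b = (\<lambda>\<theta>. \<Sum>k\<in>S. c k * falling k \<theta>)"
    and Th: "Theta b = (\<lambda>f. \<Sum>k\<in>S. scalar (c k) * (vmon k * dpow k f))" by (rule newton_repE)
  define U where "U = {k. wt a k - wt a w \<in> range (wt a)}"
  have up: "m \<in> U" if "k \<in> U" "k \<le> m" for k m
  proof -
    from that obtain n where n: "wt a k - wt a w = wt a n" by (auto simp: U_def)
    have "m = (\<lambda>j. k j + (m j - k j))" using that(2) by (auto simp: le_fun_def fun_eq_iff)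
    then have "wt a m = wt a k + wt a (\<lambda>j. m j - k j)" by (metis wt_add)
    then have "wt a m - wt a w = wt a (\<lambda>j. n j + (m j - k j))"
      using n by (simp add: wt_add algebra_simps)
    then show ?thesis by (simp add: U_def)
  qed
  have c0: "c k = 0" if "k \<in> S" "k \<notin> U" for k
  proof (rule newton_coeff_eq_0[OF S _ up that])
    fix m assume "m \<notin> U"
    then have "b (\<lambda>j. of_nat (m j)) = 0" using vanish[of m] by (simp add: U_def)
    then show "(\<Sum>k\<in>S. c k * falling k (\<lambda>j. of_nat (m j))) = 0" by (simp add: beq)
  qed
  define r where "r k = (SOME n. wt a k - wt a w = wt a n)" for k
  have r: "wt a k = wt a (\<lambda>j. r k j + w j)" if "k \<in> U" for k
  proof -
    from that have "\<exists>n. wt a k - wt a w = wt a n" by (auto simp: U_def)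
    then have "wt a k - wt a w = wt a (r k)" unfolding r_def by (rule someI_ex)
    then show ?thesis by (simp add: wt_add algebra_simps)
  qed
  define Q where "Q f = (\<Sum>k\<in>S. scalar (c k) * vmon k * dpow (r k) f)" for f
  have "Q \<in> dops" unfolding Q_def by (intro dops_sum dops_smult dops_dpow)
  moreover have "(\<lambda>f. Theta b f - Q (dpow w f)) =
      (\<lambda>f. \<Sum>k\<in>S. scalar (c k) * vmon k * (dpow k f - dpow (\<lambda>j. r k j + w j) f))"
    by (simp add: Th Q_def dpow_dpow sum_subtractf right_diff_distrib mult.assoc)
  moreover have "\<dots> \<in> toric_ideal a"
  proof (intro lideal_sum[OF lideal_toric_ideal])
    fix k assume k: "k \<in> S"
    show "(\<lambda>f. scalar (c k) * vmon k * (dpow k f - dpow (\<lambda>j. r k j + w j) f)) \<in> toric_ideal a"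
    proof (cases "k \<in> U")
      case True
      then show ?thesis by (intro lideal_smult[OF lideal_toric_ideal] dpow_diff_in_toric_ideal r)
    next
      case False
      then show ?thesis using c0[OF k] lideal_zero[OF lideal_toric_ideal] by simp
    qed
  qed
  ultimately show thesis using that by simp
qed

text \<open>
  All that is needed from non-resonance: for every \<open>w\<close> a polynomial in the weight which is a multiple
  of \<open>\<partial>\<^sup>w\<close> modulo the toric ideal (by \<open>b_operator\<close>) and has no zero on \<open>\<alpha> + \<int>\<^sup>r\<close>.
\<close>

definition has_b_functions :: "('n::finite \<Rightarrow> int ^ 'r) \<Rightarrow> complex ^ 'r \<Rightarrow> bool"
  where "has_b_functions a \<alpha> \<longleftrightarrow> (\<forall>w. \<exists>B. weight_poly a B \<and>
    (\<forall>m. wt a m - wt a w \<notin> range (wt a) \<longrightarrow> B (cvec (wt a m)) = 0) \<and> (\<forall>k. B (\<alpha> + cvec k) \<noteq> 0))"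

lemma has_b_functions_shift:
  assumes "has_b_functions a \<alpha>"
  shows "has_b_functions a (\<alpha> + cvec k)"
  unfolding has_b_functions_def
proof (intro allI)
  fix w
  from assms obtain B where B: "weight_poly a B"
    "\<forall>m. wt a m - wt a w \<notin> range (wt a) \<longrightarrow> B (cvec (wt a m)) = 0" "\<forall>k. B (\<alpha> + cvec k) \<noteq> 0"
    unfolding has_b_functions_def by blast
  have "\<forall>l. B (\<alpha> + cvec k + cvec l) \<noteq> 0"
    using B(3) by (simp only: add.assoc cvec_add[symmetric] simp_thms)
  with B(1,2) show "\<exists>B. weight_poly a B \<and>
      (\<forall>m. wt a m - wt a w \<notin> range (wt a) \<longrightarrow> B (cvec (wt a m)) = 0) \<and>
      (\<forall>l. B (\<alpha> + cvec k + cvec l) \<noteq> 0)" by (intro exI[of _ B] conjI)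
qed

lemma contiguity_operator:
  fixes a :: "'n::{finite,linorder} \<Rightarrow> int ^ 'r"
  assumes "has_b_functions a \<alpha>"
  shows "\<exists>B Q. weight_poly a B \<and> (\<forall>k. B (\<alpha> + cvec k) \<noteq> 0) \<and> Q \<in> dops \<and>
    (\<lambda>f. Theta_wt a B f - Q (dpow w f)) \<in> toric_ideal a"
proof -
  from assms obtain B where B: "weight_poly a B" "\<forall>k. B (\<alpha> + cvec k) \<noteq> 0"
    and vanish: "\<forall>m. wt a m - wt a w \<notin> range (wt a) \<longrightarrow> B (cvec (wt a m)) = 0"
    unfolding has_b_functions_def by blast
  have "B (cwt a (\<lambda>j. of_nat (m j))) = 0" if "wt a m - wt a w \<notin> range (wt a)" for m
    unfolding cwt_of_nat using vanish that by simp
  then obtain Q where Q: "Q \<in> dops" "(\<lambda>f. Theta (\<lambda>\<theta>. B (cwt a \<theta>)) f - Q (dpow w f)) \<in> toric_ideal a"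
    by (rule b_operator[OF B(1)[unfolded weight_poly_def]])
  have "(\<lambda>f. Theta_wt a B f - Q (dpow w f)) \<in> toric_ideal a"
    unfolding Theta_wt_def by (rule Q(2))
  with B Q(1) have "weight_poly a B \<and> (\<forall>k. B (\<alpha> + cvec k) \<noteq> 0) \<and> Q \<in> dops \<and>
      (\<lambda>f. Theta_wt a B f - Q (dpow w f)) \<in> toric_ideal a" by (intro conjI)
  then have "\<exists>Q. weight_poly a B \<and> (\<forall>k. B (\<alpha> + cvec k) \<noteq> 0) \<and> Q \<in> dops \<and>
      (\<lambda>f. Theta_wt a B f - Q (dpow w f)) \<in> toric_ideal a" by (rule exI[of _ Q])
  then show ?thesis by (rule exI[of _ B])
qed

lemma cvec_0: "cvec 0 = 0"
  by (simp add: cvec_def vec_eq_iff)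

lemma Theta_wt_mod_hg_ideal:
  fixes a :: "'n::{finite,linorder} \<Rightarrow> int ^ 'r"
  assumes gen: "range (\<lambda>c. \<Sum>j\<in>UNIV. c j *s a j) = UNIV" and B: "weight_poly a B"
  shows "(\<lambda>f. Theta_wt a B f - scalar (B \<alpha>) * f) \<in> hg_ideal a \<alpha>"
proof -
  note b = B[unfolded weight_poly_def]
  have p: "poly_fun (\<lambda>\<theta>. B (cwt a \<theta>) - B \<alpha>)" by (intro poly_fun_diff b poly_fun_const)
  have c0: "cvec (wt a (\<lambda>_. 0)) = 0" by (simp add: wt_0 cvec_def zero_vec_def)
  have "(\<lambda>f. Theta (\<lambda>\<theta>. B (cwt a \<theta>) - B \<alpha>) (dpow (\<lambda>_. 0) f)) \<in> hg_ideal a \<alpha>"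
    by (rule Theta_in_hg_ideal[OF gen p]) (simp add: c0)
  moreover have "Theta (\<lambda>\<theta>. B (cwt a \<theta>) - B \<alpha>) f = Theta_wt a B f - scalar (B \<alpha>) * f" for f
    unfolding Theta_wt_def by (rule trans[OF Theta_diff[OF b poly_fun_const]]) (simp only: Theta_const)
  ultimately show ?thesis by (simp only: dpow_0 id_apply)
qed

lemma unit_if_dpow_mem:
  fixes a :: "'n::{finite,linorder} \<Rightarrow> int ^ 'r"
  assumes gen: "range (\<lambda>c. \<Sum>j\<in>UNIV. c j *s a j) = UNIV" and bf: "has_b_functions a \<alpha>"
    and J: "lideal J" "hg_ideal a \<alpha> \<subseteq> J" and w: "dpow w \<in> J"
  shows "id \<in> J"
proof -
  obtain B Q where B: "weight_poly a B" "\<forall>k. B (\<alpha> + cvec k) \<noteq> 0" and Q: "Q \<in> dops"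
    and T: "(\<lambda>f. Theta_wt a B f - Q (dpow w f)) \<in> toric_ideal a"
    using contiguity_operator[OF bf, of w] by (elim exE conjE) (rule that)
  have "(\<lambda>f. Theta_wt a B f - Q (dpow w f)) \<in> J"
    using T toric_ideal_subset_hg_ideal J(2) by blast
  from lideal_add[OF J(1) this lideal_comp[OF J(1) Q w]]
  have 1: "(\<lambda>f. Theta_wt a B f) \<in> J" by simp
  have 2: "(\<lambda>f. Theta_wt a B f - scalar (B \<alpha>) * f) \<in> J"
    using Theta_wt_mod_hg_ideal[OF gen B(1), of \<alpha>] J(2) by blast
  have "(\<lambda>f. scalar (B \<alpha>) * id f) \<in> J"
    using lideal_diff[OF J(1) 1 2] by simp
  moreover have "scalar (B \<alpha>) \<noteq> (0 :: 'n ratfun)"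
    using spec[OF B(2), of 0] by (simp add: scalar_eq_0_iff cvec_0)
  ultimately show ?thesis by (rule lideal_unit_smult[OF J(1)])
qed

text \<open>
  Right multiplication by the contiguity operator \<open>Q\<close> maps \<open>H(\<alpha> + A w)\<close> into \<open>H(\<alpha>)\<close>. Indeed
  \<open>I Q \<subseteq> I\<close> for the toric ideal \<open>I\<close>, and \<open>(Z\<^sub>i - \<alpha>\<^sub>i - (A w)\<^sub>i) Q - Q (Z\<^sub>i - \<alpha>\<^sub>i) \<in> I\<close>: both hold after
  multiplication by \<open>\<partial>\<^sup>w\<close> from the right, where \<open>Q \<partial>\<^sup>w\<close> is \<open>B(A\<theta>)\<close> modulo \<open>I\<close>, and \<open>\<partial>\<^sup>w\<close> cancels
  modulo \<open>I\<close>. For the same reason \<open>\<partial>\<^sup>w Q\<close> is \<open>B(A\<theta> + A w)\<close> modulo \<open>I\<close>, and this acts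
  on the quotient by \<open>H(\<alpha>)\<close> as the nonzero number \<open>B(\<alpha> + A w)\<close>.
\<close>

lemma hg_ideal_dpow_right_cancel:
  fixes a :: "'n::{finite,linorder} \<Rightarrow> int ^ 'r"
  assumes gen: "range (\<lambda>c. \<Sum>j\<in>UNIV. c j *s a j) = UNIV" and bf: "has_b_functions a \<alpha>"
    and X: "X \<in> dops" and mem: "(\<lambda>f. X (dpow w f)) \<in> hg_ideal a (\<alpha> + cvec (wt a w))"
  shows "X \<in> hg_ideal a \<alpha>"
proof -
  let ?H = "hg_ideal a \<alpha>" and ?I = "toric_ideal a" and ?\<alpha>' = "\<alpha> + cvec (wt a w)"
  note I = lideal_toric_ideal[of a] and H = lideal_hg_ideal[of a \<alpha>]
  note IH = subsetD[OF toric_ideal_subset_hg_ideal[of a \<alpha>]]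
  obtain B Q where B: "weight_poly a B" "\<forall>k. B (\<alpha> + cvec k) \<noteq> 0" and Q: "Q \<in> dops"
    and T0: "(\<lambda>f. Theta_wt a B f - Q (dpow w f)) \<in> ?I"
    using contiguity_operator[OF bf, of w] by (elim exE conjE) (rule that)
  define T where "T f = Theta_wt a B f - Q (dpow w f)" for f
  define B' where "B' x = B (x + cvec (wt a w))" for x
  have B': "weight_poly a B'" unfolding B'_def by (rule weight_poly_shift[OF B(1)])
  have TI: "T \<in> ?I" using T0 by (simp add: T_def[abs_def])
  have Qw: "Q (dpow w f) = Theta_wt a B f - T f" for f by (simp add: T_def)
  have toric_Q: "(\<lambda>f. P (Q f)) \<in> ?I" if P: "P \<in> ?I" for P
  proof -
    have Pd: "P \<in> dops" using lideal_dops[OF I P] .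
    from lideal_diff[OF I toric_ideal_Theta_wt_right[OF P B(1)] lideal_comp[OF I Pd TI]]
    have "(\<lambda>f. P (Q (dpow w f))) \<in> ?I" by (simp add: Qw dops_diff_arg[OF Pd])
    then show ?thesis by (rule iffD1[OF toric_ideal_dpow_right_iff[OF dops_compose[OF Pd Q]]])
  qed
  have euler_Q: "(\<lambda>f. euler_op a i (Q f) - scalar (?\<alpha>' $ i) * Q f) \<in> ?H" for i
  proof -
    define C where "C x = x $ i - \<alpha> $ i" for x :: "complex ^ 'r"
    define C' where "C' x = x $ i - ?\<alpha>' $ i" for x :: "complex ^ 'r"
    have C: "weight_poly a C" and C': "weight_poly a C'"
      unfolding weight_poly_def C_def C'_def by (intro poly_fun_diff poly_fun_cwt_nth poly_fun_const)+
    note Cd = Theta_wt_in_dops[OF C] and Cd' = Theta_wt_in_dops[OF C']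
    have ZC: "Theta_wt a C f = euler_op a i f - scalar (\<alpha> $ i) * f"
      and ZC': "Theta_wt a C' f = euler_op a i f - scalar (?\<alpha>' $ i) * f" for f
      unfolding Theta_wt_def C_def C'_def by (rule Theta_euler)+
    have "(\<lambda>x. C' (x + cvec (wt a w))) = C" by (simp add: C_def[abs_def] C'_def)
    then have wZ: "Theta_wt a C (dpow w f) = dpow w (Theta_wt a C' f)" for f
      by (simp only: dpow_Theta_wt[OF C'])
    have "(\<lambda>f. T (Theta_wt a C' f)) \<in> ?I" by (rule toric_ideal_Theta_wt_right[OF TI C'])
    from lideal_diff[OF I this lideal_comp[OF I Cd' TI]]
    have i: "(\<lambda>f. Theta_wt a C' (Q (dpow w f)) - Q (Theta_wt a C (dpow w f))) \<in> ?I"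
      by (simp add: Qw wZ Theta_wt_commute[OF C' B(1)] dops_diff_arg[OF Cd'])
    have d: "(\<lambda>f. Theta_wt a C' (Q f) - Q (Theta_wt a C f)) \<in> dops"
      by (intro dops_diff dops_compose[OF Cd' Q] dops_compose[OF Q Cd])
    have 1: "(\<lambda>f. Theta_wt a C' (Q f) - Q (Theta_wt a C f)) \<in> ?H"
      by (rule IH[OF iffD1[OF toric_ideal_dpow_right_iff[OF d] i]])
    have "Theta_wt a C \<in> ?H" using euler_in_hg_ideal[of a i \<alpha>] by (simp only: ZC[symmetric])
    from lideal_add[OF H 1 lideal_comp[OF H Q this]] show ?thesis by (simp add: ZC')
  qed
  have "hg_ideal a ?\<alpha>' \<subseteq> {Y \<in> dops. (\<lambda>f. Y (Q f)) \<in> ?H}"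
  proof (rule hg_ideal_least)
    show "lideal {Y \<in> dops. (\<lambda>f. Y (Q f)) \<in> ?H}"
      unfolding lideal_def
      by (auto simp: dops_zero dops_add dops_compose lideal_zero[OF H] intro: lideal_add[OF H] lideal_comp[OF H])
    have "box_op l \<in> ?I" if "l \<in> rel_lattice a" for l
    proof -
      have "wt a (\<lambda>j. nat (l j)) - wt a (\<lambda>j. nat (- l j)) = (\<Sum>j\<in>UNIV. l j *s a j)"
        unfolding wt_def sum_subtractf[symmetric] vec.scale_left_diff_distrib[symmetric]
        by (intro sum.cong) (auto simp: vec_eq_iff)
      then show ?thesis using that dpow_diff_in_toric_ideal[of a "\<lambda>j. nat (l j)" "\<lambda>j. nat (- l j)"]
        by (simp add: rel_lattice_def box_op_def[abs_def])
    qed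
    then have "(\<lambda>f. box_op l (Q f)) \<in> ?H" if "l \<in> rel_lattice a" for l
      using that toric_Q IH by blast
    then show "hg_ops a ?\<alpha>' \<subseteq> {Y \<in> dops. (\<lambda>f. Y (Q f)) \<in> ?H}"
      using euler_Q hg_ops_subset[of a ?\<alpha>'] by (auto simp: hg_ops_def)
  qed
  then have 1: "(\<lambda>f. X (dpow w (Q f))) \<in> ?H" using mem by auto
  have i: "(\<lambda>f. dpow w (Q (dpow w f)) - Theta_wt a B' (dpow w f)) \<in> ?I"
  proof -
    have "(\<lambda>f. dpow w (Q (dpow w f)) - Theta_wt a B' (dpow w f)) = (\<lambda>f. 0 - dpow w (T f))"
      by (simp add: Qw dops_diff_arg[OF dops_dpow] dpow_Theta_wt[OF B(1)] B'_def[abs_def])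
    also have "\<dots> \<in> ?I" by (intro lideal_diff[OF I] lideal_zero[OF I] lideal_comp[OF I dops_dpow] TI)
    finally show ?thesis .
  qed
  have d: "(\<lambda>f. dpow w (Q f) - Theta_wt a B' f) \<in> dops"
    by (intro dops_diff dops_compose[OF dops_dpow Q] Theta_wt_in_dops[OF B'])
  have 2: "(\<lambda>f. dpow w (Q f) - Theta_wt a B' f) \<in> ?H"
    by (rule IH[OF iffD1[OF toric_ideal_dpow_right_iff[OF d] i]])
  have 3: "(\<lambda>f. Theta_wt a B' f - scalar (B' \<alpha>) * f) \<in> ?H"
    by (rule Theta_wt_mod_hg_ideal[OF gen B'])
  have "(\<lambda>f. X (dpow w (Q f)) - X (dpow w (Q f) - Theta_wt a B' f) - X (Theta_wt a B' f - scalar (B' \<alpha>) * f)) \<in> ?H"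
    by (intro lideal_diff[OF H lideal_diff[OF H]] 1 lideal_comp[OF H X 2] lideal_comp[OF H X 3])
  then have "(\<lambda>f. scalar (B' \<alpha>) * X f) \<in> ?H"
    by (simp add: dops_diff_arg[OF X] dops_scalar_arg[OF X])
  moreover have "scalar (B' \<alpha>) \<noteq> (0 :: 'n ratfun)" using B(2) by (simp add: scalar_eq_0_iff B'_def)
  ultimately show ?thesis by (rule lideal_unit_smult[OF H])
qed

section \<open>Descent on the degree of a polynomial\<close>

text \<open>
  On a line a polynomial function is a polynomial in one variable, and it takes one value at
  infinitely many points.
\<close>

lemma poly_fun_line_const:
  assumes p: "poly_fun p" and int: "\<And>n. p (\<lambda>j. y j + of_nat n * l j) = p y"
  shows "p (\<lambda>j. y j + z * l j) = p y"
proof -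
  obtain q where q: "\<forall>z. p (\<lambda>j. y j + z * l j) = poly q z" using poly_fun_on_line[OF p] by blast
  have "range (of_nat :: nat \<Rightarrow> complex) \<subseteq> {z. poly (q - [:p y:]) z = 0}"
    using int by (auto simp: q[rule_format, symmetric])
  moreover have "infinite (range (of_nat :: nat \<Rightarrow> complex))"
    by (rule range_inj_infinite) (rule inj_of_nat)
  ultimately have "q - [:p y:] = 0" using poly_roots_finite finite_subset by blast
  then show ?thesis using q by simp
qed

text \<open>
  The projection \<open>\<theta> - s (A \<theta>)\<close> onto the kernel of \<open>A\<close>, with \<open>s\<close> an integral right inverse of \<open>A\<close>, maps the
  unit vectors to lattice relations \<open>L k\<close>. These span the kernel over \<open>\<complex>\<close>, so two points of a fibre are
  joined by a chain of complex segments in relation directions.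
\<close>

lemma poly_fun_fibre_const:
  fixes a :: "'n::finite \<Rightarrow> int ^ 'r"
  assumes gen: "range (\<lambda>c. \<Sum>j\<in>UNIV. c j *s a j) = UNIV" and p: "poly_fun p"
    and inv: "\<And>\<theta> l. cwt a \<theta> = c \<Longrightarrow> l \<in> rel_lattice a \<Longrightarrow> p (\<lambda>j. \<theta> j + of_int (l j)) = p \<theta>"
    and \<theta>: "cwt a \<theta> = c" and \<theta>': "cwt a \<theta>' = c"
  shows "p \<theta>' = p \<theta>"
proof -
  have fib: "cwt a (\<lambda>j. y j + z * of_int (l j)) = c" if "cwt a y = c" "l \<in> rel_lattice a" for y z l
  proof -
    have "cwt a (\<lambda>j. z * of_int (l j)) = 0"
      using that(2) by (simp add: cwt_scale cwt_of_int rel_lattice_def cvec_0)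
    then show ?thesis using that(1) by (simp add: cwt_add)
  qed
  have line: "p (\<lambda>j. y j + z * of_int (l j)) = p y" if y: "cwt a y = c" and l: "l \<in> rel_lattice a" for y z l
  proof (rule poly_fun_line_const[OF p])
    fix n :: nat
    show "p (\<lambda>j. y j + of_nat n * of_int (l j)) = p y"
    proof (induction n)
      case (Suc n)
      have eq: "(\<lambda>j. y j + of_nat (Suc n) * of_int (l j)) = (\<lambda>j. (y j + of_nat n * of_int (l j)) + of_int (l j))"
        by (simp add: algebra_simps)
      show ?case unfolding eq using inv[OF fib[OF y l] l] Suc by simp
    qed simp
  qed
  obtain s where s: "\<forall>i. (\<Sum>j\<in>UNIV. s i j *s a j) = axis i 1" by (rule lattice_section[OF gen])
  define d where "d j = \<theta>' j - \<theta> j" for j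
  define L where "L k j = (if j = k then 1 else 0) - (\<Sum>i\<in>UNIV. a k $ i * s i j)" for k j
  have L: "L k \<in> rel_lattice a" for k
  proof -
    have "(\<Sum>j\<in>UNIV. s i j * a j $ m) = (if m = i then 1 else 0)" for i m
      using arg_cong[OF spec[OF s, of i], of "\<lambda>x. x $ m"] by (simp add: axis_def)
    then have "(\<Sum>i\<in>UNIV. a k $ i * (\<Sum>j\<in>UNIV. s i j * a j $ m)) = a k $ m" for m
      by (simp add: if_distrib[of "\<lambda>x. _ * x"] cong: if_cong)
    moreover have "(\<Sum>j\<in>UNIV. (\<Sum>i\<in>UNIV. a k $ i * s i j) * a j $ m) =
        (\<Sum>i\<in>UNIV. a k $ i * (\<Sum>j\<in>UNIV. s i j * a j $ m))" for m
      unfolding sum_distrib_right sum_distrib_left mult.assoc by (rule sum.swap)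
    ultimately show ?thesis
      by (simp add: rel_lattice_def vec_eq_iff L_def left_diff_distrib sum_subtractf
          if_distrib[of "\<lambda>x. x * _"] cong: if_cong)
  qed
  have "cwt a d = 0" using \<theta> \<theta>' by (simp add: d_def[abs_def] cwt_diff)
  then have d0: "(\<Sum>k\<in>UNIV. of_int (a k $ i) * d k) = 0" for i
    by (simp add: cwt_def vec_eq_iff)
  have d: "(\<Sum>k\<in>UNIV. d k * of_int (L k j)) = d j" for j
  proof -
    have "(\<Sum>k\<in>UNIV. d k * (\<Sum>i\<in>UNIV. of_int (a k $ i) * of_int (s i j))) =
        (\<Sum>k\<in>UNIV. \<Sum>i\<in>UNIV. of_int (s i j) * (of_int (a k $ i) * d k))"
      by (simp add: sum_distrib_left mult_ac)
    also have "\<dots> = (\<Sum>i\<in>UNIV. of_int (s i j) * (\<Sum>k\<in>UNIV. of_int (a k $ i) * d k))"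
      unfolding sum_distrib_left by (rule sum.swap)
    finally have "(\<Sum>k\<in>UNIV. d k * (\<Sum>i\<in>UNIV. of_int (a k $ i) * of_int (s i j))) = 0"
      by (simp add: d0)
    then show ?thesis
      by (simp add: L_def right_diff_distrib sum_subtractf if_distrib[of "\<lambda>x. _ * x"]
          if_distrib[of of_int] cong: if_cong)
  qed
  have "cwt a (\<lambda>j. \<theta> j + (\<Sum>k\<in>F. d k * of_int (L k j))) = c \<and>
      p (\<lambda>j. \<theta> j + (\<Sum>k\<in>F. d k * of_int (L k j))) = p \<theta>" if "finite F" for F
    using that
  proof (induction F rule: finite_induct)
    case empty
    show ?case using \<theta> by simp
  next
    case (insert k F)
    have eq: "(\<lambda>j. \<theta> j + (\<Sum>k\<in>insert k F. d k * of_int (L k j))) =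
        (\<lambda>j. (\<theta> j + (\<Sum>k\<in>F. d k * of_int (L k j))) + d k * of_int (L k j))"
      using insert.hyps by (simp add: add_ac)
    show ?case unfolding eq
      using fib[OF conjunct1[OF insert.IH] L] line[OF conjunct1[OF insert.IH] L] insert.IH by simp
  qed
  from conjunct2[OF this[OF finite_class.finite_UNIV]] show ?thesis by (simp add: d) (simp add: d_def)
qed

text \<open>
  Descent on the degree of \<open>p\<close>. The polynomial \<open>p(\<theta> + m) - p(\<theta> + k)\<close> that \<open>\<partial>\<^sup>m - \<partial>\<^sup>k\<close> produces has smaller
  degree and the exponent \<open>u + m\<close>; either one of these is nonzero on its fibre, or \<open>p\<close> is
  constant on the fibre of \<open>u\<close>.
\<close>

lemma unit_if_Theta_mem:
  fixes a :: "'n::{finite,linorder} \<Rightarrow> int ^ 'r"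
  assumes gen: "range (\<lambda>c. \<Sum>j\<in>UNIV. c j *s a j) = UNIV" and bf: "has_b_functions a \<alpha>"
    and J: "lideal J" "hg_ideal a \<alpha> \<subseteq> J"
  shows "poly_less n p \<Longrightarrow> (\<lambda>f. Theta p (dpow u f)) \<in> J \<Longrightarrow> cwt a \<theta> + cvec (wt a u) = \<alpha> \<Longrightarrow>
    p \<theta> \<noteq> 0 \<Longrightarrow> id \<in> J"
proof (induction n arbitrary: p u \<theta>)
  case 0
  then show ?case using poly_less_0 by metis
next
  case (Suc n)
  note JI = subsetD[OF order_trans[OF toric_ideal_subset_hg_ideal J(2)]]
  have p: "poly_fun p" using Suc.prems(1) by (auto simp: poly_fun_def)
  define sh where "sh m \<theta> = p (\<lambda>j. \<theta> j + of_nat (m j))" for m :: "'n \<Rightarrow> nat" and \<theta>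
  have sh: "poly_fun (sh m)" for m unfolding sh_def by (rule poly_fun_shift[OF p])
  have diff: "(\<lambda>f. Theta (\<lambda>\<theta>. sh m \<theta> - sh k \<theta>) (dpow (\<lambda>j. m j + u j) f)) \<in> J"
    if mk: "wt a m = wt a k" for m k
  proof -
    have eq: "dpow m (Theta p (dpow u f)) = Theta (sh m) (dpow (\<lambda>j. m j + u j) f)" for m f
      unfolding dpow_Theta[OF p] dpow_dpow sh_def ..
    have 1: "(\<lambda>f. Theta (sh m) (dpow (\<lambda>j. m j + u j) f)) \<in> J" for m
      using lideal_comp[OF J(1) dops_dpow Suc.prems(2), of m] unfolding eq .
    have "wt a (\<lambda>j. m j + u j) = wt a (\<lambda>j. k j + u j)" by (simp add: wt_add mk)
    from lideal_comp[OF J(1) Theta_in_dops[OF sh] JI[OF dpow_diff_in_toric_ideal[OF this]], of k]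
    have 2: "(\<lambda>f. Theta (sh k) (dpow (\<lambda>j. m j + u j) f) - Theta (sh k) (dpow (\<lambda>j. k j + u j) f)) \<in> J"
      unfolding dops_diff_arg[OF Theta_in_dops[OF sh]] .
    from lideal_diff[OF J(1) lideal_diff[OF J(1) 1[of m] 1[of k]] 2] show ?thesis
      unfolding Theta_diff[OF sh sh] by (simp add: algebra_simps)
  qed
  show ?case
  proof (cases "\<exists>m k \<theta>. wt a m = wt a k \<and> cwt a \<theta> + cvec (wt a (\<lambda>j. m j + u j)) = \<alpha> \<and> sh m \<theta> \<noteq> sh k \<theta>")
    case True
    then obtain m k \<theta>' where mk: "wt a m = wt a k" and \<theta>': "cwt a \<theta>' + cvec (wt a (\<lambda>j. m j + u j)) = \<alpha>"
      and ne: "sh m \<theta>' - sh k \<theta>' \<noteq> 0" by auto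
    have inc: "poly_less n (\<lambda>\<theta>. sh m \<theta> - p \<theta>)" for m
      using poly_less_increment[OF Suc.prems(1), of "\<lambda>j. of_nat (m j)"] by (simp add: sh_def)
    have "poly_less n (\<lambda>\<theta>. (sh m \<theta> - p \<theta>) - (sh k \<theta> - p \<theta>))" by (rule poly_less_diff[OF inc inc])
    then have "poly_less n (\<lambda>\<theta>. sh m \<theta> - sh k \<theta>)" by simp
    from Suc.IH[OF this diff[OF mk] \<theta>' ne] show ?thesis .
  next
    case False
    define c where "c = \<alpha> - cvec (wt a u)"
    have "p y = p \<theta>" if y: "cwt a y = c" for y
    proof (rule poly_fun_fibre_const[OF gen p _ _ y])
      show "cwt a \<theta> = c" using Suc.prems(3) by (simp add: c_def algebra_simps)
      fix y l assume y: "cwt a y = c" and l: "l \<in> rel_lattice a"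
      define m where "m j = nat (- l j)" for j
      define k where "k j = nat (l j)" for j
      define x where "x j = y j - of_nat (m j)" for j
      have km: "int (k j) - int (m j) = l j" for j by (simp add: k_def m_def)
      then have kml: "of_nat (k j) - of_nat (m j) = (of_int (l j) :: complex)" for j
        by (metis of_int_diff of_int_of_nat_eq)
      have "wt a k - wt a m = (\<Sum>j\<in>UNIV. l j *s a j)"
        by (simp add: wt_def vec_eq_iff km[symmetric] left_diff_distrib sum_subtractf)
      then have "wt a m = wt a k" using l by (simp add: rel_lattice_def)
      moreover have "cwt a x + cvec (wt a (\<lambda>j. m j + u j)) = \<alpha>"
        using y by (simp add: x_def[abs_def] cwt_diff cwt_of_nat wt_add cvec_add c_def)
      ultimately have "sh m x = sh k x" using False by blast
      moreover have "(\<lambda>j. x j + of_nat (k j)) = (\<lambda>j. y j + of_int (l j))"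
        unfolding kml[symmetric] x_def by (simp add: algebra_simps)
      ultimately show "p (\<lambda>j. y j + of_int (l j)) = p y" by (simp add: sh_def x_def)
    qed
    then have "\<And>y. cwt a y + cvec (wt a u) = \<alpha> \<Longrightarrow> p y - p \<theta> = 0"
      by (simp add: c_def eq_diff_eq)
    from Theta_in_hg_ideal[OF gen poly_fun_diff[OF p poly_fun_const] this]
    have "(\<lambda>f. Theta (\<lambda>y. p y - p \<theta>) (dpow u f)) \<in> J" using J(2) by blast
    then have "(\<lambda>f. Theta p (dpow u f) - scalar (p \<theta>) * dpow u f) \<in> J"
      by (simp only: Theta_diff[OF p poly_fun_const] Theta_const)
    from lideal_diff[OF J(1) Suc.prems(2) this]
    have "(\<lambda>f. scalar (p \<theta>) * dpow u f) \<in> J" by simp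
    moreover have "scalar (p \<theta>) \<noteq> (0 :: 'n ratfun)" using Suc.prems(4) by (simp add: scalar_eq_0_iff)
    ultimately have "dpow u \<in> J" by (rule lideal_unit_smult[OF J(1)])
    then show ?thesis by (rule unit_if_dpow_mem[OF gen bf J])
  qed
qed

section \<open>The cone, its facets and the b-functions\<close>

lemma complex_vec_real_vec: "complex_vec (real_vec k) = cvec k"
  by (simp add: complex_vec_def real_vec_def cvec_def vec_eq_iff)

lemma real_vec_add: "real_vec (x + y) = real_vec x + real_vec y"
  by (simp add: real_vec_def vec_eq_iff)

lemma real_vec_diff: "real_vec (x - y) = real_vec x - real_vec y"
  by (simp add: real_vec_def vec_eq_iff)

lemma real_vec_sum: "real_vec (\<Sum>j\<in>S. l j *s x j) = (\<Sum>j\<in>S. of_int (l j) *\<^sub>R real_vec (x j))"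
  by (simp add: real_vec_def vec_eq_iff)

lemma complex_vec_in_span:
  fixes F :: "(real ^ 'r) set"
  assumes "x \<in> span F"
  shows "complex_vec x \<in> vec.span (complex_vec ` F)"
proof -
  let ?T = "{x. complex_vec x \<in> vec.span (complex_vec ` F)}"
  have "subspace ?T"
  proof (rule subspaceI)
    have "complex_vec (0 :: real ^ 'r) = 0" by (simp add: complex_vec_def vec_eq_iff)
    then show "0 \<in> ?T" by (simp add: vec.span_zero)
  next
    fix x y assume "x \<in> ?T" "y \<in> ?T"
    moreover have "complex_vec (x + y) = complex_vec x + complex_vec y"
      by (simp add: complex_vec_def vec_eq_iff)
    ultimately show "x + y \<in> ?T" by (simp add: vec.span_add)
  next
    fix x and r :: real assume "x \<in> ?T"
    moreover have "complex_vec (r *\<^sub>R x) = of_real r *s complex_vec x"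
      by (simp add: complex_vec_def vec_eq_iff)
    ultimately show "r *\<^sub>R x \<in> ?T" by (simp add: vec.span_scale)
  qed
  moreover have "F \<subseteq> ?T" by (auto intro: vec.span_base)
  ultimately have "span F \<subseteq> ?T" by (rule span_minimal[rotated])
  then show ?thesis using assms by blast
qed

lemma affine_hull_pos_cone:
  fixes a :: "'n::finite \<Rightarrow> int ^ 'r"
  assumes gen: "range (\<lambda>c. \<Sum>j\<in>UNIV. c j *s a j) = UNIV"
  shows "affine hull (pos_cone a) = UNIV"
proof -
  obtain s where s: "\<forall>i. (\<Sum>j\<in>UNIV. s i j *s a j) = axis i 1" by (rule lattice_section[OF gen])
  have "axis i 1 \<in> span (pos_cone a)" for i :: 'r
  proof -
    have "(axis i 1 :: real ^ 'r) = real_vec (axis i 1)" by (simp add: real_vec_def axis_def vec_eq_iff)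
    also have "\<dots> = (\<Sum>j\<in>UNIV. real_of_int (s i j) *\<^sub>R real_vec (a j))"
      unfolding spec[OF s, of i, symmetric] by (rule real_vec_sum)
    also have "\<dots> \<in> span (pos_cone a)" by (intro span_sum span_scale span_base pos_cone_gen)
    finally show ?thesis .
  qed
  then have "Basis \<subseteq> span (pos_cone a)" by (auto simp: Basis_vec_def)
  then have "span (pos_cone a) = UNIV" using span_minimal[of Basis "span (pos_cone a)"] by auto
  then show ?thesis using pos_cone_0[of a] by (simp add: affine_hull_span_0 hull_inc)
qed

text \<open>
  The cone is cut out by its facets, each of which lies in a hyperplane through the origin because
  the cone is closed under scaling. A facet spans its hyperplane, also after complexification, so a
  zero of the complexified normal form lies in the complex span of the facet.
\<close>

lemma pos_cone_facet_normals:
  fixes a :: "'n::finite \<Rightarrow> int ^ 'r"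
  assumes gen: "range (\<lambda>c. \<Sum>j\<in>UNIV. c j *s a j) = UNIV"
  obtains N :: "(real ^ 'r) set" where "finite N" "pos_cone a = {x. \<forall>n\<in>N. 0 \<le> n \<bullet> x}"
    "\<forall>n\<in>N. \<forall>z. (\<Sum>i\<in>UNIV. of_real (n $ i) * z $ i) = 0 \<longrightarrow>
      z \<in> (\<Union>F\<in>{F. F facet_of pos_cone a}. vec.span (complex_vec ` F))"
proof -
  let ?C = "pos_cone a"
  note aff = affine_hull_pos_cone[OF gen]
  have "polyhedron ?C" by (simp add: pos_cone_eq_hull polyhedron_convex_cone_hull)
  then obtain H where H: "finite H" and C: "?C = affine hull ?C \<inter> \<Inter>H"
    and Hab: "\<forall>h\<in>H. \<exists>a b. a \<noteq> 0 \<and> h = {x. a \<bullet> x \<le> b}"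
    and min: "\<forall>H'. H' \<subset> H \<longrightarrow> ?C \<subset> affine hull ?C \<inter> \<Inter>H'"
    unfolding polyhedron_Int_affine_minimal by (elim exE conjE) (rule that)
  from bchoice[OF Hab] obtain u where "\<forall>h\<in>H. \<exists>b. u h \<noteq> 0 \<and> h = {x. u h \<bullet> x \<le> b}" by blast
  from bchoice[OF this] obtain b where ub: "\<forall>h\<in>H. u h \<noteq> 0 \<and> h = {x. u h \<bullet> x \<le> b h}" by blast
  have facet: "?C \<inter> {x. u h \<bullet> x = b h} facet_of ?C" if "h \<in> H" for h
    using facet_of_polyhedron_explicit[OF H C, of u b] ub min that by blast
  have Ch: "u h \<bullet> x \<le> b h" if "h \<in> H" "x \<in> ?C" for h x
  proof -
    have "x \<in> h" using C that by blast
    then show ?thesis using ub that(1) by blast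
  qed
  have b0: "b h = 0" if h: "h \<in> H" for h
  proof -
    have "0 \<le> b h" using Ch[OF h pos_cone_0] by simp
    moreover obtain x where x: "x \<in> ?C" "u h \<bullet> x = b h"
      using facet[OF h] by (auto simp: facet_of_def)
    have "u h \<bullet> (2 *\<^sub>R x) \<le> b h" using x(1) by (intro Ch[OF h] pos_cone_scaleR) auto
    then have "b h \<le> 0" using x(2) by simp
    ultimately show ?thesis by simp
  qed
  define N where "N = (\<lambda>h. - u h) ` H"
  have "finite N" using H by (simp add: N_def)
  moreover have "?C = {x. \<forall>n\<in>N. 0 \<le> n \<bullet> x}"
  proof (intro equalityI subsetI)
    fix x assume "x \<in> ?C"
    then show "x \<in> {x. \<forall>n\<in>N. 0 \<le> n \<bullet> x}" using Ch b0 by (auto simp: N_def)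
  next
    fix x assume x: "x \<in> {x. \<forall>n\<in>N. 0 \<le> n \<bullet> x}"
    have "x \<in> h" if "h \<in> H" for h
    proof -
      have "u h \<bullet> x \<le> b h" using x b0[OF that] that by (auto simp: N_def)
      then show ?thesis using ub that by blast
    qed
    then show "x \<in> ?C" using C aff by blast
  qed
  moreover have "\<forall>n\<in>N. \<forall>z. (\<Sum>i\<in>UNIV. of_real (n $ i) * z $ i) = 0 \<longrightarrow>
      z \<in> (\<Union>F\<in>{F. F facet_of ?C}. vec.span (complex_vec ` F))"
  proof (intro ballI allI impI)
    fix n and z :: "complex ^ 'r"
    assume "n \<in> N" and z: "(\<Sum>i\<in>UNIV. of_real (n $ i) * z $ i) = 0"
    then obtain h where h: "h \<in> H" and n: "n = - u h" by (auto simp: N_def)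
    define F where "F = ?C \<inter> {x. u h \<bullet> x = b h}"
    have F: "F facet_of ?C" unfolding F_def by (rule facet[OF h])
    have "0 \<in> F" using pos_cone_0 b0[OF h] by (simp add: F_def)
    have sub: "F \<subseteq> {x. u h \<bullet> x = 0}" using b0[OF h] by (auto simp: F_def)
    have "int (dim F) = aff_dim F" using \<open>0 \<in> F\<close> by (simp add: aff_dim_zero hull_inc)
    also have "\<dots> = aff_dim ?C - 1" using F by (simp add: facet_of_def)
    also have "aff_dim ?C = aff_dim (UNIV :: (real ^ 'r) set)"
      using aff by (metis aff_dim_affine_hull)
    finally have "dim F = DIM(real ^ 'r) - 1" by simp
    then have "span F = span {x. u h \<bullet> x = 0}"
      using ub h by (intro dim_eq_span sub) (simp add: dim_hyperplane)
    then have spanF: "span F = {x. u h \<bullet> x = 0}" by (simp add: subspace_hyperplane)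
    define x where "x = (\<chi> i. Re (z $ i))"
    define y where "y = (\<chi> i. Im (z $ i))"
    have "u h \<bullet> x = 0" "u h \<bullet> y = 0"
      using arg_cong[OF z, of Re] arg_cong[OF z, of Im]
      by (simp_all add: n inner_vec_def x_def y_def sum_negf)
    then have "complex_vec x \<in> vec.span (complex_vec ` F)" "complex_vec y \<in> vec.span (complex_vec ` F)"
      by (auto intro: complex_vec_in_span simp: spanF)
    then have "complex_vec x + \<i> *s complex_vec y \<in> vec.span (complex_vec ` F)"
      by (intro vec.span_add vec.span_scale)
    moreover have "complex_vec x + \<i> *s complex_vec y = z"
      by (simp add: complex_vec_def x_def y_def vec_eq_iff complex_eq_iff)
    ultimately show "z \<in> (\<Union>F\<in>{F. F facet_of ?C}. vec.span (complex_vec ` F))" using F by auto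
  qed
  ultimately show thesis by (rule that)
qed

lemma finite_bounded_int_vec: "finite {y :: int ^ 'r. \<forall>i. \<bar>y $ i\<bar> \<le> M i}"
proof (rule finite_subset)
  show "{y :: int ^ 'r. \<forall>i. \<bar>y $ i\<bar> \<le> M i} \<subseteq> vec_lambda ` (PiE UNIV (\<lambda>i. {- M i..M i}))"
  proof
    fix y :: "int ^ 'r" assume "y \<in> {y. \<forall>i. \<bar>y $ i\<bar> \<le> M i}"
    then have "vec_nth y \<in> PiE UNIV (\<lambda>i. {- M i..M i})" by (auto simp: abs_le_iff minus_le_iff)
    then show "y \<in> vec_lambda ` (PiE UNIV (\<lambda>i. {- M i..M i}))"
      by (intro image_eqI[of _ _ "vec_nth y"]) simp_all
  qed
  show "finite (vec_lambda ` (PiE UNIV (\<lambda>i :: 'r. {- M i..M i})))"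
    by (intro finite_imageI finite_PiE) auto
qed

text \<open>
  Subtracting the integral parts of the coefficients moves a lattice point of the cone into a
  finite set. Each point of that set is an integral combination of the generators, and \<open>c\<close> is large
  enough to compensate all negative coefficients that occur.
\<close>

lemma semigroup_conductor:
  fixes a :: "'n::finite \<Rightarrow> int ^ 'r"
  assumes gen: "range (\<lambda>c. \<Sum>j\<in>UNIV. c j *s a j) = UNIV"
  obtains c where "\<forall>k. real_vec k \<in> pos_cone a \<longrightarrow> wt a c + k \<in> range (wt a)"
proof -
  define Y where "Y = {y :: int ^ 'r. \<forall>i. \<bar>y $ i\<bar> \<le> (\<Sum>j\<in>UNIV. \<bar>a j $ i\<bar>)}"
  have Y: "finite Y" unfolding Y_def by (rule finite_bounded_int_vec)
  have "\<forall>y. \<exists>z. y = (\<Sum>j\<in>UNIV. z j *s a j)"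
  proof
    fix y
    have "y \<in> range (\<lambda>c. \<Sum>j\<in>UNIV. c j *s a j)" unfolding gen by (rule UNIV_I)
    then show "\<exists>z. y = (\<Sum>j\<in>UNIV. z j *s a j)" by (rule rangeE) (rule exI)
  qed
  then obtain z where z: "\<forall>y. y = (\<Sum>j\<in>UNIV. z y j *s a j)" by (rule choice[THEN exE])
  define c where "c j = (\<Sum>y\<in>Y. nat \<bar>z y j\<bar>)" for j
  have c: "- z y j \<le> int (c j)" if "y \<in> Y" for y j
  proof -
    have "nat \<bar>z y j\<bar> \<le> c j" unfolding c_def using Y that by (intro member_le_sum) auto
    then show ?thesis by linarith
  qed
  have "wt a c + k \<in> range (wt a)" if "real_vec k \<in> pos_cone a" for k
  proof -
    from that obtain t where t: "\<And>j. 0 \<le> t j" and k: "real_vec k = (\<Sum>j\<in>UNIV. t j *\<^sub>R real_vec (a j))"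
      by (auto simp: pos_cone_def)
    define y where "y = k - (\<Sum>j\<in>UNIV. \<lfloor>t j\<rfloor> *s a j)"
    have "real_vec y = (\<Sum>j\<in>UNIV. frac (t j) *\<^sub>R real_vec (a j))"
      by (simp add: y_def real_vec_diff k real_vec_sum frac_def scaleR_diff_left sum_subtractf)
    then have "real_of_int (y $ i) = (\<Sum>j\<in>UNIV. frac (t j) * real_of_int (a j $ i))" for i
      by (simp add: real_vec_def vec_eq_iff)
    then have "\<bar>real_of_int (y $ i)\<bar> \<le> (\<Sum>j\<in>UNIV. \<bar>frac (t j) * real_of_int (a j $ i)\<bar>)" for i
      by (simp only: sum_abs)
    also have "\<dots> i \<le> (\<Sum>j\<in>UNIV. \<bar>real_of_int (a j $ i)\<bar>)" for i
    proof (intro sum_mono)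
      fix j
      have "frac (t j) * \<bar>real_of_int (a j $ i)\<bar> \<le> 1 * \<bar>real_of_int (a j $ i)\<bar>"
        using frac_lt_1[of "t j"] by (intro mult_right_mono) auto
      then show "\<bar>frac (t j) * real_of_int (a j $ i)\<bar> \<le> \<bar>real_of_int (a j $ i)\<bar>"
        by (simp add: abs_mult)
    qed
    finally have "\<bar>real_of_int (y $ i)\<bar> \<le> real_of_int (\<Sum>j\<in>UNIV. \<bar>a j $ i\<bar>)" for i by simp
    then have "\<bar>y $ i\<bar> \<le> (\<Sum>j\<in>UNIV. \<bar>a j $ i\<bar>)" for i
      by (metis of_int_abs of_int_le_iff)
    then have yY: "y \<in> Y" by (simp add: Y_def)
    define m where "m j = nat (int (c j) + z y j + \<lfloor>t j\<rfloor>)" for j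
    have m: "int (m j) = int (c j) + z y j + \<lfloor>t j\<rfloor>" for j
      using c[OF yY, of j] t[of j] by (simp add: m_def)
    have "k = (\<Sum>j\<in>UNIV. z y j *s a j) + (\<Sum>j\<in>UNIV. \<lfloor>t j\<rfloor> *s a j)"
      using spec[OF z, of y] by (simp add: y_def)
    then have "wt a c + k = wt a m"
      by (simp add: wt_def m vec_eq_iff distrib_right sum.distrib)
    then show ?thesis by simp
  qed
  then show thesis by (intro that) blast
qed

lemma finite_small_nat_combinations:
  fixes q :: "'n::finite \<Rightarrow> real"
  assumes q: "\<And>j. 0 \<le> q j"
  shows "finite {(\<Sum>j\<in>UNIV. real (m j) * q j) | m. (\<Sum>j\<in>UNIV. real (m j) * q j) < K}"
proof (rule finite_subset)
  define D where "D j = (if q j = 0 then {0} else {..nat \<lceil>K / q j\<rceil>})" for j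
  show "{(\<Sum>j\<in>UNIV. real (m j) * q j) | m. (\<Sum>j\<in>UNIV. real (m j) * q j) < K} \<subseteq>
      (\<lambda>m. \<Sum>j\<in>UNIV. real (m j) * q j) ` (PiE UNIV D)"
  proof clarify
    fix m :: "'n \<Rightarrow> nat" assume m: "(\<Sum>j\<in>UNIV. real (m j) * q j) < K"
    define m' where "m' j = (if q j = 0 then 0 else m j)" for j
    have "m' j \<in> D j" for j
    proof (cases "q j = 0")
      case False
      then have "0 < q j" using q[of j] by simp
      have "real (m j) * q j \<le> (\<Sum>j\<in>UNIV. real (m j) * q j)"
        using q by (intro member_le_sum) auto
      then have "real (m j) < K / q j" using m \<open>0 < q j\<close> by (simp add: field_simps)
      then have "m j \<le> nat \<lceil>K / q j\<rceil>" by linarith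
      then show ?thesis using False by (simp add: m'_def D_def)
    qed (simp add: m'_def D_def)
    then have "m' \<in> PiE UNIV D" by auto
    moreover have "(\<Sum>j\<in>UNIV. real (m j) * q j) = (\<Sum>j\<in>UNIV. real (m' j) * q j)"
      by (rule sum.cong) (auto simp: m'_def)
    ultimately show "(\<Sum>j\<in>UNIV. real (m j) * q j) \<in> (\<lambda>m. \<Sum>j\<in>UNIV. real (m j) * q j) ` (PiE UNIV D)"
      by (intro image_eqI[of _ _ m'])
  qed
  show "finite ((\<lambda>m. \<Sum>j\<in>UNIV. real (m j) * q j) ` (PiE UNIV D))"
    by (intro finite_imageI finite_PiE) (auto simp: D_def)
qed

lemma inner_real_vec_wt: "n \<bullet> real_vec (wt a m) = (\<Sum>j\<in>UNIV. real (m j) * (n \<bullet> real_vec (a j)))"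
  unfolding wt_def real_vec_sum by (simp add: inner_sum_right)

text \<open>
  With the conductor \<open>c\<close>, a point \<open>A m\<close> that is not in \<open>A w + A \<nat>\<^sup>N\<close> satisfies \<open>n \<bullet> A m < n \<bullet> (A c + A w)\<close> for
  some facet normal \<open>n\<close>. Normals are nonnegative on the generators, so only finitely many such
  values occur, and \<open>B\<close> is the product of the corresponding linear factors.
\<close>

lemma nonresonant_imp_has_b_functions:
  fixes a :: "'n::{finite,linorder} \<Rightarrow> int ^ 'r"
  assumes gen: "range (\<lambda>c. \<Sum>j\<in>UNIV. c j *s a j) = UNIV" and nonres: "nonresonant a \<alpha>"
  shows "has_b_functions a \<alpha>"
  unfolding has_b_functions_def
proof
  fix w
  obtain N where N: "finite N" and cone: "pos_cone a = {x. \<forall>n\<in>N. 0 \<le> n \<bullet> x}"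
    and ker: "\<forall>n\<in>N. \<forall>z. (\<Sum>i\<in>UNIV. of_real (n $ i) * z $ i) = 0 \<longrightarrow>
      z \<in> (\<Union>F\<in>{F. F facet_of pos_cone a}. vec.span (complex_vec ` F))"
    by (rule pos_cone_facet_normals[OF gen])
  obtain c where c: "\<forall>k. real_vec k \<in> pos_cone a \<longrightarrow> wt a c + k \<in> range (wt a)"
    by (rule semigroup_conductor[OF gen])
  define K where "K n = n \<bullet> real_vec (wt a c + wt a w)" for n
  define V where "V n = {n \<bullet> real_vec (wt a m) | m. n \<bullet> real_vec (wt a m) < K n}" for n
  have V: "finite (V n)" if "n \<in> N" for n
  proof -
    have "0 \<le> n \<bullet> real_vec (a j)" for j
      using pos_cone_gen[of a j] that by (auto simp: cone)
    then show ?thesis unfolding V_def inner_real_vec_wt by (rule finite_small_nat_combinations)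
  qed
  define \<Lambda> where "\<Lambda> n x = (\<Sum>i\<in>UNIV. of_real (n $ i) * x $ i)" for n :: "real ^ 'r" and x :: "complex ^ 'r"
  have \<Lambda>_cvec: "\<Lambda> n (cvec k) = of_real (n \<bullet> real_vec k)" for n k
    by (simp add: \<Lambda>_def cvec_def real_vec_def inner_vec_def)
  have \<Lambda>_diff: "\<Lambda> n (x - y) = \<Lambda> n x - \<Lambda> n y" for n x y
    by (simp add: \<Lambda>_def right_diff_distrib sum_subtractf)
  define B where "B x = (\<Prod>n\<in>N. \<Prod>v\<in>V n. \<Lambda> n x - of_real v)" for x
  have "weight_poly a B"
    unfolding weight_poly_def B_def \<Lambda>_def
    by (intro poly_fun_prod poly_fun_diff poly_fun_sum poly_fun_scale poly_fun_cwt_nth poly_fun_const)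
  moreover have "B (cvec (wt a m)) = 0" if m: "wt a m - wt a w \<notin> range (wt a)" for m
  proof -
    define k where "k = wt a m - wt a w - wt a c"
    have "wt a c + k \<notin> range (wt a)" using m by (simp add: k_def)
    then have "real_vec k \<notin> pos_cone a" using c by blast
    then obtain n where n: "n \<in> N" "n \<bullet> real_vec k < 0" by (auto simp: cone not_le)
    then have "n \<bullet> real_vec (wt a m) \<in> V n"
      by (auto simp: V_def K_def k_def real_vec_diff real_vec_add inner_diff_right inner_add_right)
    then have "(\<Prod>v\<in>V n. \<Lambda> n (cvec (wt a m)) - of_real v) = 0"
      using V[OF n(1)] by (intro prod_zero) (auto simp: \<Lambda>_cvec)
    then show ?thesis unfolding B_def using N n(1) by (intro prod_zero) auto
  qed
  moreover have "B (\<alpha> + cvec k) \<noteq> 0" for k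
  proof
    assume "B (\<alpha> + cvec k) = 0"
    then obtain n v where n: "n \<in> N" and v: "v \<in> V n" and zero: "\<Lambda> n (\<alpha> + cvec k) = of_real v"
      using N V by (auto simp: B_def prod_zero_iff)
    from v obtain m where m: "v = n \<bullet> real_vec (wt a m)" by (auto simp: V_def)
    have "cvec (k - wt a m) = cvec k - cvec (wt a m)" by (simp add: cvec_def vec_eq_iff)
    then have "\<Lambda> n (\<alpha> + cvec (k - wt a m)) = 0"
      using zero \<Lambda>_diff[of n "\<alpha> + cvec k" "cvec (wt a m)"] by (simp add: m \<Lambda>_cvec add_diff_eq)
    then have "\<alpha> + cvec (k - wt a m) \<in> (\<Union>F\<in>{F. F facet_of pos_cone a}. vec.span (complex_vec ` F))"
      using ker n by (simp only: \<Lambda>_def)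
    moreover have "\<alpha> + cvec (k - wt a m) \<in> range (\<lambda>k. \<alpha> + complex_vec (real_vec k))"
      unfolding complex_vec_real_vec by (rule rangeI)
    ultimately show False using nonres unfolding nonresonant_def by blast
  qed
  ultimately show "\<exists>B. weight_poly a B \<and>
      (\<forall>m. wt a m - wt a w \<notin> range (wt a) \<longrightarrow> B (cvec (wt a m)) = 0) \<and> (\<forall>k. B (\<alpha> + cvec k) \<noteq> 0)"
    by (intro exI[of _ B] conjI allI impI)
qed

section \<open>Maximality of the hypergeometric ideal\<close>

subsection \<open>Clearing denominators\<close>

lemma vmon_eq_Fract: "vmon k = Fract (Poly_Mapping.single (Abs_poly_mapping k) 1) 1"
proof (induction k rule: multiindex_induct)
  case zero
  have "Abs_poly_mapping (\<lambda>_ :: 'a. 0 :: nat) = 0" by (rule zero_poly_mapping.abs_eq[symmetric])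
  then show ?case by (simp add: vmon_0 One_fract_def)
next
  case (step k i)
  have "Abs_poly_mapping (k(i := Suc (k i))) = Poly_Mapping.single i 1 + Abs_poly_mapping k"
    by (rule poly_mapping_eqI)
      (simp add: lookup_Abs_poly_mapping lookup_add lookup_single when_def)
  then show ?case by (simp only: vmon_Suc step var_def mult_fract mult_single mult_1_right)
qed

lemma vmon_mult: "vmon k * vmon l = vmon (\<lambda>j. k j + l j)"
  by (simp add: vmon_def power_add prod.distrib)

lemma Fract_monomial: "Fract (Poly_Mapping.single t c) 1 = scalar c * vmon (Poly_Mapping.lookup t)"
  by (simp add: vmon_eq_Fract scalar_def mult_single lookup_inverse)

text \<open>
  The operators with polynomial coefficients.
\<close>

inductive weyl :: "'n::{finite,linorder} ratop \<Rightarrow> bool" where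
  weyl_zero: "weyl (\<lambda>f. 0)"
| weyl_monomial: "weyl (\<lambda>f. scalar c * (vmon k * dpow m f))"
| weyl_add: "weyl P \<Longrightarrow> weyl Q \<Longrightarrow> weyl (\<lambda>f. P f + Q f)"

lemma weyl_mult_monomial: "weyl P \<Longrightarrow> weyl (\<lambda>f. scalar b * vmon l * P f)"
proof (induction rule: weyl.induct)
  case weyl_zero
  show ?case using weyl.weyl_zero by simp
next
  case (weyl_monomial c k m)
  have "(\<lambda>f. scalar b * vmon l * (scalar c * (vmon k * dpow m f))) =
      (\<lambda>f. scalar (b * c) * (vmon (\<lambda>j. l j + k j) * dpow m f))"
    by (simp add: scalar_mult vmon_mult[symmetric] mult_ac)
  then show ?case by (simp only: weyl.weyl_monomial)
next
  case (weyl_add P Q)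
  from weyl.weyl_add[OF weyl_add.IH] show ?case by (simp only: distrib_left)
qed

lemma weyl_mult_poly:
  assumes "weyl P"
  shows "weyl (\<lambda>f. Fract r 1 * P f)"
proof (induction r rule: mpol_induct)
  case 1
  show ?case using weyl_zero by (simp add: Zero_fract_def[symmetric])
next
  case (2 m c)
  show ?case unfolding Fract_monomial by (rule weyl_mult_monomial[OF assms])
next
  case (3 p q)
  have "Fract (p + q) 1 = Fract p 1 + Fract q 1" by simp
  then show ?case using weyl_add[OF 3] by (simp only: distrib_right)
qed

lemma dops_clear_denominators:
  fixes P :: "'n::{finite,linorder} ratop"
  assumes "P \<in> dops"
  obtains g where "g \<noteq> 0" "weyl (\<lambda>f. g * P f)"
proof -
  from assms obtain S c where S: "finite S" and P: "P = (\<lambda>f. \<Sum>m\<in>S. c m * dpow m f)" by (rule dopsE)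
  have "\<exists>s. s \<noteq> 0 \<and> weyl (\<lambda>f. Fract s 1 * (\<Sum>m\<in>S. c m * dpow m f))"
    using S
  proof (induction S rule: finite_induct)
    case empty
    show ?case using weyl_zero by (intro exI[of _ 1]) simp
  next
    case (insert m S)
    then obtain s where s: "s \<noteq> 0" "weyl (\<lambda>f. Fract s 1 * (\<Sum>m\<in>S. c m * dpow m f))" by blast
    obtain p q where c: "c m = Fract p q" and q: "q \<noteq> 0" by (cases "c m")
    have "weyl (dpow m)" using weyl_monomial[of 1 "\<lambda>_. 0" m] by (simp add: vmon_0)
    then have 1: "weyl (\<lambda>f. Fract (s * p) 1 * dpow m f)" by (rule weyl_mult_poly)
    have 2: "weyl (\<lambda>f. Fract q 1 * (Fract s 1 * (\<Sum>m\<in>S. c m * dpow m f)))" by (rule weyl_mult_poly[OF s(2)])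
    have 3: "Fract (s * q) 1 * c m = Fract (s * p) 1" using q by (simp add: c eq_fract)
    have 4: "Fract (s * q) 1 = Fract q 1 * Fract s 1" by (simp add: mult.commute)
    have "(\<lambda>f. Fract (s * q) 1 * (\<Sum>m\<in>insert m S. c m * dpow m f)) =
        (\<lambda>f. Fract (s * p) 1 * dpow m f + Fract q 1 * (Fract s 1 * (\<Sum>m\<in>S. c m * dpow m f)))"
      unfolding 3[symmetric] mult.assoc[symmetric] 4[symmetric] sum.insert[OF insert.hyps] distrib_left ..
    then show ?case using weyl_add[OF 1 2] s(1) q by (intro exI[of _ "s * q"]) (simp only: mult_eq_0_iff simp_thms)
  qed
  then obtain s where s: "s \<noteq> 0" "weyl (\<lambda>f. Fract s 1 * P f)" unfolding P by blast
  have "Fract s 1 \<noteq> 0" using s(1) by (simp add: Zero_fract_def eq_fract)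
  then show thesis using s(2) by (rule that)
qed

subsection \<open>Rewriting operators in terms of the \<open>v\<^sub>j \<partial>\<^sub>j\<close>\<close>

definition theta_form :: "'n::{finite,linorder} ratop \<Rightarrow> bool"
  where "theta_form X \<longleftrightarrow> (\<exists>S p. finite S \<and> (\<forall>m. poly_fun (p m)) \<and>
    X = (\<lambda>f. \<Sum>m\<in>S. Theta (p m) (dpow m f)))"

lemma theta_form_add:
  assumes "theta_form X" "theta_form Y"
  shows "theta_form (\<lambda>f. X f + Y f)"
proof -
  from assms(1) obtain S p where S: "finite S" and p: "\<forall>m. poly_fun (p m)"
    and X: "X = (\<lambda>f. \<Sum>m\<in>S. Theta (p m) (dpow m f))" unfolding theta_form_def by blast
  from assms(2) obtain T q where T: "finite T" and q: "\<forall>m. poly_fun (q m)"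
    and Y: "Y = (\<lambda>f. \<Sum>m\<in>T. Theta (q m) (dpow m f))" unfolding theta_form_def by blast
  define p' where "p' m = (if m \<in> S then p m else (\<lambda>_. 0))" for m
  define q' where "q' m = (if m \<in> T then q m else (\<lambda>_. 0))" for m
  have pq: "poly_fun (p' m)" "poly_fun (q' m)" for m using p q by (simp_all add: p'_def q'_def poly_fun_const)
  have X': "X = (\<lambda>f. \<Sum>m\<in>S \<union> T. Theta (p' m) (dpow m f))"
    unfolding X using S T by (intro ext sum.mono_neutral_cong_left) (auto simp: p'_def Theta_const)
  have Y': "Y = (\<lambda>f. \<Sum>m\<in>S \<union> T. Theta (q' m) (dpow m f))"
    unfolding Y using S T by (intro ext sum.mono_neutral_cong_left) (auto simp: q'_def Theta_const)
  have "(\<lambda>f. X f + Y f) = (\<lambda>f. \<Sum>m\<in>S \<union> T. Theta (\<lambda>\<theta>. p' m \<theta> + q' m \<theta>) (dpow m f))"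
    unfolding X' Y' sum.distrib[symmetric] Theta_add[OF pq] ..
  then show ?thesis unfolding theta_form_def using S T poly_fun_add[OF pq]
    by (intro exI[of _ "S \<union> T"] exI[of _ "\<lambda>m \<theta>. p' m \<theta> + q' m \<theta>"] conjI allI finite_UnI)
qed

text \<open>
  Once \<open>w \<ge> k\<close>, the factor \<open>\<partial>\<^sup>k\<close> that \<open>v\<^sup>k\<close> needs to become a polynomial in the \<open>\<theta>\<^sub>j\<close> can be split off from
  \<open>\<partial>\<^sup>m \<partial>\<^sup>w\<close>. The claim is for all large \<open>w\<close>, so that
  finitely many monomials can share one \<open>w\<close>.
\<close>

lemma weyl_dpow_right_theta_form:
  assumes "weyl P"
  shows "\<exists>v. \<forall>w\<ge>v. theta_form (\<lambda>f. P (dpow w f))"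
  using assms
proof (induction rule: weyl.induct)
  case weyl_zero
  have "theta_form (\<lambda>f :: 'a ratfun. 0)"
    unfolding theta_form_def by (rule exI[of _ "{}"], rule exI[of _ "\<lambda>_ _. 0"]) (simp add: poly_fun_const)
  then show ?case by blast
next
  case (weyl_monomial c k m)
  have "theta_form (\<lambda>f. scalar c * (vmon k * dpow m (dpow w f)))" if "k \<le> w" for w
  proof -
    define n where "n j = m j + (w j - k j)" for j
    have "(\<lambda>j. m j + w j) = (\<lambda>j. k j + n j)" 
    proof
      fix j
      have "k j \<le> w j" using that by (simp add: le_fun_def)
      then show "m j + w j = k j + n j" by (simp add: n_def)
    qed
    then have "dpow m (dpow w f) = dpow k (dpow n f)" for f by (simp only: dpow_dpow)
    moreover have pk: "poly_fun (falling k)" unfolding falling_def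
      by (intro poly_fun_prod poly_fun_diff poly_fun_coord poly_fun_const)
    ultimately have "(\<lambda>f. scalar c * (vmon k * dpow m (dpow w f))) =
        (\<lambda>f. \<Sum>m\<in>{n}. Theta (\<lambda>\<theta>. c * falling k \<theta>) (dpow m f))"
      by (simp add: Theta_scale[OF pk] Theta_falling)
    then show ?thesis unfolding theta_form_def using poly_fun_scale[OF pk]
      by (intro exI[of _ "{n}"] exI[of _ "\<lambda>_ \<theta>. c * falling k \<theta>"]) simp
  qed
  then show ?case by blast
next
  case (weyl_add P Q)
  then obtain v v' where v: "\<forall>w\<ge>v. theta_form (\<lambda>f. P (dpow w f))" "\<forall>w\<ge>v'. theta_form (\<lambda>f. Q (dpow w f))"
    by blast
  show ?case
  proof (intro exI[of _ "sup v v'"] allI impI)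
    fix w assume "sup v v' \<le> w"
    then have "theta_form (\<lambda>f. P (dpow w f))" "theta_form (\<lambda>f. Q (dpow w f))" using v by simp_all
    then show "theta_form (\<lambda>f. P (dpow w f) + Q (dpow w f))" by (rule theta_form_add)
  qed
qed

subsection \<open>Weight components\<close>

text \<open>
  Homogeneity is expressed by commutators with the Euler operators, which makes it usable modulo
  a left ideal that contains all \<open>Z\<^sub>i - \<alpha>\<^sub>i\<close>.
\<close>

definition weight_op :: "('n::{finite,linorder} \<Rightarrow> int ^ 'r) \<Rightarrow> int ^ 'r \<Rightarrow> 'n ratop \<Rightarrow> bool"
  where "weight_op a \<gamma> X \<longleftrightarrow> X \<in> dops \<and>
    (\<forall>i f. euler_op a i (X f) = X (euler_op a i f) - scalar (of_int (\<gamma> $ i)) * X f)"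

lemma weight_op_scale:
  assumes "weight_op a \<gamma> X"
  shows "weight_op a \<gamma> (\<lambda>f. scalar c * X f)"
  using assms unfolding weight_op_def
  by (simp add: dops_smult dops_scalar_arg[OF dops_euler_op] right_diff_distrib mult.left_commute)

lemma weight_op_sum:
  assumes "\<And>s. s \<in> S \<Longrightarrow> weight_op a \<gamma> (X s)"
  shows "weight_op a \<gamma> (\<lambda>f. \<Sum>s\<in>S. X s f)"
  using assms unfolding weight_op_def
  by (simp add: dops_sum dops_sum_arg[OF dops_euler_op] sum_subtractf sum_distrib_left)

lemma weight_op_Theta_dpow:
  assumes p: "poly_fun p"
  shows "weight_op a (wt a m) (\<lambda>f. Theta p (dpow m f))"
  unfolding weight_op_def
proof (intro conjI allI)
  show "(\<lambda>f. Theta p (dpow m f)) \<in> dops" by (rule dops_compose[OF Theta_in_dops[OF p] dops_dpow])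
  fix i f
  define z where "z = (\<lambda>\<theta>. cwt a \<theta> $ i)"
  define z' where "z' = (\<lambda>\<theta>. z \<theta> + of_int (wt a m $ i))"
  have z: "poly_fun z" unfolding z_def by (rule poly_fun_cwt_nth)
  have z': "poly_fun z'" unfolding z'_def by (intro poly_fun_add z poly_fun_const)
  have E: "euler_op a i g = Theta z g" for g unfolding z_def by (rule Theta_cwt_nth[symmetric])
  have "(\<lambda>\<theta>. z (\<lambda>j. \<theta> j + of_nat (m j))) = z'"
    by (simp add: z_def z'_def cwt_add cwt_of_nat cvec_def)
  then have "Theta p (dpow m (euler_op a i f)) = Theta p (Theta z' (dpow m f))"
    unfolding E dpow_Theta[OF z] by (simp only:)
  also have "\<dots> = Theta z' (Theta p (dpow m f))"
    unfolding Theta_mult[OF p z', symmetric] Theta_mult[OF z' p, symmetric] by (simp only: mult.commute)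
  also have "\<dots> = euler_op a i (Theta p (dpow m f)) + scalar (of_int (wt a m $ i)) * Theta p (dpow m f)"
    unfolding E z'_def by (simp only: Theta_add[OF z poly_fun_const] Theta_const)
  finally show "euler_op a i (Theta p (dpow m f)) =
      Theta p (dpow m (euler_op a i f)) - scalar (of_int (wt a m $ i)) * Theta p (dpow m f)"
    by simp
qed

text \<open>
  Modulo \<open>J\<close>, left multiplication by \<open>Z\<^sub>i\<close> has the component of weight \<open>\<gamma>\<close> as an eigenvector with
  eigenvalue \<open>\<alpha>\<^sub>i - \<gamma>\<^sub>i\<close>, and eigenvectors to different eigenvalues can be separated. For a coordinate
  \<open>i\<close> in which \<open>\<gamma>\<^sub>0\<close> and the weight \<open>\<delta>\<close> of the wanted component differ, the operator
  \<open>Z\<^sub>i - \<alpha>\<^sub>i + \<gamma>\<^sub>0\<^sub>i\<close> removes the component of weight \<open>\<gamma>\<^sub>0\<close> and keeps a nonzero multiple of the other.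
\<close>

lemma weight_components_mem:
  fixes a :: "'n::{finite,linorder} \<Rightarrow> int ^ 'r"
  assumes J: "lideal J" "hg_ideal a \<alpha> \<subseteq> J" and "finite B"
  shows "(\<And>\<gamma>. \<gamma> \<in> B \<Longrightarrow> weight_op a \<gamma> (X \<gamma>)) \<Longrightarrow> (\<lambda>f. \<Sum>\<gamma>\<in>B. X \<gamma> f) \<in> J \<Longrightarrow> \<gamma> \<in> B \<Longrightarrow> X \<gamma> \<in> J"
  using \<open>finite B\<close>
proof (induction B arbitrary: X \<gamma> rule: finite_induct)
  case (insert \<gamma>\<^sub>0 B)
  define S where "S f = (\<Sum>\<gamma>\<in>insert \<gamma>\<^sub>0 B. X \<gamma> f)" for f
  have S: "S \<in> J" using insert.prems(2) by (simp only: S_def[abs_def])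
  have Sd: "S \<in> dops" by (rule lideal_dops[OF J(1) S])
  have rest: "X \<delta> \<in> J" if \<delta>: "\<delta> \<in> B" for \<delta>
  proof -
    from \<delta> insert.hyps obtain i where i: "\<delta> $ i \<noteq> \<gamma>\<^sub>0 $ i" by (metis vec_eq_iff)
    have E: "(\<lambda>f. euler_op a i f - scalar (\<alpha> $ i) * f) \<in> J" using euler_in_hg_ideal J(2) by blast
    have eS: "euler_op a i (S f) =
        S (euler_op a i f) - (\<Sum>\<gamma>\<in>insert \<gamma>\<^sub>0 B. scalar (of_int (\<gamma> $ i)) * X \<gamma> f)" for f
      unfolding S_def dops_sum_arg[OF dops_euler_op] sum_subtractf[symmetric]
      using insert.prems(1) by (intro sum.cong) (auto simp: weight_op_def)
    have 1: "(\<lambda>f. euler_op a i (S f) - S (euler_op a i f - scalar (\<alpha> $ i) * f)) \<in> J"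
      by (rule lideal_diff[OF J(1) lideal_comp[OF J(1) dops_euler_op S] lideal_comp[OF J(1) Sd E]])
    have 2: "(\<lambda>f. scalar (of_int (\<gamma>\<^sub>0 $ i) - \<alpha> $ i) * S f) \<in> J" by (rule lideal_smult[OF J(1) S])
    have "(euler_op a i (S f) - S (euler_op a i f - scalar (\<alpha> $ i) * f)) +
        scalar (of_int (\<gamma>\<^sub>0 $ i) - \<alpha> $ i) * S f =
        (\<Sum>\<gamma>\<in>B. scalar (of_int (\<gamma>\<^sub>0 $ i) - of_int (\<gamma> $ i)) * X \<gamma> f)" for f
    proof -
      have "(euler_op a i (S f) - S (euler_op a i f - scalar (\<alpha> $ i) * f)) +
          scalar (of_int (\<gamma>\<^sub>0 $ i) - \<alpha> $ i) * S f =
          scalar (of_int (\<gamma>\<^sub>0 $ i)) * S f - (\<Sum>\<gamma>\<in>insert \<gamma>\<^sub>0 B. scalar (of_int (\<gamma> $ i)) * X \<gamma> f)"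
        unfolding eS dops_diff_arg[OF Sd] dops_scalar_arg[OF Sd] scalar_diff left_diff_distrib by simp
      also have "\<dots> = (\<Sum>\<gamma>\<in>insert \<gamma>\<^sub>0 B. scalar (of_int (\<gamma>\<^sub>0 $ i) - of_int (\<gamma> $ i)) * X \<gamma> f)"
        unfolding S_def sum_distrib_left sum_subtractf[symmetric] scalar_diff left_diff_distrib ..
      finally show ?thesis using insert.hyps by simp
    qed
    with lideal_add[OF J(1) 1 2]
    have "(\<lambda>f. \<Sum>\<gamma>\<in>B. scalar (of_int (\<gamma>\<^sub>0 $ i) - of_int (\<gamma> $ i)) * X \<gamma> f) \<in> J" by (simp only:)
    then have "(\<lambda>f. scalar (of_int (\<gamma>\<^sub>0 $ i) - of_int (\<delta> $ i)) * X \<delta> f) \<in> J"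
      by (rule insert.IH[rotated]) (use \<delta> insert.prems(1) in \<open>auto intro: weight_op_scale\<close>)
    moreover have "scalar (of_int (\<gamma>\<^sub>0 $ i) - of_int (\<delta> $ i)) \<noteq> (0 :: 'n ratfun)"
      using i by (simp add: scalar_eq_0_iff)
    ultimately show ?thesis by (rule lideal_unit_smult[OF J(1)])
  qed
  have "(\<lambda>f. S f - (\<Sum>\<gamma>\<in>B. X \<gamma> f)) \<in> J"
    by (intro lideal_diff[OF J(1) S] lideal_sum[OF J(1)] rest)
  then have "X \<gamma>\<^sub>0 \<in> J" using insert.hyps by (simp add: S_def)
  then show ?case using rest insert.prems(3) by blast
qed simp

subsection \<open>The main argument\<close>

text \<open>
  For left ideals \<open>J\<close> and \<open>H\<close> this is \<open>J \<partial>\<^sup>w + H\<close>.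
\<close>

definition right_shift :: "('n::{finite,linorder} \<Rightarrow> nat) \<Rightarrow> 'n ratop set \<Rightarrow> 'n ratop set \<Rightarrow> 'n ratop set"
  where "right_shift w J H = {X \<in> dops. \<exists>Y\<in>J. (\<lambda>f. X f - Y (dpow w f)) \<in> H}"

lemma right_shiftI: "X \<in> dops \<Longrightarrow> Y \<in> J \<Longrightarrow> (\<lambda>f. X f - Y (dpow w f)) \<in> H \<Longrightarrow> X \<in> right_shift w J H"
  unfolding right_shift_def by (intro CollectI conjI bexI[of _ Y])

lemma right_shiftE:
  assumes "X \<in> right_shift w J H"
  obtains Y where "Y \<in> J" "(\<lambda>f. X f - Y (dpow w f)) \<in> H"
  using assms unfolding right_shift_def by (elim CollectE conjE bexE) (rule that)

lemma lideal_right_shift: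
  fixes J :: "'n::{finite,linorder} ratop set"
  assumes J: "lideal J" and H: "lideal H"
  shows "lideal (right_shift w J H)"
  unfolding lideal_def
proof (intro conjI ballI)
  show "right_shift w J H \<subseteq> dops" unfolding right_shift_def by blast
  show "(\<lambda>f. 0) \<in> right_shift w J H"
    by (rule right_shiftI[OF dops_zero lideal_zero[OF J]]) (simp add: lideal_zero[OF H])
  fix P Q assume P: "P \<in> right_shift w J H" and Q: "Q \<in> right_shift w J H"
  from P obtain Y where Y: "Y \<in> J" "(\<lambda>f. P f - Y (dpow w f)) \<in> H" by (rule right_shiftE)
  from Q obtain Z where Z: "Z \<in> J" "(\<lambda>f. Q f - Z (dpow w f)) \<in> H" by (rule right_shiftE)
  have "(\<lambda>f. P f + Q f) \<in> dops" using P Q unfolding right_shift_def by (intro dops_add) blast+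
  moreover have "(\<lambda>f. P f + Q f - (Y (dpow w f) + Z (dpow w f))) \<in> H"
    unfolding add_diff_add by (rule lideal_add[OF H Y(2) Z(2)])
  ultimately show "(\<lambda>f. P f + Q f) \<in> right_shift w J H"
    by (rule right_shiftI[OF _ lideal_add[OF J Y(1) Z(1)]])
next
  fix Q P :: "'n ratop" assume Q: "Q \<in> dops" and P: "P \<in> right_shift w J H"
  from P obtain Y where Y: "Y \<in> J" "(\<lambda>f. P f - Y (dpow w f)) \<in> H" by (rule right_shiftE)
  have "P \<in> dops" using P unfolding right_shift_def by blast
  then have "(\<lambda>f. Q (P f)) \<in> dops" by (rule dops_compose[OF Q])
  moreover have "(\<lambda>f. Q (P f) - Q (Y (dpow w f))) \<in> H"
    using lideal_comp[OF H Q Y(2)] unfolding dops_diff_arg[OF Q] .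
  ultimately show "(\<lambda>f. Q (P f)) \<in> right_shift w J H"
    by (rule right_shiftI[OF _ lideal_comp[OF J Q Y(1)]])
qed

lemma hg_ideal_maximal:
  fixes a :: "'n::{finite,linorder} \<Rightarrow> int ^ 'r"
  assumes gen: "range (\<lambda>c. \<Sum>j\<in>UNIV. c j *s a j) = UNIV" and bf: "has_b_functions a \<alpha>"
    and J: "lideal J" "hg_ideal a \<alpha> \<subseteq> J" and P: "P \<in> J" "P \<notin> hg_ideal a \<alpha>"
  shows "id \<in> J"
proof -
  \<comment> \<open>Pass from \<open>J\<close>, \<open>P\<close>, \<open>\<alpha>\<close> to \<open>J \<partial>\<^sup>w + H(\<alpha>')\<close>, \<open>g P \<partial>\<^sup>w\<close>, \<open>\<alpha>' = \<alpha> + A w\<close>.\<close>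
  obtain g where g: "g \<noteq> 0" "weyl (\<lambda>f. g * P f)"
    by (rule dops_clear_denominators[OF lideal_dops[OF J(1) P(1)]])
  define P' where "P' f = g * P f" for f
  have P'J: "P' \<in> J" unfolding P'_def by (rule lideal_smult[OF J(1) P(1)])
  have P'H: "P' \<notin> hg_ideal a \<alpha>"
    using lideal_unit_smult[OF lideal_hg_ideal _ g(1), of P a \<alpha>] P(2) unfolding P'_def by blast
  obtain w where "theta_form (\<lambda>f. P' (dpow w f))"
    using weyl_dpow_right_theta_form[OF g(2)] unfolding P'_def by blast
  then obtain S p where S: "finite S" and p: "\<forall>m. poly_fun (p m)"
    and P'w: "(\<lambda>f. P' (dpow w f)) = (\<lambda>f. \<Sum>m\<in>S. Theta (p m) (dpow m f))"
    unfolding theta_form_def by (elim exE conjE) (rule that)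
  define \<alpha>' where "\<alpha>' = \<alpha> + cvec (wt a w)"
  let ?H' = "hg_ideal a \<alpha>'"
  have bf': "has_b_functions a \<alpha>'" unfolding \<alpha>'_def by (rule has_b_functions_shift[OF bf])
  define J' where "J' = right_shift w J ?H'"
  have J': "lideal J'" unfolding J'_def by (rule lideal_right_shift[OF J(1) lideal_hg_ideal])
  have HJ': "?H' \<subseteq> J'"
  proof
    fix Z assume Z: "Z \<in> ?H'"
    show "Z \<in> J'" unfolding J'_def
      by (rule right_shiftI[OF lideal_dops[OF lideal_hg_ideal Z] lideal_zero[OF J(1)]]) (simp add: Z)
  qed
  have P'J': "(\<lambda>f. P' (dpow w f)) \<in> J'"
    unfolding J'_def
    by (rule right_shiftI[OF dops_compose[OF lideal_dops[OF J(1) P'J] dops_dpow] P'J])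
      (simp add: lideal_zero[OF lideal_hg_ideal])
  have P'H': "(\<lambda>f. P' (dpow w f)) \<notin> ?H'"
    using hg_ideal_dpow_right_cancel[OF gen bf lideal_dops[OF J(1) P'J], of w] P'H
    unfolding \<alpha>'_def by blast
  define X where "X \<gamma> f = (\<Sum>m\<in>{m\<in>S. wt a m = \<gamma>}. Theta (p m) (dpow m f))" for \<gamma> f
  have X: "weight_op a \<gamma> (X \<gamma>)" for \<gamma>
    unfolding X_def using weight_op_Theta_dpow[OF spec[OF p]] by (intro weight_op_sum) auto
  have sumX: "(\<lambda>f. P' (dpow w f)) = (\<lambda>f. \<Sum>\<gamma>\<in>wt a ` S. X \<gamma> f)"
    unfolding P'w X_def by (intro ext sum.image_gen[OF S])
  have XJ': "X \<gamma> \<in> J'" if "\<gamma> \<in> wt a ` S" for \<gamma>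
    by (rule weight_components_mem[OF J' HJ' finite_imageI[OF S] X P'J'[unfolded sumX] that])
  have "\<exists>\<gamma>\<in>wt a ` S. X \<gamma> \<notin> ?H'"
  proof (rule ccontr)
    assume "\<not> (\<exists>\<gamma>\<in>wt a ` S. X \<gamma> \<notin> ?H')"
    then have "(\<lambda>f. \<Sum>\<gamma>\<in>wt a ` S. X \<gamma> f) \<in> ?H'" by (intro lideal_sum[OF lideal_hg_ideal]) blast
    then show False using P'H' unfolding sumX by blast
  qed
  then obtain u where u: "u \<in> S" "X (wt a u) \<notin> ?H'" by blast
  \<comment> \<open>All monomials of one weight may be replaced by a single one of them.\<close>
  define T where "T = {m\<in>S. wt a m = wt a u}"
  define q where "q \<theta> = (\<Sum>m\<in>T. p m \<theta>)" for \<theta>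
  have q: "poly_fun q" unfolding q_def by (intro poly_fun_sum spec[OF p])
  have pm: "Theta (p m) \<in> dops" for m by (rule Theta_in_dops[OF spec[OF p]])
  have "(\<lambda>f. \<Sum>m\<in>T. Theta (p m) (dpow u f - dpow m f)) \<in> toric_ideal a"
  proof (rule lideal_sum[OF lideal_toric_ideal])
    fix m assume "m \<in> T"
    then have "wt a u = wt a m" by (simp add: T_def)
    then show "(\<lambda>f. Theta (p m) (dpow u f - dpow m f)) \<in> toric_ideal a"
      by (rule lideal_comp[OF lideal_toric_ideal pm dpow_diff_in_toric_ideal])
  qed
  moreover have "(\<Sum>m\<in>T. Theta (p m) (dpow u f - dpow m f)) = Theta q (dpow u f) - X (wt a u) f" for f
  proof -
    have "(\<Sum>m\<in>T. Theta (p m) (dpow u f - dpow m f)) =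
        (\<Sum>m\<in>T. Theta (p m) (dpow u f)) - (\<Sum>m\<in>T. Theta (p m) (dpow m f))"
      unfolding sum_subtractf[symmetric] dops_diff_arg[OF pm] ..
    moreover have "Theta q (dpow u f) = (\<Sum>m\<in>T. Theta (p m) (dpow u f))"
      unfolding q_def by (rule Theta_sum[OF spec[OF p]])
    ultimately show ?thesis by (simp only: X_def T_def)
  qed
  ultimately have D: "(\<lambda>f. Theta q (dpow u f) - X (wt a u) f) \<in> ?H'"
    using subsetD[OF toric_ideal_subset_hg_ideal] by (simp only:)
  have qJ': "(\<lambda>f. Theta q (dpow u f)) \<in> J'"
  proof -
    have "(\<lambda>f. (Theta q (dpow u f) - X (wt a u) f) + X (wt a u) f) \<in> J'"
      by (rule lideal_add[OF J' subsetD[OF HJ' D] XJ'[OF imageI[OF u(1)]]])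
    then show ?thesis by simp
  qed
  have qH': "(\<lambda>f. Theta q (dpow u f)) \<notin> ?H'"
  proof
    assume "(\<lambda>f. Theta q (dpow u f)) \<in> ?H'"
    from lideal_diff[OF lideal_hg_ideal this D] have "X (wt a u) \<in> ?H'" by simp
    with u(2) show False by blast
  qed
  have "\<exists>\<theta>. cwt a \<theta> + cvec (wt a u) = \<alpha>' \<and> q \<theta> \<noteq> 0"
  proof (rule ccontr)
    assume "\<not> (\<exists>\<theta>. cwt a \<theta> + cvec (wt a u) = \<alpha>' \<and> q \<theta> \<noteq> 0)"
    then have "q \<theta> = 0" if "cwt a \<theta> + cvec (wt a u) = \<alpha>'" for \<theta> using that by blast
    with qH' show False using Theta_in_hg_ideal[OF gen q] by blast
  qed
  then obtain \<theta> where \<theta>: "cwt a \<theta> + cvec (wt a u) = \<alpha>'" "q \<theta> \<noteq> 0" by blast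
  obtain n where "poly_less n q" using q by (auto simp: poly_fun_def)
  from unit_if_Theta_mem[OF gen bf' J' HJ' this qJ' \<theta>] have "id \<in> J'" .
  from lideal_comp[OF J' dops_dpow this, of w] have "dpow w \<in> J'" by simp
  \<comment> \<open>So \<open>\<partial>\<^sup>w\<close> lies in \<open>J \<partial>\<^sup>w + H(\<alpha>')\<close>; cancelling \<open>\<partial>\<^sup>w\<close> shows that \<open>1 - Y\<close> is in \<open>H(\<alpha>)\<close>.\<close>
  then obtain Y where Y: "Y \<in> J" and YH: "(\<lambda>f. dpow w f - Y (dpow w f)) \<in> ?H'"
    unfolding J'_def by (rule right_shiftE)
  from YH have "(\<lambda>f. id (dpow w f) - Y (dpow w f)) \<in> hg_ideal a (\<alpha> + cvec (wt a w))"
    by (simp only: \<alpha>'_def id_apply)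
  then have "(\<lambda>g. id g - Y g) \<in> hg_ideal a \<alpha>"
    by (rule hg_ideal_dpow_right_cancel[OF gen bf dops_diff[OF dops_id lideal_dops[OF J(1) Y]]])
  then have "(\<lambda>g. id g - Y g) \<in> J" using J(2) by blast
  from lideal_add[OF J(1) this Y] show ?thesis by (simp add: id_def)
qed

theorem theorem1p2:
  fixes a :: "'n::{finite,linorder} \<Rightarrow> int ^ 'r"
    and \<alpha> :: "complex ^ 'r"
  assumes "inj a"
    and "CARD('n) > CARD('r)"
    and "range (\<lambda>c. \<Sum>j\<in>UNIV. c j *s a j) = (UNIV :: (int ^ 'r) set)"
    and "\<exists>h :: real ^ 'r \<Rightarrow> real. linear h \<and> (\<forall>j. h (real_vec (a j)) = 1)"
    and "nonresonant a \<alpha>"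
  shows "hg_irreducible a \<alpha>"
proof (rule hg_irreducibleI)
  fix J assume J: "lideal J" "hg_ideal a \<alpha> \<subseteq> J" "J \<noteq> hg_ideal a \<alpha>"
  then obtain P where "P \<in> J" "P \<notin> hg_ideal a \<alpha>" by blast
  then show "id \<in> J"
    by (rule hg_ideal_maximal[OF assms(3) nonresonant_imp_has_b_functions[OF assms(3,5)] J(1,2)])
qed

end
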